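(* Let $\gamma\colon I\to \mathbb{R}^{n+1}$ be a unit-speed curve. Let $\xi_1, \ldots, \xi_{n}$ be a parallel orthonormal frame of $N_{\gamma}I$ and let $\varphi, \beta_i\in C^{\infty}(I)$, $1\leq i\leq n$, satisfy $\beta_i'+\varphi' k_i=0$, where $\gamma''=\sum_{i=1}^{n}k_i\xi_i$. Let $\alpha=(\alpha_1,\dots,\alpha_n)\colon J\to \mathbb{R}^{n}$ be a unit-speed curve. Then the map $f\colon I\times J\to \mathbb{R}^{n+1}$ given by $$ f(s,t)=\gamma(s)-2\varphi(s)\frac{\varphi'(s)\gamma'(s)+\sum_{i=1}^{n} (\beta_i(s)+\alpha_i(t))\xi_i(s)}{(\varphi'(s))^2+\sum_{i=1}^{n} (\beta_i(s)+\alpha_i(t))^2} $$ parametrizes, at regular points, a surface with flat normal bundle whose coordinate curves are lines of curvature and such that the $t$-coordinate curves have constant geodesic curvature. Conversely, any umbilic-free surface with flat normal bundle whose lines of curvature of one family have constant geodesic curvature can be locally parametrized in this way.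
   Context: $I,J\subset\mathbb{R}$ are open intervals; $N_\gamma I$ is the normal bundle of $\gamma$, and "parallel" means parallel in the normal connection along $\gamma$ (so $\xi_i'=-k_i\gamma'$). For a surface in $\mathbb{R}^{n+1}$ with flat normal bundle, the shape operators commute, and lines of curvature are curves whose tangent vectors are eigenvectors of all shape operators. Surfaces in the converse are surfaces in $\mathbb{R}^{n+1}$. The $t$-coordinate curves are the curves $t\mapsto f(s,t)$ with $s$ fixed; "constant geodesic curvature" means that each such curve has constant geodesic curvature (the constant may depend on the curve). *)

theory Defs
  imports "HOL-Analysis.Analysis"
begin

primrec Ck_on :: "nat \<Rightarrow> 'a set \<Rightarrow> ('a::euclidean_space \<Rightarrow> 'b::euclidean_space) \<Rightarrow> bool" where
  "Ck_on 0 S f \<longleftrightarrow> continuous_on S f"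
| "Ck_on (Suc k) S f \<longleftrightarrow>
     (\<forall>x\<in>S. f differentiable (at x)) \<and> (\<forall>v. Ck_on k S (\<lambda>x. frechet_derivative f (at x) v))"

text \<open>Class \<open>C\<^sup>\<infinity>\<close>; only meant for open \<open>S\<close>, since the derivatives are taken with
  respect to the whole space.\<close>

definition smooth_on :: "'a set \<Rightarrow> ('a::euclidean_space \<Rightarrow> 'b::euclidean_space) \<Rightarrow> bool" where
  "smooth_on S f \<longleftrightarrow> (\<forall>k. Ck_on k S f)"

definition diffeomorphism_between ::
    "'a set \<Rightarrow> 'b set \<Rightarrow> ('a::euclidean_space \<Rightarrow> 'b::euclidean_space) \<Rightarrow> bool" where
  "diffeomorphism_between A B \<psi> \<longleftrightarrow>
     open A \<and> open B \<and> bij_betw \<psi> A B \<and> smooth_on A \<psi> \<and> smooth_on B (inv_into A \<psi>)"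

definition open_interval :: "real set \<Rightarrow> bool" where
  "open_interval I \<longleftrightarrow> open I \<and> is_interval I \<and> I \<noteq> {}"

abbreviation velocity :: "(real \<Rightarrow> 'a::real_normed_vector) \<Rightarrow> real \<Rightarrow> 'a" where
  "velocity c t \<equiv> vector_derivative c (at t)"

definition unit_speed_curve :: "real set \<Rightarrow> (real \<Rightarrow> 'a::euclidean_space) \<Rightarrow> bool" where
  "unit_speed_curve I c \<longleftrightarrow> open_interval I \<and> smooth_on I c \<and> (\<forall>t\<in>I. norm (velocity c t) = 1)"

text \<open>A surface is an immersion \<open>g\<close> of an open subset \<open>U\<close> of the plane, whose points are the
  parameters; tangent vectors of the surface are represented by vectors of the plane, and normal
  vectors are vectors of the ambient space.\<close>

definition immersed_surface :: "(real \<times> real) set \<Rightarrow> (real \<times> real \<Rightarrow> 'a::euclidean_space) \<Rightarrow> bool" where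
  "immersed_surface U g \<longleftrightarrow>
     open U \<and> smooth_on U g \<and> (\<forall>p\<in>U. inj (frechet_derivative g (at p)))"

definition tangent_plane :: "(real \<times> real \<Rightarrow> 'a::euclidean_space) \<Rightarrow> real \<times> real \<Rightarrow> 'a set" where
  "tangent_plane g p = range (frechet_derivative g (at p))"

definition normal_space :: "(real \<times> real \<Rightarrow> 'a::euclidean_space) \<Rightarrow> real \<times> real \<Rightarrow> 'a set" where
  "normal_space g p = (tangent_plane g p)\<^sup>\<bottom>"

definition tangential_part :: "(real \<times> real \<Rightarrow> 'a::euclidean_space) \<Rightarrow> real \<times> real \<Rightarrow> 'a \<Rightarrow> 'a" where
  "tangential_part g p x = (THE y. y \<in> tangent_plane g p \<and> x - y \<in> normal_space g p)"

definition normal_part :: "(real \<times> real \<Rightarrow> 'a::euclidean_space) \<Rightarrow> real \<times> real \<Rightarrow> 'a \<Rightarrow> 'a" where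
  "normal_part g p x = x - tangential_part g p x"

definition second_fundamental_form ::
    "(real \<times> real \<Rightarrow> 'a::euclidean_space) \<Rightarrow> real \<times> real \<Rightarrow> real \<times> real \<Rightarrow> real \<times> real \<Rightarrow> 'a" where
  "second_fundamental_form g p u v =
     normal_part g p (frechet_derivative (\<lambda>q. frechet_derivative g (at q) v) (at p) u)"

definition shape_operator ::
    "(real \<times> real \<Rightarrow> 'a::euclidean_space) \<Rightarrow> real \<times> real \<Rightarrow> 'a \<Rightarrow> real \<times> real \<Rightarrow> real \<times> real" where
  "shape_operator g p \<xi> u =
     (THE w. \<forall>v. frechet_derivative g (at p) w \<bullet> frechet_derivative g (at p) v
                 = second_fundamental_form g p u v \<bullet> \<xi>)"

definition umbilic :: "(real \<times> real \<Rightarrow> 'a::euclidean_space) \<Rightarrow> real \<times> real \<Rightarrow> bool" where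
  "umbilic g p \<longleftrightarrow>
     (\<exists>H\<in>normal_space g p. \<forall>u v. second_fundamental_form g p u v
        = (frechet_derivative g (at p) u \<bullet> frechet_derivative g (at p) v) *\<^sub>R H)"

definition normal_connection ::
    "(real \<times> real \<Rightarrow> 'a::euclidean_space) \<Rightarrow> real \<times> real \<Rightarrow> (real \<times> real \<Rightarrow> 'a) \<Rightarrow> real \<times> real \<Rightarrow> 'a" where
  "normal_connection g u \<eta> q = normal_part g q (frechet_derivative \<eta> (at q) u)"

text \<open>The curvature tensor of the normal connection is evaluated on the constant vector fields
  \<open>u\<close> and \<open>v\<close> of the parameter plane, whose Lie bracket vanishes.\<close>

definition flat_normal_bundle :: "(real \<times> real) set \<Rightarrow> (real \<times> real \<Rightarrow> 'a::euclidean_space) \<Rightarrow> bool" where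
  "flat_normal_bundle U g \<longleftrightarrow>
     (\<forall>V \<eta>. open V \<and> V \<subseteq> U \<and> smooth_on V \<eta> \<and> (\<forall>q\<in>V. \<eta> q \<in> normal_space g q) \<longrightarrow>
        (\<forall>q\<in>V. \<forall>u v. normal_connection g u (normal_connection g v \<eta>) q
                     - normal_connection g v (normal_connection g u \<eta>) q = 0))"

definition principal_direction ::
    "(real \<times> real \<Rightarrow> 'a::euclidean_space) \<Rightarrow> real \<times> real \<Rightarrow> real \<times> real \<Rightarrow> bool" where
  "principal_direction g p u \<longleftrightarrow>
     u \<noteq> 0 \<and> (\<forall>\<xi>\<in>normal_space g p. \<exists>a. shape_operator g p \<xi> u = a *\<^sub>R u)"

text \<open>The curve on the surface is \<open>g \<circ> c\<close>, with \<open>c\<close> a curve in the parameter plane.\<close>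

definition line_of_curvature ::
    "(real \<times> real) set \<Rightarrow> (real \<times> real \<Rightarrow> 'a::euclidean_space) \<Rightarrow> real set \<Rightarrow> (real \<Rightarrow> real \<times> real) \<Rightarrow> bool" where
  "line_of_curvature U g K c \<longleftrightarrow>
     open_interval K \<and> smooth_on K c \<and> c ` K \<subseteq> U \<and>
     (\<forall>t\<in>K. principal_direction g (c t) (velocity c t))"

text \<open>A family of lines of curvature is given by its field \<open>L\<close> of tangent lines, a continuous
  choice of a common eigenline of the shape operators. The field need not be orientable, so it is
  only locally spanned by a vector field.\<close>

definition curvature_line_field ::
    "(real \<times> real) set \<Rightarrow> (real \<times> real \<Rightarrow> 'a::euclidean_space) \<Rightarrow> (real \<times> real \<Rightarrow> (real \<times> real) set) \<Rightarrow> bool" where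
  "curvature_line_field U g L \<longleftrightarrow>
     (\<forall>p\<in>U. \<exists>V X. open V \<and> p \<in> V \<and> V \<subseteq> U \<and> continuous_on V X \<and>
        (\<forall>q\<in>V. principal_direction g q (X q) \<and> L q = span {X q}))"

definition line_of_family ::
    "(real \<times> real) set \<Rightarrow> (real \<times> real \<Rightarrow> 'a::euclidean_space) \<Rightarrow> (real \<times> real \<Rightarrow> (real \<times> real) set)
      \<Rightarrow> real set \<Rightarrow> (real \<Rightarrow> real \<times> real) \<Rightarrow> bool" where
  "line_of_family U g L K c \<longleftrightarrow>
     line_of_curvature U g K c \<and> (\<forall>t\<in>K. velocity c t \<in> L (c t))"

text \<open>Norm of the covariant derivative of the unit tangent with respect to arc length. No
  orientation of the surface enters; on an interval the signed geodesic curvature, being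
  continuous, is constant iff this is.\<close>

definition geodesic_curvature ::
    "(real \<times> real \<Rightarrow> 'a::euclidean_space) \<Rightarrow> (real \<Rightarrow> real \<times> real) \<Rightarrow> real \<Rightarrow> real" where
  "geodesic_curvature g c t =
     norm (tangential_part g (c t)
       (velocity (\<lambda>\<tau>. sgn (velocity (g \<circ> c) \<tau>)) t /\<^sub>R norm (velocity (g \<circ> c) t)))"

definition constant_geodesic_curvature ::
    "(real \<times> real \<Rightarrow> 'a::euclidean_space) \<Rightarrow> real set \<Rightarrow> (real \<Rightarrow> real \<times> real) \<Rightarrow> bool" where
  "constant_geodesic_curvature g K c \<longleftrightarrow> (\<exists>\<kappa>. \<forall>t\<in>K. geodesic_curvature g c t = \<kappa>)"

text \<open>Intended for \<open>CARD('m) = CARD('n) + 1\<close>: then \<open>CARD('n)\<close> orthonormal normal vectors form a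
  basis of the normal space of the curve, and \<open>\<xi> i\<close> is parallel in the normal connection iff its
  derivative is tangent to the curve.\<close>

definition parallel_orthonormal_frame ::
    "real set \<Rightarrow> (real \<Rightarrow> real^'m) \<Rightarrow> ('n::finite \<Rightarrow> real \<Rightarrow> real^'m) \<Rightarrow> bool" where
  "parallel_orthonormal_frame I \<gamma> \<xi> \<longleftrightarrow>
     (\<forall>i. smooth_on I (\<xi> i)) \<and>
     (\<forall>s\<in>I. \<forall>i. \<xi> i s \<bullet> velocity \<gamma> s = 0) \<and>
     (\<forall>s\<in>I. \<forall>i j. \<xi> i s \<bullet> \<xi> j s = (if i = j then 1 else 0)) \<and>
     (\<forall>s\<in>I. \<forall>i. velocity (\<xi> i) s \<in> span {velocity \<gamma> s})"

definition construction_data ::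
    "real set \<Rightarrow> real set \<Rightarrow> (real \<Rightarrow> real^'m) \<Rightarrow> ('n::finite \<Rightarrow> real \<Rightarrow> real^'m) \<Rightarrow> ('n \<Rightarrow> real \<Rightarrow> real)
      \<Rightarrow> (real \<Rightarrow> real) \<Rightarrow> ('n \<Rightarrow> real \<Rightarrow> real) \<Rightarrow> (real \<Rightarrow> real^'n) \<Rightarrow> bool" where
  "construction_data I J \<gamma> \<xi> k \<phi> \<beta> \<alpha> \<longleftrightarrow>
     unit_speed_curve I \<gamma> \<and>
     parallel_orthonormal_frame I \<gamma> \<xi> \<and>
     (\<forall>s\<in>I. velocity (velocity \<gamma>) s = (\<Sum>i\<in>UNIV. k i s *\<^sub>R \<xi> i s)) \<and>
     smooth_on I \<phi> \<and> (\<forall>i. smooth_on I (\<beta> i)) \<and>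
     (\<forall>s\<in>I. \<forall>i. deriv (\<beta> i) s + deriv \<phi> s * k i s = 0) \<and>
     unit_speed_curve J \<alpha>"

definition construction_denom ::
    "(real \<Rightarrow> real) \<Rightarrow> ('n::finite \<Rightarrow> real \<Rightarrow> real) \<Rightarrow> (real \<Rightarrow> real^'n) \<Rightarrow> real \<times> real \<Rightarrow> real" where
  "construction_denom \<phi> \<beta> \<alpha> = (\<lambda>(s, t). (deriv \<phi> s)\<^sup>2 + (\<Sum>i\<in>UNIV. (\<beta> i s + \<alpha> t $ i)\<^sup>2))"

definition construction_map ::
    "(real \<Rightarrow> real^'m) \<Rightarrow> ('n::finite \<Rightarrow> real \<Rightarrow> real^'m) \<Rightarrow> (real \<Rightarrow> real) \<Rightarrow> ('n \<Rightarrow> real \<Rightarrow> real)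
      \<Rightarrow> (real \<Rightarrow> real^'n) \<Rightarrow> real \<times> real \<Rightarrow> real^'m" where
  "construction_map \<gamma> \<xi> \<phi> \<beta> \<alpha> = (\<lambda>(s, t).
     \<gamma> s - (2 * \<phi> s) *\<^sub>R
       ((deriv \<phi> s *\<^sub>R velocity \<gamma> s + (\<Sum>i\<in>UNIV. (\<beta> i s + \<alpha> t $ i) *\<^sub>R \<xi> i s))
         /\<^sub>R construction_denom \<phi> \<beta> \<alpha> (s, t)))"

text \<open>A zero of the denominator, where the map is not defined, is not a regular point.\<close>

definition regular_points ::
    "real set \<Rightarrow> real set \<Rightarrow> (real \<Rightarrow> real^'m) \<Rightarrow> ('n::finite \<Rightarrow> real \<Rightarrow> real^'m) \<Rightarrow> (real \<Rightarrow> real)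
      \<Rightarrow> ('n \<Rightarrow> real \<Rightarrow> real) \<Rightarrow> (real \<Rightarrow> real^'n) \<Rightarrow> (real \<times> real) set" where
  "regular_points I J \<gamma> \<xi> \<phi> \<beta> \<alpha> =
     {x \<in> I \<times> J. construction_denom \<phi> \<beta> \<alpha> x \<noteq> 0 \<and>
        inj (frechet_derivative (construction_map \<gamma> \<xi> \<phi> \<beta> \<alpha>) (at x))}"

end

theory Submission
  imports Defs
begin

text \<open>Let \<open>N\<close> be the vector inverted in the construction and \<open>R\<close> the reflection in the hyperplane
  orthogonal to \<open>N\<close>. Both partial derivatives of the map are multiples of images under \<open>R\<close> of orthogonal
  vectors: one of \<open>R \<gamma>'\<close>, the other of \<open>R (\<partial>N/\<partial>t)\<close>. The \<open>t\<close>-derivative of \<open>R \<gamma>'\<close> is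
  \<open>\<phi>'/\<phi>\<close> times the \<open>t\<close>-partial derivative of the map. Hence the coordinates are orthogonal and conjugate,
  and the \<open>t\<close>-curves have geodesic curvature \<open>\<bar>\<phi>'/\<phi>\<bar>\<close>.

  Conversely, at a point that is not umbilic the given line field is a simple root of a quadratic equation,
  hence smooth, and curvature line coordinates arise from first integrals. If \<open>w\<close> is the surface in these
  coordinates and \<open>X\<close> the unit vector along \<open>\<partial>w/\<partial>s\<close>, constant geodesic curvature makes \<open>X + \<nu> w\<close>
  independent of \<open>t\<close>, where \<open>\<nu>\<close> depends only on \<open>s\<close>. Each \<open>t\<close>-curve therefore lies in a sphere or a
  hyperplane that meets the surface orthogonally. For \<open>\<gamma>\<close> one can take another \<open>s\<close>-curve \<open>w(\<cdot>, t\<^sub>1)\<close> of the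
  same surface, parametrized by arc length. With \<open>\<phi>' = - \<nu> \<phi>\<close> the inversion turns the chord \<open>w - \<gamma>\<close> into
  \<open>N\<close>, whose components in a parallel frame of \<open>\<gamma>\<close> have \<open>s\<close>-derivatives independent of \<open>t\<close>, so they
  split as \<open>\<beta>\<^sub>i(s) + \<alpha>\<^sub>i(t)\<close>.\<close>

section \<open>Calculus of smooth maps\<close>

text \<open>Two choices in the converse need a reason. Equating a surface with the map means c = -2
  \<phi> N / |N|^2 for the chord c = w - \<gamma>, hence N = -2 \<phi> c / |c|^2, so c must not
  vanish near the given point. This is why the base curve passes through a different point of the
  same t-curve. Moreover the component of N along \<gamma>' has to be \<phi>'. Since the t-curve
  satisfies the sphere equation \<nu> |c|^2 = 2 \<gamma>' . c, that component is -\<nu> \<phi>, and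
  this is the origin of \<phi>' = -\<nu> \<phi>. The recurring obstacle is regularity. The line
  field is only continuous, the geodesic curvature is known only up to sign, and the existence
  theorems yield first derivatives only. The field is made smooth by solving its quadratic equation
  explicitly, the sign is fixed by continuity, and solutions, flows and inverse maps gain one order
  at a time, because their derivatives are smooth expressions in the maps themselves.\<close>

lemma has_derivative_cong_open:
  assumes "open S" "x \<in> S" "\<And>y. y \<in> S \<Longrightarrow> f y = g y"
  shows "(f has_derivative f') (at x) \<longleftrightarrow> (g has_derivative f') (at x)"
  using has_derivative_transform_within_open[of f f' x UNIV S g]
    has_derivative_transform_within_open[of g f' x UNIV S f] assms by auto

lemma frechet_derivative_cong:
  assumes "open S" "x \<in> S" "\<And>y. y \<in> S \<Longrightarrow> f y = g y"
  shows "frechet_derivative f (at x) = frechet_derivative g (at x)"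
  using has_derivative_cong_open[OF assms] by (simp add: frechet_derivative_def)

lemma differentiable_cong_open:
  assumes "open S" "x \<in> S" "\<And>y. y \<in> S \<Longrightarrow> f y = g y"
  shows "f differentiable (at x) \<longleftrightarrow> g differentiable (at x)"
  using has_derivative_cong_open[OF assms] by (simp add: differentiable_def)

text \<open>On an open \<open>S\<close> the values on \<open>S\<close> determine the derivatives at
  its points, so equality of maps survives every order. This permits replacing a derivative by a
  formula that is valid on \<open>S\<close> only.\<close>

lemma Ck_on_cong:
  fixes f g :: "'a::euclidean_space \<Rightarrow> 'b::euclidean_space"
  assumes "open S" and "\<And>x. x \<in> S \<Longrightarrow> f x = g x"
  shows "Ck_on k S f \<longleftrightarrow> Ck_on k S g"
  using assms(2)
proof (induction k arbitrary: f g)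
  case 0
  then show ?case by (simp cong: continuous_on_cong)
next
  case (Suc k)
  have 1: "f differentiable (at x) \<longleftrightarrow> g differentiable (at x)" if "x \<in> S" for x
    using differentiable_cong_open[OF assms(1) that Suc.prems] .
  have 2: "frechet_derivative f (at x) = frechet_derivative g (at x)" if "x \<in> S" for x
    using frechet_derivative_cong[OF assms(1) that Suc.prems] .
  have "Ck_on k S (\<lambda>x. frechet_derivative f (at x) v) = Ck_on k S (\<lambda>x. frechet_derivative g (at x) v)" for v
    by (rule Suc.IH) (simp add: 2)
  then show ?case using 1 by simp
qed

lemma Ck_on_subset: "Ck_on k S f \<Longrightarrow> T \<subseteq> S \<Longrightarrow> Ck_on k T f"
  by (induction k arbitrary: f) (auto intro: continuous_on_subset)

lemma Ck_on_Suc_D: "Ck_on (Suc k) S f \<Longrightarrow> Ck_on k S f"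
proof (induction k arbitrary: f)
  case 0
  then show ?case
    by (auto intro!: continuous_at_imp_continuous_on differentiable_imp_continuous_within)
next
  case (Suc k)
  then show ?case by (metis Ck_on.simps(2))
qed

lemma Ck_on_le: "Ck_on n S f \<Longrightarrow> m \<le> n \<Longrightarrow> Ck_on m S f"
  by (induction n) (auto simp: le_Suc_eq simp del: Ck_on.simps(2) dest: Ck_on_Suc_D)

lemma Ck_on_imp_continuous_on: "Ck_on k S f \<Longrightarrow> continuous_on S f"
  using Ck_on_le[of k S f 0] by simp

text \<open>Lets an induction on \<open>k\<close> work with any correct formula \<open>f'\<close>
  for the derivative in place of \<open>frechet_derivative\<close>, about which nothing is known
  outside \<open>S\<close>.\<close>

lemma Ck_on_Suc_has_derivative:
  assumes "open S"
    and "\<And>x. x \<in> S \<Longrightarrow> (f has_derivative f' x) (at x)"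
    and "\<And>v. Ck_on k S (\<lambda>x. f' x v)"
  shows "Ck_on (Suc k) S f"
proof -
  have "frechet_derivative f (at x) = f' x" if "x \<in> S" for x
    using assms(2)[OF that] frechet_derivative_at by metis
  then have "Ck_on k S (\<lambda>x. frechet_derivative f (at x) v)" for v
    using assms(3)[of v] Ck_on_cong[OF assms(1), of "\<lambda>x. frechet_derivative f (at x) v" "\<lambda>x. f' x v"]
    by simp
  then show ?thesis using assms(2) by (auto simp: differentiable_def)
qed

lemma Ck_on_const: "Ck_on k S (\<lambda>x. c)"
  by (induction k arbitrary: c) (auto simp: frechet_derivative_const)

lemma Ck_on_add:
  assumes "open S" "Ck_on k S f" "Ck_on k S g"
  shows "Ck_on k S (\<lambda>x. f x + g x)"
  using assms(2,3)
proof (induction k arbitrary: f g)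
  case 0
  then show ?case by (auto intro: continuous_intros)
next
  case (Suc k)
  show ?case
    by (rule Ck_on_Suc_has_derivative[OF assms(1), where f' = "\<lambda>x v. frechet_derivative f (at x) v + frechet_derivative g (at x) v"])
      (use Suc in \<open>auto intro!: has_derivative_add simp: frechet_derivative_works[symmetric]\<close>)
qed

text \<open>One induction covers products, scalar multiples and inner products. The product rule
  leaves one factor of each summand undifferentiated; that factor is lowered from order
  \<open>Suc k\<close> to \<open>k\<close> before the induction hypothesis is applied.\<close>

lemma Ck_on_bilinear:
  assumes "bounded_bilinear B" "open S" "Ck_on k S f" "Ck_on k S g"
  shows "Ck_on k S (\<lambda>x. B (f x) (g x))"
  using assms(3,4)
proof (induction k arbitrary: f g)
  case 0
  then show ?case by (auto intro: bounded_bilinear.continuous_on[OF assms(1)])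
next
  case (Suc k)
  show ?case
  proof (rule Ck_on_Suc_has_derivative[OF assms(2), where f' = "\<lambda>x v. B (f x) (frechet_derivative g (at x) v) + B (frechet_derivative f (at x) v) (g x)"])
    fix x assume "x \<in> S"
    then show "((\<lambda>x. B (f x) (g x)) has_derivative
        (\<lambda>v. B (f x) (frechet_derivative g (at x) v) + B (frechet_derivative f (at x) v) (g x))) (at x)"
      using Suc.prems by (auto intro!: bounded_bilinear.FDERIV[OF assms(1)] simp: frechet_derivative_works[symmetric])
  next
    fix v
    show "Ck_on k S (\<lambda>x. B (f x) (frechet_derivative g (at x) v) + B (frechet_derivative f (at x) v) (g x))"
      using Suc.prems Suc.prems[THEN Ck_on_Suc_D] by (auto intro!: Ck_on_add assms Suc.IH)
  qed
qed

lemma Ck_on_bounded_linear: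
  assumes "bounded_linear h" "open S" "Ck_on k S f"
  shows "Ck_on k S (\<lambda>x. h (f x))"
  using assms(3)
proof (induction k arbitrary: f)
  case 0
  then show ?case by (auto intro: bounded_linear.continuous_on[OF assms(1)])
next
  case (Suc k)
  show ?case
    by (rule Ck_on_Suc_has_derivative[OF assms(2), where f' = "\<lambda>x v. h (frechet_derivative f (at x) v)"])
      (use Suc in \<open>auto intro!: bounded_linear.has_derivative[OF assms(1)] simp: frechet_derivative_works[symmetric]\<close>)
qed

lemma Ck_on_ident:
  assumes "open S"
  shows "Ck_on k S (\<lambda>x. x)"
  by (cases k)
     (auto intro!: Ck_on_Suc_has_derivative[OF assms, where f' = "\<lambda>x v. v"] Ck_on_const has_derivative_ident simp del: Ck_on.simps(2))

lemma Ck_on_sum: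
  assumes "open S" "\<And>i. i \<in> A \<Longrightarrow> Ck_on k S (f i)"
  shows "Ck_on k S (\<lambda>x. \<Sum>i\<in>A. f i x)"
  using assms(2)
  by (induction A rule: infinite_finite_induct) (auto intro: Ck_on_const Ck_on_add[OF assms(1)])

lemma linear_eq_sum_Basis:
  fixes f :: "'a::euclidean_space \<Rightarrow> 'b::real_vector"
  assumes "linear f"
  shows "f v = (\<Sum>i\<in>Basis. (v \<bullet> i) *\<^sub>R f i)"
  using linear_sum[OF assms, of "\<lambda>i. (v \<bullet> i) *\<^sub>R i" Basis] 
  by (simp add: euclidean_representation linear_cmul[OF assms])

text \<open>\<open>Ck_on\<close> controls the derivative of \<open>g\<close> in fixed directions
  only, while the chain rule evaluates it in a direction that varies with the point. Expanding that
  direction over \<open>Basis\<close> leaves fixed directions with varying coefficients.\<close>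

lemma Ck_on_compose:
  assumes "open S" "open T" "f ` S \<subseteq> T" "Ck_on k T g" "Ck_on k S f"
  shows "Ck_on k S (\<lambda>x. g (f x))"
  using assms(4,5)
proof (induction k arbitrary: g)
  case 0
  then show ?case using continuous_on_compose2[of T g S f] assms(3) by auto
next
  case (Suc k)
  show ?case
  proof (rule Ck_on_Suc_has_derivative[OF assms(1), where f' = "\<lambda>x v. frechet_derivative g (at (f x)) (frechet_derivative f (at x) v)"])
    fix x assume x: "x \<in> S"
    with assms(3) have "f x \<in> T" by auto
    with x show "((\<lambda>x. g (f x)) has_derivative (\<lambda>v. frechet_derivative g (at (f x)) (frechet_derivative f (at x) v))) (at x)"
      using Suc.prems by (intro has_derivative_compose[of f _ x UNIV g, simplified])
        (auto simp: frechet_derivative_works[symmetric])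
  next
    fix v
    have *: "frechet_derivative g (at (f x)) (frechet_derivative f (at x) v)
      = (\<Sum>i\<in>Basis. (frechet_derivative f (at x) v \<bullet> i) *\<^sub>R frechet_derivative g (at (f x)) i)" if "x \<in> S" for x
      using that Suc.prems assms(3) by (intro linear_eq_sum_Basis linear_frechet_derivative) auto
    have "Ck_on k S (\<lambda>x. \<Sum>i\<in>Basis. (frechet_derivative f (at x) v \<bullet> i) *\<^sub>R frechet_derivative g (at (f x)) i)"
    proof (intro Ck_on_sum assms(1) Ck_on_bilinear[OF bounded_bilinear_scaleR])
      fix i :: 'b
      show "Ck_on k S (\<lambda>x. frechet_derivative f (at x) v \<bullet> i)"
        by (rule Ck_on_bounded_linear[OF bounded_linear_inner_left assms(1)]) (use Suc.prems in auto)
      show "Ck_on k S (\<lambda>x. frechet_derivative g (at (f x)) i)"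
        by (rule Suc.IH) (use Suc.prems Suc.prems(2)[THEN Ck_on_Suc_D] in auto)
    qed
    then show "Ck_on k S (\<lambda>x. frechet_derivative g (at (f x)) (frechet_derivative f (at x) v))"
      using Ck_on_cong[OF assms(1) *] by simp
  qed
qed

lemma Ck_on_Suc_real:
  fixes f :: "real \<Rightarrow> 'b::euclidean_space"
  assumes "open S" and "\<And>x. x \<in> S \<Longrightarrow> (f has_vector_derivative f' x) (at x)" and "Ck_on k S f'"
  shows "Ck_on (Suc k) S f"
  by (rule Ck_on_Suc_has_derivative[OF assms(1), where f' = "\<lambda>x v. v *\<^sub>R f' x"])
    (use assms in \<open>auto simp: has_vector_derivative_def[symmetric] intro!: Ck_on_bounded_linear[OF bounded_linear_scaleR_right]\<close>)

text \<open>The derivative is a polynomial in \<open>inverse\<close> itself, so the induction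
  hypothesis applies to it. The square root and the exponential below close their inductions in the
  same way.\<close>

lemma Ck_on_inverse_real: "Ck_on k {x::real. x \<noteq> 0} inverse"
proof (induction k)
  case 0
  then show ?case by (auto intro!: continuous_intros)
next
  case (Suc k)
  have op: "open {x::real. x \<noteq> 0}" by (simp add: open_Collect_neq continuous_on_id continuous_on_const)
  show ?case
    by (rule Ck_on_Suc_real[OF op, where f' = "\<lambda>x. - (inverse x * inverse x)"])
      (auto intro!: derivative_eq_intros Ck_on_bounded_linear[OF bounded_linear_minus[OF bounded_linear_ident]]
         Ck_on_bilinear[OF bounded_bilinear_mult] op Suc
         simp: has_real_derivative_iff_has_vector_derivative[symmetric] power2_eq_square)
qed

lemma Ck_on_sqrt: "Ck_on k {x::real. x > 0} sqrt"
proof (induction k)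
  case 0
  then show ?case by (auto intro!: continuous_intros)
next
  case (Suc k)
  have op: "open {x::real. x > 0}" by (simp add: open_Collect_less continuous_on_id continuous_on_const)
  have "open {x::real. x \<noteq> 0}" by (simp add: open_Collect_neq continuous_on_id continuous_on_const)
  then show ?case
  proof (intro Ck_on_Suc_real[OF op, where f' = "\<lambda>x. (1/2) * inverse (sqrt x)"])
    fix x :: real assume "x \<in> {x. x > 0}"
    then show "(sqrt has_vector_derivative (1/2) * inverse (sqrt x)) (at x)"
      by (auto intro!: derivative_eq_intros
          simp: has_real_derivative_iff_has_vector_derivative[symmetric] field_simps)
  next
    assume "open {x::real. x \<noteq> 0}"
    then show "Ck_on k {x::real. x > 0} (\<lambda>x. (1/2) * inverse (sqrt x))"
      by (intro Ck_on_bounded_linear[OF bounded_linear_mult_right]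
         Ck_on_compose[OF op _ _ Ck_on_inverse_real] op Suc) auto
  qed
qed

lemma Ck_on_exp: "Ck_on k (UNIV::real set) exp"
proof (induction k)
  case 0
  then show ?case by (auto intro!: continuous_intros)
next
  case (Suc k)
  show ?case
    by (rule Ck_on_Suc_real[OF open_UNIV, where f' = exp])
      (auto intro!: derivative_eq_intros Suc simp: has_real_derivative_iff_has_vector_derivative[symmetric])
qed

section \<open>Closure properties of smooth maps\<close>

lemma smooth_on_cong:
  "open S \<Longrightarrow> (\<And>x. x \<in> S \<Longrightarrow> f x = g x) \<Longrightarrow> smooth_on S f \<longleftrightarrow> smooth_on S g"
  unfolding smooth_on_def using Ck_on_cong by blast

lemma smooth_on_subset: "smooth_on S f \<Longrightarrow> T \<subseteq> S \<Longrightarrow> smooth_on T f"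
  unfolding smooth_on_def using Ck_on_subset by blast

lemma smooth_on_imp_continuous_on: "smooth_on S f \<Longrightarrow> continuous_on S f"
  unfolding smooth_on_def using Ck_on.simps(1) by blast

lemma smooth_on_imp_differentiable: "smooth_on S f \<Longrightarrow> x \<in> S \<Longrightarrow> f differentiable (at x)"
  unfolding smooth_on_def using Ck_on.simps(2) by blast

lemma smooth_on_has_derivative:
  "smooth_on S f \<Longrightarrow> x \<in> S \<Longrightarrow> (f has_derivative frechet_derivative f (at x)) (at x)"
  using smooth_on_imp_differentiable frechet_derivative_works by blast

lemma smooth_on_frechet_derivative: "smooth_on S f \<Longrightarrow> smooth_on S (\<lambda>x. frechet_derivative f (at x) v)"
  unfolding smooth_on_def using Ck_on.simps(2) by blast

named_theorems smooth_intros

lemma smooth_on_const [smooth_intros]: "smooth_on S (\<lambda>x. c)"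
  by (simp add: smooth_on_def Ck_on_const)

lemma smooth_on_ident [smooth_intros]: "open S \<Longrightarrow> smooth_on S (\<lambda>x. x)"
  by (simp add: smooth_on_def Ck_on_ident)

lemma smooth_on_bounded_linear:
  "bounded_linear h \<Longrightarrow> open S \<Longrightarrow> smooth_on S f \<Longrightarrow> smooth_on S (\<lambda>x. h (f x))"
  unfolding smooth_on_def using Ck_on_bounded_linear[where h = h and f = f] by blast

lemma smooth_on_bilinear:
  "bounded_bilinear B \<Longrightarrow> open S \<Longrightarrow> smooth_on S f \<Longrightarrow> smooth_on S g \<Longrightarrow> smooth_on S (\<lambda>x. B (f x) (g x))"
  unfolding smooth_on_def using Ck_on_bilinear[where B = B and f = f and g = g] by blast

lemma smooth_on_add [smooth_intros]:
  "open S \<Longrightarrow> smooth_on S f \<Longrightarrow> smooth_on S g \<Longrightarrow> smooth_on S (\<lambda>x. f x + g x)"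
  unfolding smooth_on_def using Ck_on_add[where f = f and g = g] by blast

lemma smooth_on_minus [smooth_intros]: "open S \<Longrightarrow> smooth_on S f \<Longrightarrow> smooth_on S (\<lambda>x. - f x)"
  by (rule smooth_on_bounded_linear[OF bounded_linear_minus[OF bounded_linear_ident]])

lemma smooth_on_diff [smooth_intros]:
  "open S \<Longrightarrow> smooth_on S f \<Longrightarrow> smooth_on S g \<Longrightarrow> smooth_on S (\<lambda>x. f x - g x)"
  using smooth_on_add[of S f "\<lambda>x. - g x"] smooth_on_minus[of S g] by simp

lemma smooth_on_sum [smooth_intros]:
  "open S \<Longrightarrow> (\<And>i. i \<in> A \<Longrightarrow> smooth_on S (f i)) \<Longrightarrow> smooth_on S (\<lambda>x. \<Sum>i\<in>A. f i x)"
  unfolding smooth_on_def using Ck_on_sum[where f = f] by blast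

lemma smooth_on_fst [smooth_intros]: "open S \<Longrightarrow> smooth_on S f \<Longrightarrow> smooth_on S (\<lambda>x. fst (f x))"
  by (rule smooth_on_bounded_linear[OF bounded_linear_fst])

lemma smooth_on_snd [smooth_intros]: "open S \<Longrightarrow> smooth_on S f \<Longrightarrow> smooth_on S (\<lambda>x. snd (f x))"
  by (rule smooth_on_bounded_linear[OF bounded_linear_snd])

lemma smooth_on_scaleR [smooth_intros]:
  "open S \<Longrightarrow> smooth_on S f \<Longrightarrow> smooth_on S g \<Longrightarrow> smooth_on S (\<lambda>x. f x *\<^sub>R g x)"
  by (rule smooth_on_bilinear[OF bounded_bilinear_scaleR])

lemma smooth_on_mult [smooth_intros]:
  fixes f g :: "'a::euclidean_space \<Rightarrow> real"
  shows "open S \<Longrightarrow> smooth_on S f \<Longrightarrow> smooth_on S g \<Longrightarrow> smooth_on S (\<lambda>x. f x * g x)"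
  by (rule smooth_on_bilinear[OF bounded_bilinear_mult])

lemma smooth_on_inner [smooth_intros]:
  "open S \<Longrightarrow> smooth_on S f \<Longrightarrow> smooth_on S g \<Longrightarrow> smooth_on S (\<lambda>x. f x \<bullet> g x)"
  by (rule smooth_on_bilinear[OF bounded_bilinear_inner])

lemma smooth_on_power [smooth_intros]:
  fixes f :: "'a::euclidean_space \<Rightarrow> real"
  shows "open S \<Longrightarrow> smooth_on S f \<Longrightarrow> smooth_on S (\<lambda>x. f x ^ n)"
  by (induction n) (auto intro!: smooth_on_mult smooth_on_const)

lemma smooth_on_vec_nth [smooth_intros]:
  "open S \<Longrightarrow> smooth_on S f \<Longrightarrow> smooth_on S (\<lambda>x. f x $ i)"
  by (rule smooth_on_bounded_linear[OF bounded_linear_vec_nth])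

lemma smooth_on_Pair [smooth_intros]:
  assumes "open S" "smooth_on S f" "smooth_on S g"
  shows "smooth_on S (\<lambda>x. (f x, g x))"
proof -
  have "smooth_on S (\<lambda>x. (f x, 0) + (0, g x))"
    by (rule smooth_on_add[OF assms(1)
          smooth_on_bounded_linear[OF bounded_linear_Pair[OF bounded_linear_ident bounded_linear_zero] assms(1,2)]
          smooth_on_bounded_linear[OF bounded_linear_Pair[OF bounded_linear_zero bounded_linear_ident] assms(1,3)]])
  then show ?thesis by simp
qed

lemma smooth_on_compose:
  assumes "open S" "open T" "f ` S \<subseteq> T" "smooth_on T g" "smooth_on S f"
  shows "smooth_on S (\<lambda>x. g (f x))"
  unfolding smooth_on_def
proof
  fix k
  show "Ck_on k S (\<lambda>x. g (f x))"
    using assms(4,5) by (simp add: smooth_on_def Ck_on_compose[OF assms(1-3), of k g])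
qed

lemma smooth_on_inverse [smooth_intros]:
  fixes f :: "'a::euclidean_space \<Rightarrow> real"
  assumes "open S" "smooth_on S f" "\<And>x. x \<in> S \<Longrightarrow> f x \<noteq> 0"
  shows "smooth_on S (\<lambda>x. inverse (f x))"
  by (rule smooth_on_compose[of S "{x. x \<noteq> 0}" f inverse])
    (use assms in \<open>auto simp: smooth_on_def Ck_on_inverse_real open_Collect_neq continuous_on_id continuous_on_const\<close>)

lemma smooth_on_divide [smooth_intros]:
  fixes f g :: "'a::euclidean_space \<Rightarrow> real"
  assumes "open S" "smooth_on S f" "smooth_on S g" "\<And>x. x \<in> S \<Longrightarrow> g x \<noteq> 0"
  shows "smooth_on S (\<lambda>x. f x / g x)"
  unfolding divide_inverse by (intro smooth_intros assms)

lemma smooth_on_sqrt [smooth_intros]: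
  fixes f :: "'a::euclidean_space \<Rightarrow> real"
  assumes "open S" "smooth_on S f" "\<And>x. x \<in> S \<Longrightarrow> f x > 0"
  shows "smooth_on S (\<lambda>x. sqrt (f x))"
  by (rule smooth_on_compose[of S "{x. x > 0}" f sqrt])
    (use assms in \<open>auto simp: smooth_on_def Ck_on_sqrt open_Collect_less continuous_on_id continuous_on_const\<close>)

lemma smooth_on_exp [smooth_intros]:
  fixes f :: "'a::euclidean_space \<Rightarrow> real"
  assumes "open S" "smooth_on S f"
  shows "smooth_on S (\<lambda>x. exp (f x))"
  by (rule smooth_on_compose[of S UNIV f exp]) (use assms in \<open>auto simp: smooth_on_def Ck_on_exp\<close>)

lemma smooth_on_norm [smooth_intros]:
  assumes "open S" "smooth_on S f" "\<And>x. x \<in> S \<Longrightarrow> f x \<noteq> 0"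
  shows "smooth_on S (\<lambda>x. norm (f x))"
  unfolding norm_eq_sqrt_inner by (intro smooth_intros assms) (use assms in auto)

lemma smooth_on_velocity:
  assumes "open S" "smooth_on S c"
  shows "smooth_on S (velocity c)"
proof -
  have "velocity c t = frechet_derivative c (at t) 1" if "t \<in> S" for t
    using frechet_derivative_eq_vector_derivative[OF smooth_on_imp_differentiable[OF assms(2) that]]
    by simp
  then show ?thesis
    using smooth_on_cong[OF assms(1), of "velocity c" "\<lambda>t. frechet_derivative c (at t) 1"]
      smooth_on_frechet_derivative[OF assms(2), of 1] by simp
qed

lemma smooth_on_has_vector_derivative:
  "smooth_on S c \<Longrightarrow> t \<in> S \<Longrightarrow> (c has_vector_derivative velocity c t) (at t)"
  using smooth_on_imp_differentiable vector_derivative_works by blast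

lemma smooth_on_deriv:
  fixes c :: "real \<Rightarrow> real"
  assumes "open S" "smooth_on S c"
  shows "smooth_on S (deriv c)"
proof -
  have "velocity c t = deriv c t" if "t \<in> S" for t
    using smooth_on_has_vector_derivative[OF assms(2) that]
    by (simp add: DERIV_imp_deriv has_real_derivative_iff_has_vector_derivative)
  then show ?thesis
    using smooth_on_cong[OF assms(1), of "velocity c" "deriv c"] smooth_on_velocity[OF assms] by simp
qed

lemma smooth_on_has_real_derivative:
  fixes c :: "real \<Rightarrow> real"
  assumes "smooth_on S c" "t \<in> S"
  shows "(c has_real_derivative deriv c t) (at t)"
  using smooth_on_imp_differentiable[OF assms] DERIV_deriv_iff_real_differentiable by blast

text \<open>Bootstrapping for solutions of differential equations: the derivative is an expression
  in \<open>f\<close>, so it is as regular as \<open>f\<close>, and each round gains one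
  order.\<close>

lemma smooth_on_real_if_derivative:
  fixes f :: "real \<Rightarrow> 'b::euclidean_space"
  assumes "open S" and "\<And>x. x \<in> S \<Longrightarrow> (f has_vector_derivative f' x) (at x)"
    and step: "\<And>k. Ck_on k S f \<Longrightarrow> Ck_on k S f'"
  shows "smooth_on S f"
proof -
  have "Ck_on k S f" for k
  proof (induction k)
    case 0
    then show ?case
      using assms(2) by (auto intro!: continuous_at_imp_continuous_on has_vector_derivative_continuous)
  next
    case (Suc k)
    show ?case by (rule Ck_on_Suc_real[OF assms(1,2) step[OF Suc]])
  qed
  then show ?thesis by (simp add: smooth_on_def)
qed

section \<open>Partial derivatives in the plane\<close>

text \<open>Taken from the Frechet derivative rather than from the slice, so that smoothness is
  inherited at once. \<open>has_vector_derivative_partial_s\<close> and \<open>partial_s_eqI\<close>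
  translate to slices and back.\<close>

definition partial_s :: "(real \<times> real \<Rightarrow> 'a::real_normed_vector) \<Rightarrow> real \<times> real \<Rightarrow> 'a" where
  "partial_s f p = frechet_derivative f (at p) (1, 0)"

definition partial_t :: "(real \<times> real \<Rightarrow> 'a::real_normed_vector) \<Rightarrow> real \<times> real \<Rightarrow> 'a" where
  "partial_t f p = frechet_derivative f (at p) (0, 1)"

lemma frechet_derivative_eq_partials:
  fixes f :: "real \<times> real \<Rightarrow> 'a::real_normed_vector"
  assumes "f differentiable (at p)"
  shows "frechet_derivative f (at p) v = fst v *\<^sub>R partial_s f p + snd v *\<^sub>R partial_t f p"
proof -
  have l: "linear (frechet_derivative f (at p))"
    by (rule linear_frechet_derivative[OF assms])
  have "frechet_derivative f (at p) v = frechet_derivative f (at p) (fst v *\<^sub>R (1, 0) + snd v *\<^sub>R (0, 1))"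
    by simp
  also have "\<dots> = fst v *\<^sub>R partial_s f p + snd v *\<^sub>R partial_t f p"
    unfolding partial_s_def partial_t_def by (simp only: linear_add[OF l] linear_cmul[OF l])
  finally show ?thesis .
qed

lemma has_vector_derivative_partial_s:
  fixes f :: "real \<times> real \<Rightarrow> 'a::real_normed_vector"
  assumes "f differentiable (at (s, t))"
  shows "((\<lambda>s. f (s, t)) has_vector_derivative partial_s f (s, t)) (at s)"
proof -
  have 1: "((\<lambda>s. (s, t)) has_derivative (\<lambda>h. (h, 0))) (at s)"
    by (auto intro!: derivative_eq_intros)
  have 2: "(f has_derivative frechet_derivative f (at (s, t))) (at (s, t))"
    using assms frechet_derivative_works by blast
  have "((\<lambda>s. f (s, t)) has_derivative (\<lambda>h. frechet_derivative f (at (s, t)) (h, 0))) (at s)"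
    by (rule has_derivative_compose[OF 1 2])
  then show ?thesis
    unfolding has_vector_derivative_def by (simp add: frechet_derivative_eq_partials[OF assms])
qed

lemma has_vector_derivative_partial_t:
  fixes f :: "real \<times> real \<Rightarrow> 'a::real_normed_vector"
  assumes "f differentiable (at (s, t))"
  shows "((\<lambda>t. f (s, t)) has_vector_derivative partial_t f (s, t)) (at t)"
proof -
  have 1: "((\<lambda>t. (s, t)) has_derivative (\<lambda>h. (0, h))) (at t)"
    by (auto intro!: derivative_eq_intros)
  have 2: "(f has_derivative frechet_derivative f (at (s, t))) (at (s, t))"
    using assms frechet_derivative_works by blast
  have "((\<lambda>t. f (s, t)) has_derivative (\<lambda>h. frechet_derivative f (at (s, t)) (0, h))) (at t)"
    by (rule has_derivative_compose[OF 1 2])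
  then show ?thesis
    unfolding has_vector_derivative_def by (simp add: frechet_derivative_eq_partials[OF assms])
qed

lemma partial_s_eqI:
  assumes "f differentiable (at (s, t))" "((\<lambda>s. f (s, t)) has_vector_derivative D) (at s)"
  shows "partial_s f (s, t) = D"
  using vector_derivative_unique_at[OF has_vector_derivative_partial_s[OF assms(1)] assms(2)] .

lemma partial_t_eqI:
  assumes "f differentiable (at (s, t))" "((\<lambda>t. f (s, t)) has_vector_derivative D) (at t)"
  shows "partial_t f (s, t) = D"
  using vector_derivative_unique_at[OF has_vector_derivative_partial_t[OF assms(1)] assms(2)] .

lemma smooth_on_partial_s: "smooth_on S f \<Longrightarrow> smooth_on S (partial_s f)"
  unfolding partial_s_def by (rule smooth_on_frechet_derivative)

lemma smooth_on_partial_t: "smooth_on S f \<Longrightarrow> smooth_on S (partial_t f)"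
  unfolding partial_t_def by (rule smooth_on_frechet_derivative)

text \<open>The increment splits into a step in s along the line through the point, governed by the
  derivative at \<open>s\<close> alone, and a step in t at a varying s, governed by the mean value
  theorem and the continuity of \<open>f2\<close>.\<close>

lemma has_derivative_if_continuous_partials:
  fixes f :: "real \<times> real \<Rightarrow> 'a::real_normed_vector"
  assumes "open S" "(s, t) \<in> S"
    and fs: "\<And>s t. (s, t) \<in> S \<Longrightarrow> ((\<lambda>s. f (s, t)) has_vector_derivative f1 (s, t)) (at s)"
    and ft: "\<And>s t. (s, t) \<in> S \<Longrightarrow> ((\<lambda>t. f (s, t)) has_vector_derivative f2 (s, t)) (at t)"
    and cont: "continuous_on S f2"
  shows "(f has_derivative (\<lambda>v. fst v *\<^sub>R f1 (s, t) + snd v *\<^sub>R f2 (s, t))) (at (s, t))"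
proof -
  obtain A B where AB: "open A" "open B" "(s, t) \<in> A \<times> B" "A \<times> B \<subseteq> S"
    using open_prod_elim[OF assms(1,2)] by metis
  \<comment> \<open>The factor for t is shrunk to a ball because the mean value argument in t runs
    over a convex set.\<close>
  then obtain r where r: "r > 0" "ball t r \<subseteq> B" by (meson mem_Sigma_iff openE)
  have A: "s \<in> A" and t: "t \<in> ball t r" using AB r by auto
  have sub: "A \<times> ball t r \<subseteq> S" using AB r by auto
  have *: "((\<lambda>(s, t). f (s, t)) has_derivative (\<lambda>(a, b). a *\<^sub>R f1 (s, t) + blinfun_scaleR_left (f2 (s, t)) b))
      (at (s, t) within A \<times> ball t r)"
  proof (rule has_derivative_partialsI[where fy = "\<lambda>s t. blinfun_scaleR_left (f2 (s, t))"])
    show "((\<lambda>s. f (s, t)) has_derivative (\<lambda>a. a *\<^sub>R f1 (s, t))) (at s within A)"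
      using fs[OF assms(2)] unfolding has_vector_derivative_def by (rule has_derivative_at_withinI)
    show "((\<lambda>t. f (s', t)) has_derivative blinfun_apply (blinfun_scaleR_left (f2 (s', t')))) (at t' within ball t r)"
      if "s' \<in> A" "t' \<in> ball t r" for s' t'
    proof -
      have "(s', t') \<in> S" using that sub by blast
      from ft[OF this] show ?thesis
        unfolding has_vector_derivative_def blinfun_scaleR_left.rep_eq by (rule has_derivative_at_withinI)
    qed
    have "continuous_on (A \<times> ball t r) (\<lambda>x. blinfun_scaleR_left (f2 x))"
      by (intro continuous_intros continuous_on_subset[OF cont sub])
    then show "continuous (at (s, t) within A \<times> ball t r) (\<lambda>(x, y). blinfun_scaleR_left (f2 (x, y)))"
      using A t by (auto simp: continuous_on_eq_continuous_within case_prod_unfold)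
  qed (use r in auto)
  have "at (s, t) within A \<times> ball t r = at (s, t)"
    using A t by (intro at_within_open) (auto intro: open_Times AB)
  then show ?thesis
    using * by (simp add: case_prod_unfold blinfun_scaleR_left.rep_eq)
qed

text \<open>Made for the flow of a scalar equation, where one partial is given by the equation and
  the other by an explicit integral, and both have the regularity of the flow itself.\<close>

lemma Ck_on_Suc_partials:
  fixes f :: "real \<times> real \<Rightarrow> 'a::euclidean_space"
  assumes "open S"
    and fs: "\<And>s t. (s, t) \<in> S \<Longrightarrow> ((\<lambda>s. f (s, t)) has_vector_derivative f1 (s, t)) (at s)"
    and ft: "\<And>s t. (s, t) \<in> S \<Longrightarrow> ((\<lambda>t. f (s, t)) has_vector_derivative f2 (s, t)) (at t)"
    and C: "Ck_on k S f1" "Ck_on k S f2"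
  shows "Ck_on (Suc k) S f"
proof (rule Ck_on_Suc_has_derivative[OF assms(1), where f' = "\<lambda>x v. fst v *\<^sub>R f1 x + snd v *\<^sub>R f2 x"])
  fix x assume x: "x \<in> S"
  obtain s t where st: "x = (s, t)" by (cases x)
  show "(f has_derivative (\<lambda>v. fst v *\<^sub>R f1 x + snd v *\<^sub>R f2 x)) (at x)"
    unfolding st
    by (rule has_derivative_if_continuous_partials[OF assms(1) x[unfolded st] fs ft Ck_on_imp_continuous_on[OF C(2)]])
next
  fix v :: "real \<times> real"
  show "Ck_on k S (\<lambda>x. fst v *\<^sub>R f1 x + snd v *\<^sub>R f2 x)"
    by (rule Ck_on_add[OF assms(1) Ck_on_bounded_linear[OF bounded_linear_scaleR_right assms(1) C(1)]
          Ck_on_bounded_linear[OF bounded_linear_scaleR_right assms(1) C(2)]])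
qed

text \<open>The second difference over a square is a difference of differences. Grouping it by one
  variable or by the other and applying the mean value theorem twice produces either mixed partial
  at some point of the square. Each grouping differentiates only one of the first partials, hence
  the separate premises.\<close>

lemma second_difference_eq:
  fixes f :: "real \<times> real \<Rightarrow> real"
  assumes h: "h > 0" and sub: "{s..s+h} \<times> {t..t+h} \<subseteq> S"
    and f: "\<And>p. p \<in> S \<Longrightarrow> f differentiable (at p)"
  shows "(\<And>p. p \<in> S \<Longrightarrow> partial_s f differentiable (at p)) \<Longrightarrow>
      \<exists>p\<in>{s..s+h} \<times> {t..t+h}. f (s+h, t+h) - f (s, t+h) - f (s+h, t) + f (s, t) = h\<^sup>2 * partial_t (partial_s f) p"
    and "(\<And>p. p \<in> S \<Longrightarrow> partial_t f differentiable (at p)) \<Longrightarrow>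
      \<exists>p\<in>{s..s+h} \<times> {t..t+h}. f (s+h, t+h) - f (s, t+h) - f (s+h, t) + f (s, t) = h\<^sup>2 * partial_s (partial_t f) p"
proof -
  have in_S: "(x, y) \<in> S" if "s \<le> x" "x \<le> s+h" "t \<le> y" "y \<le> t+h" for x y
    using sub that by (meson SigmaI atLeastAtMost_iff subsetD)
  {
  assume d: "\<And>p. p \<in> S \<Longrightarrow> partial_s f differentiable (at p)"
  have "\<exists>x. s < x \<and> x < s+h \<and> (f (s+h, t+h) - f (s+h, t)) - (f (s, t+h) - f (s, t))
      = (s+h - s) * (partial_s f (x, t+h) - partial_s f (x, t))"
    using h by (intro MVT2)
      (auto intro!: has_vector_derivative_diff has_vector_derivative_partial_s f in_S simp: has_real_derivative_iff_has_vector_derivative)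
  then obtain x where x: "s < x" "x < s+h" "(f (s+h, t+h) - f (s+h, t)) - (f (s, t+h) - f (s, t))
      = h * (partial_s f (x, t+h) - partial_s f (x, t))" by auto
  have "\<exists>y. t < y \<and> y < t+h \<and> partial_s f (x, t+h) - partial_s f (x, t)
      = (t+h - t) * partial_t (partial_s f) (x, y)"
    using h x by (intro MVT2)
      (auto intro!: has_vector_derivative_partial_t d in_S simp: has_real_derivative_iff_has_vector_derivative)
  then obtain y where "t < y" "y < t+h" "partial_s f (x, t+h) - partial_s f (x, t)
      = h * partial_t (partial_s f) (x, y)" by auto
  with x show "\<exists>p\<in>{s..s+h} \<times> {t..t+h}. f (s+h, t+h) - f (s, t+h) - f (s+h, t) + f (s, t) = h\<^sup>2 * partial_t (partial_s f) p"
    by (intro bexI[of _ "(x, y)"]) (auto simp: power2_eq_square)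
  }
  assume d: "\<And>p. p \<in> S \<Longrightarrow> partial_t f differentiable (at p)"
  have "\<exists>x. t < x \<and> x < t+h \<and> (f (s+h, t+h) - f (s, t+h)) - (f (s+h, t) - f (s, t))
      = (t+h - t) * (partial_t f (s+h, x) - partial_t f (s, x))"
    using h by (intro MVT2)
      (auto intro!: has_vector_derivative_diff has_vector_derivative_partial_t f in_S simp: has_real_derivative_iff_has_vector_derivative)
  then obtain x where x: "t < x" "x < t+h" "(f (s+h, t+h) - f (s, t+h)) - (f (s+h, t) - f (s, t))
      = h * (partial_t f (s+h, x) - partial_t f (s, x))" by auto
  have "\<exists>y. s < y \<and> y < s+h \<and> partial_t f (s+h, x) - partial_t f (s, x)
      = (s+h - s) * partial_s (partial_t f) (y, x)"
    using h x by (intro MVT2)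
      (auto intro!: has_vector_derivative_partial_s d in_S simp: has_real_derivative_iff_has_vector_derivative)
  then obtain y where "s < y" "y < s+h" "partial_t f (s+h, x) - partial_t f (s, x)
      = h * partial_s (partial_t f) (y, x)" by auto
  with x show "\<exists>p\<in>{s..s+h} \<times> {t..t+h}. f (s+h, t+h) - f (s, t+h) - f (s+h, t) + f (s, t) = h\<^sup>2 * partial_s (partial_t f) p"
    by (intro bexI[of _ "(y, x)"]) (auto simp: power2_eq_square)
qed

text \<open>On every small square both mixed partials take the same value, the second difference
  divided by \<open>h\<^sup>2\<close>, though at different points. Continuity then forces equality
  at the corner.\<close>

lemma partial_commute_real:
  fixes f :: "real \<times> real \<Rightarrow> real"
  assumes "open S" "smooth_on S f" "p \<in> S"
  shows "partial_s (partial_t f) p = partial_t (partial_s f) p"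
proof (rule ccontr)
  assume ne: "partial_s (partial_t f) p \<noteq> partial_t (partial_s f) p"
  \<comment> \<open>Half the distance, so that the two continuity errors together cannot bridge
    it.\<close>
  define e where "e = dist (partial_s (partial_t f) p) (partial_t (partial_s f) p) / 2"
  have e: "e > 0" using ne by (simp add: e_def)
  have "continuous_on S (partial_s (partial_t f))" "continuous_on S (partial_t (partial_s f))"
    by (intro smooth_on_imp_continuous_on smooth_on_partial_s smooth_on_partial_t assms)+
  then have c: "isCont (partial_s (partial_t f)) p" "isCont (partial_t (partial_s f)) p"
    using assms continuous_on_eq_continuous_at by blast+
  have "\<forall>\<^sub>F q in nhds p. q \<in> S \<and> dist (partial_s (partial_t f) q) (partial_s (partial_t f) p) < e
      \<and> dist (partial_t (partial_s f) q) (partial_t (partial_s f) p) < e"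
    using c e assms(1,3) by (intro eventually_conj eventually_nhds_in_open)
      (auto simp: isCont_def tendsto_iff eventually_at_filter elim!: eventually_mono)
  then obtain W where W: "open W" "p \<in> W" and Wp: "\<And>q. q \<in> W \<Longrightarrow> q \<in> S \<and> dist (partial_s (partial_t f) q) (partial_s (partial_t f) p) < e
      \<and> dist (partial_t (partial_s f) q) (partial_t (partial_s f) p) < e"
    unfolding eventually_nhds by blast
  obtain s t where p: "p = (s, t)" by (cases p)
  obtain A B where AB: "open A" "open B" "(s, t) \<in> A \<times> B" "A \<times> B \<subseteq> W"
    using open_prod_elim[OF W[unfolded p]] by metis
  obtain h1 h2 where h1: "h1 > 0" "cball s h1 \<subseteq> A" and h2: "h2 > 0" "cball t h2 \<subseteq> B"
    using AB by (meson mem_Sigma_iff open_contains_cball)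
  define h where "h = min h1 h2"
  have h: "h > 0" using h1 h2 by (simp add: h_def)
  have sub: "{s..s+h} \<times> {t..t+h} \<subseteq> W"
    using h1 h2 AB(4) by (fastforce simp: h_def cball_def dist_real_def)
  have sub': "{s..s+h} \<times> {t..t+h} \<subseteq> S" using sub Wp by blast
  obtain q1 where q1: "q1 \<in> {s..s+h} \<times> {t..t+h}"
      "f (s+h, t+h) - f (s, t+h) - f (s+h, t) + f (s, t) = h\<^sup>2 * partial_t (partial_s f) q1"
    using second_difference_eq(1)[OF h sub' smooth_on_imp_differentiable[OF assms(2)]
        smooth_on_imp_differentiable[OF smooth_on_partial_s[OF assms(2)]]] by blast
  obtain q2 where q2: "q2 \<in> {s..s+h} \<times> {t..t+h}"
      "f (s+h, t+h) - f (s, t+h) - f (s+h, t) + f (s, t) = h\<^sup>2 * partial_s (partial_t f) q2"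
    using second_difference_eq(2)[OF h sub' smooth_on_imp_differentiable[OF assms(2)]
        smooth_on_imp_differentiable[OF smooth_on_partial_t[OF assms(2)]]] by blast
  have eq: "partial_t (partial_s f) q1 = partial_s (partial_t f) q2" using q1(2) q2(2) h by simp
  have "dist (partial_s (partial_t f) q2) (partial_s (partial_t f) p) < e"
      "dist (partial_t (partial_s f) q1) (partial_t (partial_s f) p) < e"
    using Wp sub q1(1) q2(1) by blast+
  then have "dist (partial_s (partial_t f) p) (partial_t (partial_s f) p) < 2 * e"
    using eq by (simp add: dist_real_def)
  then show False by (simp add: e_def)
qed

lemma partial_bounded_linear:
  fixes f :: "real \<times> real \<Rightarrow> 'a::real_normed_vector"
  assumes "bounded_linear h" "f differentiable (at p)"
  shows "partial_s (\<lambda>q. h (f q)) p = h (partial_s f p)" "partial_t (\<lambda>q. h (f q)) p = h (partial_t f p)"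
proof -
  have "((\<lambda>q. h (f q)) has_derivative (\<lambda>v. h (frechet_derivative f (at p) v))) (at p)"
    using assms(2) by (intro bounded_linear.has_derivative[OF assms(1)]) (simp add: frechet_derivative_works)
  then show "partial_s (\<lambda>q. h (f q)) p = h (partial_s f p)" "partial_t (\<lambda>q. h (f q)) p = h (partial_t f p)"
    unfolding partial_s_def partial_t_def by (metis frechet_derivative_at)+
qed

text \<open>The mean value theorem yields intermediate points for real functions only, so vectors
  are treated through their inner products with the basis.\<close>

lemma partial_commute:
  fixes f :: "real \<times> real \<Rightarrow> 'a::euclidean_space"
  assumes S: "open S" and f: "smooth_on S f" and p: "p \<in> S"
  shows "partial_s (partial_t f) p = partial_t (partial_s f) p"
proof (rule euclidean_eqI)
  fix b :: 'a assume "b \<in> Basis"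
  have bl: "bounded_linear (\<lambda>x::'a. x \<bullet> b)" by (rule bounded_linear_inner_left)
  have sm: "smooth_on S (\<lambda>q. f q \<bullet> b)" by (rule smooth_on_bounded_linear[OF bl S f])
  have s: "partial_s (\<lambda>q. f q \<bullet> b) q = partial_s f q \<bullet> b" and t: "partial_t (\<lambda>q. f q \<bullet> b) q = partial_t f q \<bullet> b"
    if "q \<in> S" for q
    using partial_bounded_linear[OF bl smooth_on_imp_differentiable[OF f that]] by auto
  have "partial_s (partial_t (\<lambda>q. f q \<bullet> b)) p = partial_s (partial_t f) p \<bullet> b"
    using frechet_derivative_cong[OF S p t] partial_bounded_linear[OF bl
        smooth_on_imp_differentiable[OF smooth_on_partial_t[OF f] p]] by (simp add: partial_s_def)
  moreover have "partial_t (partial_s (\<lambda>q. f q \<bullet> b)) p = partial_t (partial_s f) p \<bullet> b"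
    using frechet_derivative_cong[OF S p s] partial_bounded_linear[OF bl
        smooth_on_imp_differentiable[OF smooth_on_partial_s[OF f] p]] by (simp add: partial_t_def)
  ultimately show "partial_s (partial_t f) p \<bullet> b = partial_t (partial_s f) p \<bullet> b"
    using partial_commute_real[OF S sm p] by simp
qed

section \<open>Inverse functions and integrals depending on parameters\<close>

text \<open>Cramer's rule. It displays the inverse of a derivative as a rational expression in the
  entries, through which smoothness passes to inverse maps.\<close>

lemma inverse_of_plane_isomorphism:
  fixes L :: "real \<times> real \<Rightarrow> real \<times> real"
  assumes "linear L" "bij L"
  defines "J \<equiv> fst (L (1, 0)) * snd (L (0, 1)) - fst (L (0, 1)) * snd (L (1, 0))"
  shows "J \<noteq> 0"
    and "inv L v = ((snd (L (0, 1)) * fst v - fst (L (0, 1)) * snd v) / J,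
                    (fst (L (1, 0)) * snd v - snd (L (1, 0)) * fst v) / J)"
proof -
  define a b c d where "a = fst (L (1, 0))" "b = fst (L (0, 1))" "c = snd (L (1, 0))" "d = snd (L (0, 1))"
  have L: "L v = (a * fst v + b * snd v, c * fst v + d * snd v)" for v
  proof -
    have "L v = L (fst v *\<^sub>R (1, 0) + snd v *\<^sub>R (0, 1))" by simp
    also have "\<dots> = fst v *\<^sub>R L (1, 0) + snd v *\<^sub>R L (0, 1)"
      by (simp only: linear_add[OF assms(1)] linear_cmul[OF assms(1)])
    finally show ?thesis by (simp add: a_b_c_d_def prod_eq_iff algebra_simps)
  qed
  have J: "J = a * d - b * c" by (simp add: J_def a_b_c_d_def)
  show J0: "J \<noteq> 0"
  proof
    assume "J = 0"
    then have ad: "a * d = b * c" by (simp add: J)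
    \<comment> \<open>If the determinant vanishes, the columns of the adjugate lie in the kernel.
      They are then zero, so all entries of \<open>L\<close> vanish, which contradicts
      injectivity.\<close>
    have "L (d, - c) = L 0" "L (b, - a) = L 0" using ad by (auto simp: L algebra_simps)
    then have "(d, - c) = 0" "(b, - a) = 0" using assms(2) by (metis bij_is_inj injD)+
    then have "L (1, 0) = L 0" by (auto simp: L zero_prod_def)
    then have "(1 :: real, 0 :: real) = 0" using assms(2) by (metis bij_is_inj injD)
    then show False by (simp add: zero_prod_def)
  qed
  have "L ((d * fst v - b * snd v) / J, (a * snd v - c * fst v) / J) = v"
  proof -
    have "a * (d * fst v - b * snd v) + b * (a * snd v - c * fst v) = fst v * J"
      "c * (d * fst v - b * snd v) + d * (a * snd v - c * fst v) = snd v * J"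
      by (simp_all add: J algebra_simps)
    then show ?thesis using J0
      by (simp add: L prod_eq_iff add_divide_distrib[symmetric] nonzero_divide_eq_eq)
  qed
  then have "inv L v = ((d * fst v - b * snd v) / J, (a * snd v - c * fst v) / J)"
    using assms(2) by (metis bij_inv_eq_iff)
  then show "inv L v = ((snd (L (0, 1)) * fst v - fst (L (0, 1)) * snd v) / J,
                    (fst (L (1, 0)) * snd v - snd (L (1, 0)) * fst v) / J)"
    by (simp add: a_b_c_d_def)
qed

text \<open>The inverse function theorem gives \<open>g\<close> a derivative, the inverse of the
  derivative of \<open>f\<close> at \<open>g y\<close>. By Cramer's rule this is a smooth map
  composed with \<open>g\<close>, so it has the order of \<open>g\<close>, and induction yields
  every order.\<close>

lemma smooth_local_inverse:
  fixes f :: "real \<times> real \<Rightarrow> real \<times> real"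
  assumes U: "open U" and f: "smooth_on U f" and p: "p \<in> U" and inj: "inj (frechet_derivative f (at p))"
  obtains U' V g where "open U'" "U' \<subseteq> U" "p \<in> U'" "open V" "homeomorphism U' V f g" "smooth_on V g"
proof -
  have bl: "bounded_linear (frechet_derivative f (at x))" if "x \<in> U" for x
    using smooth_on_has_derivative[OF f that] has_derivative_bounded_linear by blast
  obtain L where L: "linear L" "L \<circ> frechet_derivative f (at p) = id"
    using linear_injective_left_inverse[OF _ inj] bl[OF p] bounded_linear.linear by blast
  have bL: "bounded_linear L" by (simp add: L linear_conv_bounded_linear[symmetric])
  have 1: "(f has_derivative blinfun_apply (Blinfun (frechet_derivative f (at x)))) (at x)" if "x \<in> U" for x
    using smooth_on_has_derivative[OF f that] bl[OF that] by (simp add: bounded_linear_Blinfun_apply)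
  have 2: "continuous_on U (\<lambda>x. Blinfun (frechet_derivative f (at x)))"
  proof (rule continuous_on_blinfun_componentwise)
    fix i :: "real \<times> real"
    have "continuous_on U (\<lambda>x. frechet_derivative f (at x) i)"
      by (intro smooth_on_imp_continuous_on smooth_on_frechet_derivative f)
    then show "continuous_on U (\<lambda>x. blinfun_apply (Blinfun (frechet_derivative f (at x))) i)"
      using bl by (simp add: bounded_linear_Blinfun_apply cong: continuous_on_cong)
  qed
  have 3: "Blinfun L o\<^sub>L Blinfun (frechet_derivative f (at p)) = id_blinfun"
    using fun_cong[OF L(2)] by (intro blinfun_eqI) (simp add: bounded_linear_Blinfun_apply bL bl[OF p])
  obtain U' V g g' where *: "open U'" "U' \<subseteq> U" "p \<in> U'" "open V" "f p \<in> V" "homeomorphism U' V f g"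
    and g: "\<And>y. y \<in> V \<Longrightarrow> (g has_derivative g' y) (at y)"
    and g': "\<And>y. y \<in> V \<Longrightarrow> g' y = inv (blinfun_apply (Blinfun (frechet_derivative f (at (g y)))))"
    and bij: "\<And>y. y \<in> V \<Longrightarrow> bij (blinfun_apply (Blinfun (frechet_derivative f (at (g y)))))"
    using inverse_function_theorem[OF U 1 2 p 3] by metis
  have gV: "g ` V = U'" using *(6) by (simp add: homeomorphism_def)
  have gU: "g y \<in> U" if "y \<in> V" for y using gV *(2) that by blast
  have f': "smooth_on U' f" using smooth_on_subset[OF f *(2)] .
  define a b c d J where "a = (\<lambda>x. fst (frechet_derivative f (at x) (1, 0)))"
    "b = (\<lambda>x. fst (frechet_derivative f (at x) (0, 1)))"
    "c = (\<lambda>x. snd (frechet_derivative f (at x) (1, 0)))"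
    "d = (\<lambda>x. snd (frechet_derivative f (at x) (0, 1)))"
    "J = (\<lambda>x. a x * d x - b x * c x)"
  have J0: "J x \<noteq> 0" if "x \<in> U'" for x
  proof -
    have "x \<in> g ` V" using that gV by simp
    then obtain y where "y \<in> V" "x = g y" by (rule imageE)
    then show ?thesis
      using inverse_of_plane_isomorphism(1)[OF _ bij[of y]] bl[OF gU[of y]]
      by (simp add: a_b_c_d_J_def bounded_linear_Blinfun_apply bounded_linear.linear)
  qed
  have g'eq: "g' y v = ((d (g y) / J (g y)) * fst v - (b (g y) / J (g y)) * snd v,
      (a (g y) / J (g y)) * snd v - (c (g y) / J (g y)) * fst v)" if "y \<in> V" for y v
    using inverse_of_plane_isomorphism(2)[OF _ bij[OF that]] bl[OF gU[OF that]] g'[OF that]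
    by (simp add: a_b_c_d_J_def bounded_linear_Blinfun_apply bounded_linear.linear diff_divide_distrib)
  have sm: "smooth_on U' (\<lambda>x. (d x / J x * fst v - b x / J x * snd v, a x / J x * snd v - c x / J x * fst v))" for v
    unfolding a_b_c_d_J_def
    by (intro smooth_on_Pair smooth_on_diff smooth_on_mult smooth_on_divide smooth_on_fst smooth_on_snd
        smooth_on_const smooth_on_frechet_derivative f' *(1))
      (use J0 in \<open>auto simp: a_b_c_d_J_def\<close>)
  have "Ck_on k V g" for k
  proof (induction k)
    case 0
    then show ?case using *(6) by (simp add: homeomorphism_def)
  next
    case (Suc k)
    show ?case
    proof (rule Ck_on_Suc_has_derivative[OF *(4) g])
      fix v
      let ?G = "\<lambda>x. (d x / J x * fst v - b x / J x * snd v, a x / J x * snd v - c x / J x * fst v)"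
      have "Ck_on k V (\<lambda>y. ?G (g y))"
        by (rule Ck_on_compose[OF *(4,1) _ _ Suc, of ?G]) (use gV sm in \<open>auto simp: smooth_on_def\<close>)
      then show "Ck_on k V (\<lambda>y. g' y v)"
        using Ck_on_cong[OF *(4), of "\<lambda>y. g' y v" "\<lambda>y. ?G (g y)"] g'eq by simp
    qed
  qed
  then have "smooth_on V g" by (simp add: smooth_on_def)
  then show thesis using that * by blast
qed

text \<open>Differentiation under the integral sign. The induction ranges over all \<open>q\<close>,
  because differentiating in the parameter replaces \<open>q\<close> by one of its directional
  derivatives.\<close>

lemma Ck_on_parameter_integral:
  fixes q :: "'a::euclidean_space \<times> real \<Rightarrow> 'b::euclidean_space"
  assumes S: "open S" and W: "open W" "S \<times> {0..1} \<subseteq> W" and q: "Ck_on k W q"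
  shows "Ck_on k S (\<lambda>x. integral {0..1} (\<lambda>\<theta>. q (x, \<theta>)))"
  using q
proof (induction k arbitrary: q)
  case 0
  have "continuous_on S (\<lambda>x. integral (cbox 0 1) (\<lambda>\<theta>. q (x, \<theta>)))"
    using 0 W by (intro integral_continuous_on_param) (auto intro: continuous_on_subset)
  then show ?case by simp
next
  case (Suc k)
  have dq: "(q has_derivative frechet_derivative q (at y)) (at y)" if "y \<in> W" for y
    using Suc.prems that by (simp add: frechet_derivative_works[symmetric])
  let ?D = "\<lambda>x \<theta>. Blinfun (\<lambda>v. frechet_derivative q (at (x, \<theta>)) (v, 0))"
  have bl: "bounded_linear (\<lambda>v::'a. frechet_derivative q (at y) (v, 0))" if "y \<in> W" for y
    using has_derivative_bounded_linear[OF dq[OF that]]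
    by (rule bounded_linear_compose) (rule bounded_linear_Pair[OF bounded_linear_ident bounded_linear_zero])
  have D: "blinfun_apply (?D x \<theta>) v = frechet_derivative q (at (x, \<theta>)) (v, 0)" if "(x, \<theta>) \<in> W" for x \<theta> v
    using bl[OF that] by (simp add: bounded_linear_Blinfun_apply)
  have cont: "continuous_on W (\<lambda>y. frechet_derivative q (at y) v)" for v
  proof -
    have "Ck_on k W (\<lambda>y. frechet_derivative q (at y) v)" using Suc.prems by (simp del: split_paired_All)
    then show ?thesis by (rule Ck_on_imp_continuous_on)
  qed
  have main: "((\<lambda>x. integral {0..1} (\<lambda>\<theta>. q (x, \<theta>))) has_derivative
      (\<lambda>v. integral {0..1} (\<lambda>\<theta>. frechet_derivative q (at (x, \<theta>)) (v, 0)))) (at x)" if x: "x \<in> S" for x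
  proof -
    obtain r where r: "r > 0" "ball x r \<subseteq> S" using S x openE by blast
    have sub: "ball x r \<times> {0..1} \<subseteq> W" using r W by auto
    have 1: "((\<lambda>x. integral (cbox 0 1) (\<lambda>\<theta>. q (x, \<theta>))) has_derivative integral (cbox 0 1) (?D x)) (at x within ball x r)"
    proof (rule leibniz_rule)
      fix y and t :: real assume "y \<in> ball x r" "t \<in> cbox 0 1"
      then have yW: "(y, t) \<in> W" using sub by auto
      have "((\<lambda>y. (y, t)) has_derivative (\<lambda>v. (v, 0))) (at y)" by (auto intro!: derivative_eq_intros)
      from has_derivative_compose[OF this dq[OF yW]]
      have "((\<lambda>y. q (y, t)) has_derivative blinfun_apply (?D y t)) (at y)"
        using bl[OF yW] by (simp add: bounded_linear_Blinfun_apply)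
      then show "((\<lambda>y. q (y, t)) has_derivative blinfun_apply (?D y t)) (at y within ball x r)"
        by (rule has_derivative_at_withinI)
    next
      fix y assume "y \<in> ball x r"
      then show "(\<lambda>\<theta>. q (y, \<theta>)) integrable_on cbox 0 1"
        using sub Ck_on_imp_continuous_on[OF Suc.prems]
        by (intro integrable_continuous continuous_on_compose2[of W q "cbox 0 1" "\<lambda>\<theta>. (y, \<theta>)"] continuous_intros) auto
    next
      show "continuous_on (ball x r \<times> cbox 0 1) (\<lambda>(x, t). ?D x t)"
      proof (rule continuous_on_blinfun_componentwise)
        fix i :: 'a
        have "continuous_on (ball x r \<times> cbox 0 1) (\<lambda>y. frechet_derivative q (at y) (i, 0))"
          using sub by (intro continuous_on_subset[OF cont]) auto
        moreover have "(case y of (x, \<theta>) \<Rightarrow> ?D x \<theta>) i = frechet_derivative q (at y) (i, 0)" if "y \<in> ball x r \<times> cbox 0 1" for y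
          using D[of "fst y" "snd y"] that sub by (auto simp: case_prod_unfold)
        ultimately show "continuous_on (ball x r \<times> cbox 0 1) (\<lambda>y. (case y of (x, \<theta>) \<Rightarrow> ?D x \<theta>) i)"
          by (simp cong: continuous_on_cong)
      qed
    qed (use r in auto)
    have xW: "(x, \<theta>) \<in> W" if "\<theta> \<in> cbox 0 1" for \<theta>
      using that W(2) x by (metis SigmaI box_real(2) subsetD)
    have "?D x integrable_on cbox 0 1"
    proof (intro integrable_continuous continuous_on_blinfun_componentwise)
      fix i :: 'a
      have "continuous_on (cbox 0 1) (\<lambda>\<theta>. frechet_derivative q (at (x, \<theta>)) (i, 0))"
        using xW by (intro continuous_on_compose2[OF cont, of "cbox 0 1" "\<lambda>\<theta>. (x, \<theta>)"] continuous_intros) auto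
      then show "continuous_on (cbox 0 1) (\<lambda>\<theta>. blinfun_apply (?D x \<theta>) i)"
        by (rule continuous_on_eq) (simp only: D[OF xW])
    qed
    then have 2: "blinfun_apply (integral (cbox 0 1) (?D x)) v = integral (cbox 0 1) (\<lambda>\<theta>. blinfun_apply (?D x \<theta>) v)" for v
      by (rule blinfun_apply_integral)
    have 3: "integral (cbox 0 1) (\<lambda>\<theta>. blinfun_apply (?D x \<theta>) v) = integral (cbox 0 1) (\<lambda>\<theta>. frechet_derivative q (at (x, \<theta>)) (v, 0))" for v
      by (rule integral_cong) (simp only: D[OF xW])
    have "blinfun_apply (integral (cbox 0 1) (?D x)) = (\<lambda>v. integral {0..1} (\<lambda>\<theta>. frechet_derivative q (at (x, \<theta>)) (v, 0)))"
      using 2 3 by (auto simp: fun_eq_iff)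
    then show ?thesis using 1 r by (simp add: at_within_open[of x "ball x r"])
  qed
  show ?case
  proof (rule Ck_on_Suc_has_derivative[OF S main])
    fix v
    have "Ck_on k W (\<lambda>y. frechet_derivative q (at y) (v, 0))" using Suc.prems by simp
    then show "Ck_on k S (\<lambda>x. integral {0..1} (\<lambda>\<theta>. frechet_derivative q (at (x, \<theta>)) (v, 0)))"
      by (rule Suc.IH)
  qed
qed

section \<open>Ordinary differential equations\<close>

lemma has_vector_derivative_bound:
  fixes f :: "real \<Rightarrow> 'a::real_normed_vector"
  assumes "convex S" and "\<And>x. x \<in> S \<Longrightarrow> (f has_vector_derivative f' x) (at x within S)"
    and B: "\<And>x. x \<in> S \<Longrightarrow> norm (f' x) \<le> B" and "x \<in> S" "y \<in> S"
  shows "norm (f x - f y) \<le> B * \<bar>x - y\<bar>"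
proof -
  have "norm (f x - f y) \<le> B * norm (x - y)"
  proof (rule differentiable_bound[OF assms(1) _ _ assms(4,5)])
    fix x assume x: "x \<in> S"
    show "(f has_derivative (\<lambda>h. h *\<^sub>R f' x)) (at x within S)"
      using assms(2)[OF x] by (simp add: has_vector_derivative_def)
    have "0 \<le> B" using B[OF x] norm_ge_zero order_trans by blast
    then show "onorm (\<lambda>h. h *\<^sub>R f' x) \<le> B"
    proof (intro onorm_bound)
      fix h :: real
      have "\<bar>h\<bar> * norm (f' x) \<le> \<bar>h\<bar> * B" by (rule mult_left_mono[OF B[OF x]]) simp
      then show "norm (h *\<^sub>R f' x) \<le> B * norm h" by (simp add: mult.commute)
    qed
  qed
  then show ?thesis by simp
qed

text \<open>The Lipschitz bound holds for all values of x, so the integral operator contracts the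
  whole space of bounded continuous functions and no invariant ball has to be found. A right-hand
  side that is only locally Lipschitz is cut off before this is applied.\<close>

lemma picard_lindelof:
  fixes F :: "real \<Rightarrow> 'a::euclidean_space \<Rightarrow> 'a"
  assumes h: "0 < h" and K: "0 \<le> K" "K * h < 1"
    and cont: "continuous_on ({t0-h..t0+h} \<times> UNIV) (\<lambda>(t, x). F t x)"
    and lip: "\<And>t x y. t \<in> {t0-h..t0+h} \<Longrightarrow> norm (F t x - F t y) \<le> K * norm (x - y)"
  obtains y where "y t0 = y0"
    "\<And>t. t \<in> {t0-h..t0+h} \<Longrightarrow> (y has_vector_derivative F t (y t)) (at t within {t0-h..t0+h})"
proof -
  define I where "I = {t0-h..t0+h}"
  \<comment> \<open>Bounded continuous functions live on the whole real line. Clamping the time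
    extends a function on the interval by its end values.\<close>
  define c where "c = (\<lambda>t. max (t0-h) (min (t0+h) t))"
  have cI: "c t \<in> I" for t using h by (auto simp: c_def I_def)
  have cid: "c t = t" if "t \<in> I" for t using that by (auto simp: c_def I_def)
  have contc: "continuous_on UNIV c" unfolding c_def by (intro continuous_intros)
  define G where "G = (\<lambda>(u :: real \<Rightarrow>\<^sub>C 'a) t. F t (apply_bcontfun u t))"
  \<comment> \<open>The integral from \<open>t0\<close> is written as a difference, because
    \<open>integral\<close> over a reversed interval would be 0 for times before
    \<open>t0\<close>.\<close>
  define P where "P = (\<lambda>u t. y0 + integral {t0-h..t} (G u) - integral {t0-h..t0} (G u))"
  have contG: "continuous_on I (G u)" for u :: "real \<Rightarrow>\<^sub>C 'a"
  proof -
    have "continuous_on I (\<lambda>t. (t, apply_bcontfun u t))"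
      by (intro continuous_intros) auto
    then show ?thesis
      unfolding G_def using continuous_on_compose2[OF cont, of I "\<lambda>t. (t, apply_bcontfun u t)"] by (auto simp: I_def)
  qed
  have derP: "(P u has_vector_derivative G u t) (at t within I)" if "t \<in> I" for u :: "real \<Rightarrow>\<^sub>C 'a" and t
  proof -
    have "((\<lambda>t. integral {t0-h..t} (G u)) has_vector_derivative G u t) (at t within I)"
      using integral_has_vector_derivative[OF contG[unfolded I_def]] that by (simp add: I_def)
    then show ?thesis unfolding P_def by (auto intro!: derivative_eq_intros)
  qed
  have contP: "continuous_on I (P u)" for u :: "real \<Rightarrow>\<^sub>C 'a"
    using derP has_vector_derivative_continuous by (fastforce simp: continuous_on_eq_continuous_within)
  have bc: "(\<lambda>t. P u (c t)) \<in> bcontfun" for u :: "real \<Rightarrow>\<^sub>C 'a"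
  proof -
    have "continuous_on UNIV (\<lambda>t. P u (c t))"
      by (rule continuous_on_compose2[OF contP contc]) (use cI in auto)
    moreover have "range (\<lambda>t. P u (c t)) \<subseteq> P u ` I" using cI by auto
    moreover have "bounded (P u ` I)"
      using contP[of u] by (intro compact_imp_bounded compact_continuous_image) (auto simp: I_def)
    ultimately show ?thesis unfolding bcontfun_def using bounded_subset by blast
  qed
  define T where "T = (\<lambda>u. Bcontfun (\<lambda>t. P u (c t)))"
  have T: "apply_bcontfun (T u) t = P u (c t)" for u :: "real \<Rightarrow>\<^sub>C 'a" and t
    using Bcontfun_inverse[OF bc] by (simp add: T_def)
  have "\<exists>!u. T u = u"
  proof (rule banach_fix_type[of "K * h"])
    show "\<forall>u v. dist (T u) (T v) \<le> K * h * dist u v"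
    proof (intro allI dist_bound)
      fix u v :: "real \<Rightarrow>\<^sub>C 'a" and t
      let ?B = "K * dist u v"
      have "norm ((P u (c t) - P v (c t)) - (P u t0 - P v t0)) \<le> ?B * \<bar>c t - t0\<bar>"
      proof (rule has_vector_derivative_bound[where S = I and f' = "\<lambda>t. G u t - G v t"])
        fix t assume t: "t \<in> I"
        show "((\<lambda>t. P u t - P v t) has_vector_derivative G u t - G v t) (at t within I)"
          by (intro has_vector_derivative_diff derP t)
        have "norm (G u t - G v t) \<le> K * norm (apply_bcontfun u t - apply_bcontfun v t)"
          unfolding G_def using lip t by (simp add: I_def)
        also have "\<dots> \<le> K * dist u v"
          using dist_bounded[of u t v] K(1) by (intro mult_left_mono) (auto simp: dist_norm)
        finally show "norm (G u t - G v t) \<le> K * dist u v" .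
      qed (use cI h in \<open>auto simp: I_def\<close>)
      also have "\<dots> \<le> ?B * h"
        using cI[of t] K(1) by (intro mult_left_mono) (auto simp: I_def)
      finally show "dist (apply_bcontfun (T u) t) (apply_bcontfun (T v) t) \<le> K * h * dist u v"
        by (simp add: T dist_norm P_def algebra_simps)
    qed
  qed (use h K in auto)
  then obtain u where u: "T u = u" by auto
  define y where "y = apply_bcontfun u"
  have y: "y t = P u t" if "t \<in> I" for t using T[of u t] u cid[OF that] by (simp add: y_def)
  show thesis
  proof (rule that[of y])
    have "t0 \<in> I" using h by (simp add: I_def)
    then show "y t0 = y0" by (simp add: y P_def)
    fix t assume "t \<in> {t0-h..t0+h}"
    then have t: "t \<in> I" by (simp add: I_def)
    have "(y has_vector_derivative G u t) (at t within I)"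
      by (rule has_vector_derivative_transform[OF t _ derP[OF t]]) (simp add: y)
    then show "(y has_vector_derivative F t (y t)) (at t within {t0-h..t0+h})"
      by (simp add: G_def y_def I_def)
  qed
qed

section \<open>Scalar equations: primitives with parameters and the smooth flow\<close>

lemma scalar_linear_ode:
  fixes D P Q :: "real \<Rightarrow> real"
  assumes S: "open S" "convex S" "x0 \<in> S" "x \<in> S"
    and D: "\<And>x. x \<in> S \<Longrightarrow> (D has_real_derivative Q x * D x) (at x)"
    and P: "\<And>x. x \<in> S \<Longrightarrow> (P has_real_derivative Q x) (at x)" "P x0 = 0"
  shows "D x = D x0 * exp (P x)"
proof -
  have "D x * exp (- P x) = D x0 * exp (- P x0)"
  proof (rule has_derivative_zero_unique[OF S(2) _ S(4,3)])
    fix x assume x: "x \<in> S"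
    have "((\<lambda>x. D x * exp (- P x)) has_real_derivative 0) (at x)"
      by (rule derivative_eq_intros D[OF x] P(1)[OF x] refl | simp)+
    then show "((\<lambda>x. D x * exp (- P x)) has_derivative (\<lambda>h. 0)) (at x within S)"
      by (rule has_derivative_at_withinI[OF has_field_derivative_imp_has_derivative[THEN has_derivative_eq_rhs]])
        auto
  qed
  then have "D x * exp (- P x) * exp (P x) = D x0 * exp (P x)" using P(2) by simp
  then show ?thesis by (simp add: mult.assoc exp_add[symmetric])
qed

text \<open>The primitive in the first variable that vanishes at \<open>x0\<close>. The substitution
  moves the upper limit into the integrand, so that the domain is \<open>{0..1}\<close> for every
  parameter, and the formula is also right for x below \<open>x0\<close>.\<close>

definition primitive_from :: "real \<Rightarrow> (real \<times> real \<Rightarrow> real) \<Rightarrow> real \<times> real \<Rightarrow> real" where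
  "primitive_from x0 q = (\<lambda>(x, c). (x - x0) * integral {0..1} (\<lambda>\<theta>. q (x0 + \<theta> * (x - x0), c)))"

lemma convex_combination_in_interval:
  fixes x0 h x \<theta> :: real
  assumes "x \<in> {x0-h<..<x0+h}" "\<theta> \<in> {0..1}"
  shows "x0 + \<theta> * (x - x0) \<in> {x0-h<..<x0+h}"
proof -
  have "\<bar>\<theta> * (x - x0)\<bar> \<le> \<bar>x - x0\<bar>" using assms(2) by (simp add: abs_mult mult_left_le_one_le)
  then show ?thesis using assms(1) by (auto simp: abs_less_iff)
qed

lemma Ck_on_primitive_from:
  assumes B: "open B" and q: "Ck_on k ({x0-h<..<x0+h} \<times> B) q"
  shows "Ck_on k ({x0-h<..<x0+h} \<times> B) (primitive_from x0 q)"
proof -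
  define A where "A = {x0-h<..<x0+h}"
  have op: "open (A \<times> B)" by (auto simp: A_def intro: open_Times B)
  let ?m = "\<lambda>y :: (real \<times> real) \<times> real. (x0 + snd y * (fst (fst y) - x0), snd (fst y))"
  \<comment> \<open>The integrand is under control only where the convex combination stays in the
    rectangle. This set is open and contains all of \<open>{0..1}\<close> over each point.\<close>
  define W where "W = ?m -` (A \<times> B)"
  have sm: "smooth_on UNIV ?m"
    by (intro smooth_on_Pair smooth_on_add smooth_on_mult smooth_on_diff smooth_on_fst smooth_on_snd
      smooth_on_const smooth_on_ident open_UNIV)
  have W: "open W"
    unfolding W_def using smooth_on_imp_continuous_on[OF sm] op by (intro open_vimage)
  have "Ck_on k W (\<lambda>y. q (?m y))"
    by (rule Ck_on_compose[OF W op _ q[folded A_def], of ?m])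
      (use smooth_on_subset[OF sm, of W] in \<open>auto simp: W_def smooth_on_def\<close>)
  moreover have "(A \<times> B) \<times> {0..1} \<subseteq> W"
    using convex_combination_in_interval by (auto simp: W_def A_def)
  ultimately have "Ck_on k (A \<times> B) (\<lambda>x. integral {0..1} (\<lambda>\<theta>. q (?m (x, \<theta>))))"
    using Ck_on_parameter_integral[OF op W, of k "\<lambda>y. q (?m y)"] by blast
  then have I: "Ck_on k (A \<times> B) (\<lambda>x. integral {0..1} (\<lambda>\<theta>. q (x0 + \<theta> * (fst x - x0), snd x)))"
    by simp
  have "Ck_on k (A \<times> B) (\<lambda>x. (fst x - x0) * integral {0..1} (\<lambda>\<theta>. q (x0 + \<theta> * (fst x - x0), snd x)))"
  proof (rule Ck_on_bilinear[OF bounded_bilinear_mult op _ I])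
    have "smooth_on (A \<times> B) (\<lambda>x. fst x - x0)"
      by (intro smooth_on_diff smooth_on_fst smooth_on_const smooth_on_ident op)
    then show "Ck_on k (A \<times> B) (\<lambda>x. fst x - x0)" by (simp add: smooth_on_def)
  qed
  then show ?thesis by (simp add: primitive_from_def A_def case_prod_unfold)
qed

lemma primitive_from_start: "primitive_from x0 q (x0, c) = 0"
  by (simp add: primitive_from_def)

text \<open>The substituted integral is compared with an antiderivative \<open>F\<close> along the
  slice: it equals \<open>F x - F x0\<close>.\<close>

lemma has_real_derivative_primitive_from:
  assumes q: "continuous_on {x0-h<..<x0+h} (\<lambda>x. q (x, c))" and x: "x \<in> {x0-h<..<x0+h}"
  shows "((\<lambda>x. primitive_from x0 q (x, c)) has_real_derivative q (x, c)) (at x)"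
proof -
  define A where "A = {x0-h<..<x0+h}"
  have ne: "ereal (x0-h) < ereal (x0+h)" using x by auto
  have "\<exists>F. \<forall>x :: real. ereal (x0-h) < x \<longrightarrow> x < ereal (x0+h) \<longrightarrow> (F has_vector_derivative q (x, c)) (at x)"
    by (rule einterval_antiderivative[OF ne])
      (use q in \<open>auto simp: continuous_on_eq_continuous_at\<close>)
  then obtain F where F: "(F has_vector_derivative q (x, c)) (at x)" if "x \<in> A" for x
    by (auto simp: A_def)
  have *: "primitive_from x0 q (x, c) = F x - F x0" if x: "x \<in> A" for x
  proof -
    have "((\<lambda>\<theta>. (x - x0) *\<^sub>R q (x0 + \<theta> * (x - x0), c)) has_integral
        (F (x0 + 1 * (x - x0)) - F (x0 + 0 * (x - x0)))) {0..1}"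
    proof (rule fundamental_theorem_of_calculus)
      fix \<theta> :: real assume \<theta>: "\<theta> \<in> {0..1}"
      have "x0 + \<theta> * (x - x0) \<in> A"
        using convex_combination_in_interval[of x x0 h \<theta>] x \<theta> by (simp add: A_def)
      then have "(F has_vector_derivative q (x0 + \<theta> * (x - x0), c)) (at (x0 + \<theta> * (x - x0)))" by (rule F)
      moreover have "((\<lambda>\<theta>. x0 + \<theta> * (x - x0)) has_vector_derivative (x - x0)) (at \<theta> within {0..1})"
        by (auto intro!: derivative_eq_intros)
      ultimately show "((\<lambda>\<theta>. F (x0 + \<theta> * (x - x0))) has_vector_derivative (x - x0) *\<^sub>R q (x0 + \<theta> * (x - x0), c)) (at \<theta> within {0..1})"
        using vector_diff_chain_within[of "\<lambda>\<theta>. x0 + \<theta> * (x - x0)" "x - x0" \<theta> "{0..1}" F]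
        by (auto simp: o_def intro: has_vector_derivative_at_within)
    qed simp
    then have "integral {0..1} (\<lambda>\<theta>. (x - x0) *\<^sub>R q (x0 + \<theta> * (x - x0), c))
        = F (x0 + 1 * (x - x0)) - F (x0 + 0 * (x - x0))"
      by (rule integral_unique)
    then show ?thesis by (simp add: primitive_from_def)
  qed
  have xA: "x \<in> A" using x by (simp add: A_def)
  have "((\<lambda>x. F x - F x0) has_real_derivative q (x, c)) (at x)"
    using F[OF xA] by (auto simp: has_real_derivative_iff_has_vector_derivative intro!: derivative_eq_intros)
  then show ?thesis
    by (rule has_field_derivative_transform_within_open[where S = A])
      (use xA * in \<open>auto simp: A_def\<close>)
qed

text \<open>Hadamard's form of the difference quotient in the second variable: it remains continuous
  across the diagonal u = v. Evaluated along two solutions, it is the coefficient of the linear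
  equation for their difference.\<close>

definition difference_quotient_t :: "(real \<times> real \<Rightarrow> real) \<Rightarrow> real \<times> real \<times> real \<Rightarrow> real" where
  "difference_quotient_t F = (\<lambda>(x, u, v). integral {0..1} (\<lambda>\<theta>. partial_t F (x, u + \<theta> * (v - u))))"

lemma convex_combination_greaterThanLessThan:
  fixes l m u v \<theta> :: real
  assumes "u \<in> {l<..<m}" "v \<in> {l<..<m}" "\<theta> \<in> {0..1}"
  shows "u + \<theta> * (v - u) \<in> {l<..<m}"
proof -
  have "(1 - \<theta>) *\<^sub>R u + \<theta> *\<^sub>R v \<in> {l<..<m}"
    using assms by (intro convexD) (auto simp: convex_real_interval)
  then show ?thesis by (simp add: algebra_simps)
qed

lemma difference_quotient_t:
  assumes A: "open A" and sub: "A \<times> {l<..<m} \<subseteq> U" and U: "open U" and F: "smooth_on U F"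
  shows "continuous_on (A \<times> {l<..<m} \<times> {l<..<m}) (difference_quotient_t F)"
    and "\<And>x u v. x \<in> A \<Longrightarrow> u \<in> {l<..<m} \<Longrightarrow> v \<in> {l<..<m} \<Longrightarrow>
      F (x, v) - F (x, u) = (v - u) * difference_quotient_t F (x, u, v)"
    and "\<And>x u. difference_quotient_t F (x, u, u) = partial_t F (x, u)"
    and "\<And>x u v K. x \<in> A \<Longrightarrow> u \<in> {l<..<m} \<Longrightarrow> v \<in> {l<..<m} \<Longrightarrow>
      (\<And>y. y \<in> {l<..<m} \<Longrightarrow> \<bar>partial_t F (x, y)\<bar> \<le> K) \<Longrightarrow> \<bar>difference_quotient_t F (x, u, v)\<bar> \<le> K"
proof -
  let ?I = "{l<..<m}"
  let ?m = "\<lambda>y :: (real \<times> real \<times> real) \<times> real. (fst (fst y), fst (snd (fst y)) + snd y * (snd (snd (fst y)) - fst (snd (fst y))))"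
  have F': "smooth_on U (partial_t F)" by (rule smooth_on_partial_t[OF F])
  have contF': "continuous_on U (partial_t F)" by (rule smooth_on_imp_continuous_on[OF F'])
  have contm: "continuous_on UNIV ?m" by (intro continuous_intros)
  have W: "open (?m -` U)" using contm U by (intro open_vimage) auto
  have "Ck_on 0 (?m -` U) (\<lambda>y. partial_t F (?m y))"
    using continuous_on_compose2[OF contF' continuous_on_subset[OF contm, of "?m -` U"]] by auto
  moreover have "(A \<times> ?I \<times> ?I) \<times> {0..1} \<subseteq> ?m -` U"
    using sub convex_combination_greaterThanLessThan by fastforce
  ultimately have "Ck_on 0 (A \<times> ?I \<times> ?I) (\<lambda>x. integral {0..1} (\<lambda>\<theta>. partial_t F (?m (x, \<theta>))))"
    using Ck_on_parameter_integral[OF open_Times[OF A open_Times[OF open_greaterThanLessThan open_greaterThanLessThan]] W,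
        of l m l m 0 "\<lambda>y. partial_t F (?m y)"] by blast
  then show "continuous_on (A \<times> {l<..<m} \<times> {l<..<m}) (difference_quotient_t F)"
    by (simp add: difference_quotient_t_def case_prod_unfold)
  show "difference_quotient_t F (x, u, u) = partial_t F (x, u)" for x u
    by (simp add: difference_quotient_t_def)
  fix x u v assume x: "x \<in> A" and uv: "u \<in> ?I" "v \<in> ?I"
  have inU: "(x, u + \<theta> * (v - u)) \<in> U" if "\<theta> \<in> {0..1}" for \<theta>
    using sub x convex_combination_greaterThanLessThan[OF uv that] by blast
  have cont: "continuous_on {0..1} (\<lambda>\<theta>. partial_t F (x, u + \<theta> * (v - u)))"
    by (rule continuous_on_compose2[OF contF', of _ "\<lambda>\<theta>. (x, u + \<theta> * (v - u))"])
      (use inU in \<open>auto intro!: continuous_intros\<close>)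
  have "((\<lambda>\<theta>. (v - u) *\<^sub>R partial_t F (x, u + \<theta> * (v - u))) has_integral
      F (x, u + 1 * (v - u)) - F (x, u + 0 * (v - u))) {0..1}"
  proof (rule fundamental_theorem_of_calculus)
    fix \<theta> :: real assume \<theta>: "\<theta> \<in> {0..1}"
    have "((\<lambda>y. F (x, y)) has_vector_derivative partial_t F (x, u + \<theta> * (v - u))) (at (u + \<theta> * (v - u)))"
      by (rule has_vector_derivative_partial_t[OF smooth_on_imp_differentiable[OF F inU[OF \<theta>]]])
    moreover have "((\<lambda>\<theta>. u + \<theta> * (v - u)) has_vector_derivative (v - u)) (at \<theta> within {0..1})"
      by (auto intro!: derivative_eq_intros)
    ultimately show "((\<lambda>\<theta>. F (x, u + \<theta> * (v - u))) has_vector_derivative (v - u) *\<^sub>R partial_t F (x, u + \<theta> * (v - u))) (at \<theta> within {0..1})"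
      using vector_diff_chain_within[of "\<lambda>\<theta>. u + \<theta> * (v - u)" "v - u" \<theta> "{0..1}" "\<lambda>y. F (x, y)"]
      by (auto simp: o_def intro: has_vector_derivative_at_within)
  qed simp
  then have "integral {0..1} (\<lambda>\<theta>. (v - u) *\<^sub>R partial_t F (x, u + \<theta> * (v - u)))
      = F (x, u + 1 * (v - u)) - F (x, u + 0 * (v - u))" by (rule integral_unique)
  then show "F (x, v) - F (x, u) = (v - u) * difference_quotient_t F (x, u, v)"
    by (simp add: difference_quotient_t_def)
  fix K assume K: "\<And>y. y \<in> ?I \<Longrightarrow> \<bar>partial_t F (x, y)\<bar> \<le> K"
  have "norm (integral {0..1} (\<lambda>\<theta>. partial_t F (x, u + \<theta> * (v - u)))) \<le> K * (1 - 0)"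
    by (rule integral_bound[OF _ cont])
      (use K convex_combination_greaterThanLessThan[OF uv] in auto)
  then show "\<bar>difference_quotient_t F (x, u, v)\<bar> \<le> K"
    by (simp add: difference_quotient_t_def)
qed

text \<open>One time interval serves all initial values near \<open>y0\<close>. The bounds
  \<open>M\<close> and \<open>K\<close> are exported together with the solutions because the
  continuity of the flow is estimated with them.\<close>

lemma scalar_flow_exists:
  fixes F :: "real \<times> real \<Rightarrow> real"
  assumes U: "open U" and F: "smooth_on U F" and p: "(x0, y0) \<in> U"
  obtains h b K M Y where "0 < h" "0 < b" "0 \<le> K" "0 \<le> M" "{x0-h<..<x0+h} \<times> {y0-b<..<y0+b} \<subseteq> U"
    and "\<And>x y. x \<in> {x0-h<..<x0+h} \<Longrightarrow> y \<in> {y0-b<..<y0+b} \<Longrightarrow> \<bar>F (x, y)\<bar> \<le> M"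
    and "\<And>x y. x \<in> {x0-h<..<x0+h} \<Longrightarrow> y \<in> {y0-b<..<y0+b} \<Longrightarrow> \<bar>partial_t F (x, y)\<bar> \<le> K"
    and "\<And>c. c \<in> {y0-b/2<..<y0+b/2} \<Longrightarrow> Y (x0, c) = c"
    and "\<And>x c. x \<in> {x0-h<..<x0+h} \<Longrightarrow> c \<in> {y0-b/2<..<y0+b/2} \<Longrightarrow> Y (x, c) \<in> {y0-b<..<y0+b}"
    and "\<And>x c. x \<in> {x0-h<..<x0+h} \<Longrightarrow> c \<in> {y0-b/2<..<y0+b/2} \<Longrightarrow>
      ((\<lambda>x. Y (x, c)) has_real_derivative F (x, Y (x, c))) (at x)"
proof -
  obtain A B where AB: "open A" "open B" "(x0, y0) \<in> A \<times> B" "A \<times> B \<subseteq> U"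
    using open_prod_elim[OF U p] by metis
  obtain a where a: "a > 0" "cball x0 a \<subseteq> A" using AB by (meson mem_Sigma_iff open_contains_cball)
  obtain b where b: "b > 0" "cball y0 b \<subseteq> B" using AB by (meson mem_Sigma_iff open_contains_cball)
  define R where "R = {x0-a..x0+a} \<times> {y0-b..y0+b}"
  have R: "R \<subseteq> U" using a b AB(4) by (fastforce simp: R_def cball_def dist_real_def)
  have compR: "compact R" by (auto simp: R_def intro: compact_Times)
  have contF: "continuous_on R F" "continuous_on R (partial_t F)"
    using F R smooth_on_partial_t[OF F] by (auto intro: continuous_on_subset smooth_on_imp_continuous_on)
  obtain M where M: "M > 0" "\<And>q. q \<in> R \<Longrightarrow> \<bar>F q\<bar> \<le> M"
    using compact_imp_bounded[OF compact_continuous_image[OF contF(1) compR]]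
    by (auto simp: bounded_pos)
  obtain K where K: "K > 0" "\<And>q. q \<in> R \<Longrightarrow> \<bar>partial_t F q\<bar> \<le> K"
    using compact_imp_bounded[OF compact_continuous_image[OF contF(2) compR]]
    by (auto simp: bounded_pos)
  \<comment> \<open>\<open>K * h < 1\<close> is the contraction condition, and
    \<open>M * h \<le> b / 2\<close> keeps a solution that starts within b/2 of \<open>y0\<close> in
    the strip of half-width b.\<close>
  define h where "h = min a (min (1 / (2 * K)) (b / (2 * M)))"
  have h: "0 < h" "h \<le> a" "K * h < 1" "M * h \<le> b / 2"
  proof -
    show "0 < h" using a b K M by (simp add: h_def)
    show "h \<le> a" by (simp add: h_def)
    have "K * h \<le> K * (1 / (2 * K))" using K by (intro mult_left_mono) (auto simp: h_def)
    then show "K * h < 1" using K by simp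
    have "M * h \<le> M * (b / (2 * M))" using M by (intro mult_left_mono) (auto simp: h_def)
    then show "M * h \<le> b / 2" using M by simp
  qed
  define cl where "cl = (\<lambda>y. max (y0-b) (min (y0+b) y))"
  have clR: "(x, cl y) \<in> R" if "x \<in> {x0-h..x0+h}" for x y
    using that h b by (auto simp: R_def cl_def)
  have cl_lip: "\<bar>cl y - cl z\<bar> \<le> \<bar>y - z\<bar>" for y z by (auto simp: cl_def max_def min_def)
  have contG: "continuous_on ({x0-h..x0+h} \<times> UNIV) (\<lambda>(x, y). F (x, cl y))"
    unfolding case_prod_unfold
    by (rule continuous_on_compose2[OF contF(1), of _ "\<lambda>q. (fst q, cl (snd q))"])
      (use clR in \<open>auto intro!: continuous_intros simp: cl_def\<close>)
  have lip: "norm (F (x, cl y) - F (x, cl z)) \<le> K * norm (y - z)" if x: "x \<in> {x0-h..x0+h}" for x y z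
  proof -
    have "norm (F (x, cl y) - F (x, cl z)) \<le> K * \<bar>cl y - cl z\<bar>"
    proof (rule has_vector_derivative_bound[where S = "{y0-b..y0+b}" and f' = "\<lambda>y. partial_t F (x, y)"])
      fix y assume y: "y \<in> {y0-b..y0+b}"
      then have "(x, y) \<in> R" using x h by (auto simp: R_def)
      then have "(x, y) \<in> U" "\<bar>partial_t F (x, y)\<bar> \<le> K" using R K by auto
      then show "((\<lambda>y. F (x, y)) has_vector_derivative partial_t F (x, y)) (at y within {y0-b..y0+b})"
        "norm (partial_t F (x, y)) \<le> K"
        by (auto intro!: has_vector_derivative_at_within has_vector_derivative_partial_t smooth_on_imp_differentiable[OF F])
    qed (use b in \<open>auto simp: cl_def\<close>)
    also have "\<dots> \<le> K * \<bar>y - z\<bar>" using K cl_lip by (intro mult_left_mono) auto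
    finally show ?thesis by simp
  qed
  define X where "X = {x0-h..x0+h}"
  have ex: "\<exists>y. y x0 = c \<and> (\<forall>t\<in>X. (y has_vector_derivative F (t, cl (y t))) (at t within X))" for c
    using picard_lindelof[OF h(1) _ h(3) contG lip] K(1) unfolding X_def
    by (metis less_eq_real_def)
  then obtain y where y: "\<And>c. y c x0 = c"
    "\<And>c t. t \<in> X \<Longrightarrow> (y c has_vector_derivative F (t, cl (y c t))) (at t within X)"
    by metis
  have bound: "y c x \<in> {y0-b<..<y0+b}" if x: "x \<in> X" and c: "c \<in> {y0-b/2<..<y0+b/2}" for x c
  proof -
    have "norm (y c x - y c x0) \<le> M * \<bar>x - x0\<bar>"
      by (rule has_vector_derivative_bound[where S = X, OF _ y(2)])
        (use h x clR M in \<open>auto simp: X_def\<close>)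
    also have "\<dots> \<le> M * h" using x M by (intro mult_left_mono) (auto simp: X_def)
    finally have "\<bar>y c x - c\<bar> \<le> b / 2" using h y(1) by simp
    then have "y c x - c \<le> b / 2" "c - y c x \<le> b / 2" by linarith+
    then show ?thesis using c unfolding greaterThanLessThan_iff by linarith
  qed
  have sub: "{x0-h<..<x0+h} \<times> {y0-b<..<y0+b} \<subseteq> R" using h by (auto simp: R_def)
  show thesis
  proof (rule that[of h b K M "\<lambda>(x, c). y c x"])
    show "{x0-h<..<x0+h} \<times> {y0-b<..<y0+b} \<subseteq> U" using sub R by blast
    fix x assume x: "x \<in> {x0-h<..<x0+h}"
    then have X: "x \<in> X" by (auto simp: X_def)
    show "\<bar>F (x, y)\<bar> \<le> M" "\<bar>partial_t F (x, y)\<bar> \<le> K" if "y \<in> {y0-b<..<y0+b}" for y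
      using sub x that M K by blast+
    fix c assume c: "c \<in> {y0-b/2<..<y0+b/2}"
    show "(case (x, c) of (x, c) \<Rightarrow> y c x) \<in> {y0-b<..<y0+b}" using bound[OF X c] by simp
    have "cl (y c x) = y c x" using bound[OF X c] by (auto simp: cl_def)
    then have "(y c has_vector_derivative F (x, y c x)) (at x within X)" using y(2)[OF X] by metis
    moreover have "at x within X = at x" using x by (intro at_within_interior) (auto simp: X_def interior_atLeastAtMost_real)
    ultimately show "((\<lambda>x. case (x, c) of (x, c) \<Rightarrow> y c x) has_real_derivative F (x, case (x, c) of (x, c) \<Rightarrow> y c x)) (at x)"
      by (simp add: has_real_derivative_iff_has_vector_derivative)
  qed (use h b K M y in auto)
qed

text \<open>The difference of two solutions satisfies a linear equation, so it can be integrated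
  explicitly; this gives the derivative with respect to the initial value, and smoothness follows
  by bootstrapping.\<close>

lemma scalar_flow:
  fixes F :: "real \<times> real \<Rightarrow> real"
  assumes U: "open U" and F: "smooth_on U F" and p: "(x0, y0) \<in> U"
  obtains h r Y where "0 < h" "0 < r" "smooth_on ({x0-h<..<x0+h} \<times> {y0-r<..<y0+r}) Y"
    and "\<And>c. c \<in> {y0-r<..<y0+r} \<Longrightarrow> Y (x0, c) = c"
    and "\<And>x c. x \<in> {x0-h<..<x0+h} \<Longrightarrow> c \<in> {y0-r<..<y0+r} \<Longrightarrow> (x, Y (x, c)) \<in> U"
    and "\<And>x c. x \<in> {x0-h<..<x0+h} \<Longrightarrow> c \<in> {y0-r<..<y0+r} \<Longrightarrow> partial_s Y (x, c) = F (x, Y (x, c))"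
    and "\<And>x c. x \<in> {x0-h<..<x0+h} \<Longrightarrow> c \<in> {y0-r<..<y0+r} \<Longrightarrow> partial_t Y (x, c) \<noteq> 0"
proof -
  obtain h b K M Y where pos: "0 < h" "0 < b" "0 \<le> K" "0 \<le> M"
    and sub: "{x0-h<..<x0+h} \<times> {y0-b<..<y0+b} \<subseteq> U"
    and M: "\<And>x y. x \<in> {x0-h<..<x0+h} \<Longrightarrow> y \<in> {y0-b<..<y0+b} \<Longrightarrow> \<bar>F (x, y)\<bar> \<le> M"
    and K: "\<And>x y. x \<in> {x0-h<..<x0+h} \<Longrightarrow> y \<in> {y0-b<..<y0+b} \<Longrightarrow> \<bar>partial_t F (x, y)\<bar> \<le> K"
    and Y0: "\<And>c. c \<in> {y0-b/2<..<y0+b/2} \<Longrightarrow> Y (x0, c) = c"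
    and Yin: "\<And>x c. x \<in> {x0-h<..<x0+h} \<Longrightarrow> c \<in> {y0-b/2<..<y0+b/2} \<Longrightarrow> Y (x, c) \<in> {y0-b<..<y0+b}"
    and Yder: "\<And>x c. x \<in> {x0-h<..<x0+h} \<Longrightarrow> c \<in> {y0-b/2<..<y0+b/2} \<Longrightarrow>
      ((\<lambda>x. Y (x, c)) has_real_derivative F (x, Y (x, c))) (at x)"
    by (rule scalar_flow_exists[OF U F p], rule that)
  define A where "A = {x0-h<..<x0+h}"
  define B where "B = {y0-b/2<..<y0+b/2}"
  define I where "I = {y0-b<..<y0+b}"
  have A: "open A" "convex A" "x0 \<in> A" using pos by (auto simp: A_def)
  have B: "open B" by (simp add: B_def)
  have opAB: "open (A \<times> B)" using A B by (intro open_Times)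
  note M = M[folded A_def I_def] and K = K[folded A_def I_def] and Y0 = Y0[folded B_def]
    and Yin = Yin[folded A_def B_def I_def] and Yder = Yder[folded A_def B_def] and sub = sub[folded A_def I_def]
  define Q where "Q = difference_quotient_t F"
  note dq = difference_quotient_t[OF A(1) sub[unfolded I_def] U F, folded I_def Q_def]
  have contYx: "continuous_on A (\<lambda>x. Y (x, c))" if "c \<in> B" for c
    using Yder[OF _ that] by (auto intro!: continuous_at_imp_continuous_on DERIV_isCont)
  have contQ1: "continuous_on A (\<lambda>x. Q (x, Y (x, c), Y (x, c')))" if "c \<in> B" "c' \<in> B" for c c'
    by (rule continuous_on_compose2[OF dq(1), of _ "\<lambda>x. (x, Y (x, c), Y (x, c'))"])
      (use that Yin in \<open>auto intro!: continuous_intros contYx\<close>)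
  \<comment> \<open>\<open>P\<close> is any primitive of the coefficient along the two solutions,
    normalized at \<open>x0\<close>; it is kept arbitrary so that it can be chosen with or without
    dependence on \<open>c'\<close>.\<close>
  have lin: "Y (x, c') - Y (x, c) = (c' - c) * exp (P x)"
    if "x \<in> A" "c \<in> B" "c' \<in> B" "P x0 = 0"
      "\<And>x. x \<in> A \<Longrightarrow> (P has_real_derivative Q (x, Y (x, c), Y (x, c'))) (at x)" for x c c' P
  proof -
    have "Y (x, c') - Y (x, c) = (Y (x0, c') - Y (x0, c)) * exp (P x)"
    proof (rule scalar_linear_ode[where S = A and D = "\<lambda>x. Y (x, c') - Y (x, c)" and Q = "\<lambda>x. Q (x, Y (x, c), Y (x, c'))"])
      fix x assume x: "x \<in> A"
      have "((\<lambda>x. Y (x, c') - Y (x, c)) has_real_derivative F (x, Y (x, c')) - F (x, Y (x, c))) (at x)"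
        by (intro DERIV_diff Yder x that)
      then show "((\<lambda>x. Y (x, c') - Y (x, c)) has_real_derivative Q (x, Y (x, c), Y (x, c')) * (Y (x, c') - Y (x, c))) (at x)"
        using dq(2)[OF x Yin[OF x that(2)] Yin[OF x that(3)]] by (simp add: mult.commute)
    qed (use that A in auto)
    then show ?thesis using Y0 that by simp
  qed
  \<comment> \<open>The coefficient is bounded by \<open>K\<close> over a time at most
    \<open>h\<close>, which gives a Lipschitz constant in the initial value. Joint continuity of
    \<open>Y\<close> follows from this and the speed bound \<open>M\<close>.\<close>
  have lipc: "\<bar>Y (x, c') - Y (x, c)\<bar> \<le> exp (K * h) * \<bar>c' - c\<bar>" if x: "x \<in> A" and c: "c \<in> B" "c' \<in> B" for x c c'
  proof -
    define q where "q = (\<lambda>(x, _ :: real). Q (x, Y (x, c), Y (x, c')))"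
    define P where "P = (\<lambda>x. primitive_from x0 q (x, 0))"
    have P: "(P has_real_derivative Q (x, Y (x, c), Y (x, c'))) (at x)" if "x \<in> A" for x
      using has_real_derivative_primitive_from[of x0 h q 0 x] contQ1[OF c] that
      by (simp add: P_def q_def A_def)
    have "norm (P x - P x0) \<le> K * \<bar>x - x0\<bar>"
    proof (rule has_vector_derivative_bound[OF A(2), where f' = "\<lambda>x. Q (x, Y (x, c), Y (x, c'))"])
      fix z assume z: "z \<in> A"
      show "(P has_vector_derivative Q (z, Y (z, c), Y (z, c'))) (at z within A)"
        using P[OF z] by (rule has_vector_derivative_at_within[OF has_real_derivative_iff_has_vector_derivative[THEN iffD1]])
      show "norm (Q (z, Y (z, c), Y (z, c'))) \<le> K"
        using dq(4)[OF z Yin[OF z c(1)] Yin[OF z c(2)] K[OF z]] by simp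
    qed (use A x in auto)
    also have "\<dots> \<le> K * h" using x pos by (intro mult_left_mono) (auto simp: A_def)
    finally have "P x \<le> K * h" by (simp add: P_def primitive_from_start)
    then have "\<bar>c' - c\<bar> * exp (P x) \<le> \<bar>c' - c\<bar> * exp (K * h)" by (intro mult_left_mono) auto
    then show ?thesis
      using lin[OF x c _ P] by (simp add: P_def primitive_from_start abs_mult mult.commute)
  qed
  have contY: "continuous_on (A \<times> B) Y"
  proof (rule continuous_onI)
    fix q e assume q: "q \<in> A \<times> B" and e: "(e::real) > 0"
    define L where "L = exp (K * h) + M + 1"
    have L: "L > 0" using pos by (simp add: L_def add_pos_nonneg)
    show "\<exists>d>0. \<forall>q'\<in>A \<times> B. dist q' q < d \<longrightarrow> dist (Y q') (Y q) \<le> e"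
    proof (intro exI[of _ "e / L"] conjI ballI impI)
      show "0 < e / L" using e L by simp
      fix q' assume q': "q' \<in> A \<times> B" "dist q' q < e / L"
      obtain x c x' c' where eq: "q = (x, c)" "q' = (x', c')" by (metis surj_pair)
      have xc: "x \<in> A" "c \<in> B" "x' \<in> A" "c' \<in> B" using q q' eq by auto
      have d: "\<bar>x' - x\<bar> \<le> dist q' q" "\<bar>c' - c\<bar> \<le> dist q' q"
        using dist_fst_le[of q' q] dist_snd_le[of q' q] by (auto simp: eq dist_real_def)
      have 1: "\<bar>Y (x', c') - Y (x', c)\<bar> \<le> exp (K * h) * \<bar>c' - c\<bar>" by (rule lipc) (use xc in auto)
      have "norm (Y (x', c) - Y (x, c)) \<le> M * \<bar>x' - x\<bar>"
      proof (rule has_vector_derivative_bound[OF A(2), where f' = "\<lambda>x. F (x, Y (x, c))"])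
        fix z assume z: "z \<in> A"
        show "((\<lambda>x. Y (x, c)) has_vector_derivative F (z, Y (z, c))) (at z within A)"
          using Yder[OF z xc(2)] by (rule has_vector_derivative_at_within[OF has_real_derivative_iff_has_vector_derivative[THEN iffD1]])
        show "norm (F (z, Y (z, c))) \<le> M" using M[OF z Yin[OF z xc(2)]] by simp
      qed (use xc in auto)
      then have "\<bar>Y (x', c') - Y (x, c)\<bar> \<le> exp (K * h) * \<bar>c' - c\<bar> + M * \<bar>x' - x\<bar>" using 1 by simp
      also have "\<dots> \<le> exp (K * h) * dist q' q + M * dist q' q"
        using d pos by (intro add_mono mult_left_mono) auto
      also have "\<dots> \<le> L * dist q' q" by (simp add: L_def algebra_simps)
      also have "\<dots> \<le> L * (e / L)" using q'(2) L by (intro mult_left_mono) auto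
      finally show "dist (Y q') (Y q) \<le> e" using L by (simp add: eq dist_real_def)
    qed
  qed
  \<comment> \<open>The logarithm of the derivative in the initial value: as \<open>c'\<close> tends
    to \<open>c\<close> the coefficient tends to \<open>partial_t F\<close> along one solution, and
    the exponential factor in \<open>lin\<close> tends to the derivative.\<close>
  define R where "R = primitive_from x0 (\<lambda>(x, c). partial_t F (x, Y (x, c)))"
  have dYc: "((\<lambda>c. Y (x, c)) has_real_derivative exp (R (x, c))) (at c)" if x: "x \<in> A" and c: "c \<in> B" for x c
  proof -
    define q where "q = (\<lambda>(x, c'). Q (x, Y (x, c), Y (x, c')))"
    have contq: "continuous_on (A \<times> B) q"
      unfolding q_def case_prod_unfold
    proof (rule continuous_on_compose2[OF dq(1), of _ "\<lambda>z. (fst z, Y (fst z, c), Y (fst z, snd z))"])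
      show "continuous_on (A \<times> B) (\<lambda>z. (fst z, Y (fst z, c), Y (fst z, snd z)))"
        by (intro continuous_intros continuous_on_compose2[OF contYx[OF c]] continuous_on_compose2[OF contY]) auto
    qed (use Yin c in auto)
    have "Ck_on 0 (A \<times> B) (primitive_from x0 q)"
      unfolding A_def by (rule Ck_on_primitive_from[OF B]) (use contq in \<open>simp add: A_def\<close>)
    then have contP: "continuous_on (A \<times> B) (primitive_from x0 q)" by simp
    have diff: "Y (x, c') - Y (x, c) = (c' - c) * exp (primitive_from x0 q (x, c'))" if c': "c' \<in> B" for c'
    proof (rule lin[OF x c c'])
      fix z assume z: "z \<in> A"
      have "((\<lambda>x. primitive_from x0 q (x, c')) has_real_derivative q (z, c')) (at z)"
        by (rule has_real_derivative_primitive_from[where h = h])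
          (use contQ1[OF c c'] z in \<open>auto simp: q_def A_def\<close>)
      then show "((\<lambda>x. primitive_from x0 q (x, c')) has_real_derivative Q (z, Y (z, c), Y (z, c'))) (at z)"
        by (simp add: q_def)
    qed (simp add: primitive_from_start)
    have "continuous_on B (\<lambda>c'. exp (primitive_from x0 q (x, c')))"
      by (intro continuous_intros continuous_on_compose2[OF contP]) (use x in auto)
    then have "isCont (\<lambda>c'. exp (primitive_from x0 q (x, c'))) c"
      using B c by (simp add: continuous_on_eq_continuous_at)
    then have "((\<lambda>c'. exp (primitive_from x0 q (x, c'))) \<longlongrightarrow> exp (primitive_from x0 q (x, c))) (at c)"
      by (simp add: isCont_def)
    then have "((\<lambda>c'. (Y (x, c') - Y (x, c)) / (c' - c)) \<longlongrightarrow> exp (primitive_from x0 q (x, c))) (at c)"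
    proof (rule Lim_transform_eventually)
      show "\<forall>\<^sub>F c' in at c. exp (primitive_from x0 q (x, c')) = (Y (x, c') - Y (x, c)) / (c' - c)"
        using eventually_at_in_open[OF B c] by eventually_elim (simp add: diff)
    qed
    then have "((\<lambda>c. Y (x, c)) has_real_derivative exp (primitive_from x0 q (x, c))) (at c)"
      by (simp add: has_field_derivative_iff)
    moreover have "primitive_from x0 q (x, c) = R (x, c)"
      by (simp add: R_def primitive_from_def q_def dq(3))
    ultimately show ?thesis by simp
  qed
  have YU: "(x, Y (x, c)) \<in> U" if "x \<in> A" "c \<in> B" for x c using sub Yin[OF that] that by blast
  \<comment> \<open>The first partial of \<open>Y\<close> is a smooth function of (x, Y), and the
    second is the exponential of a primitive of such a function. Both have the order of
    \<open>Y\<close>, so each round gains one order.\<close>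
  have "Ck_on k (A \<times> B) Y" for k
  proof (induction k)
    case 0
    then show ?case using contY by simp
  next
    case (Suc k)
    have "Ck_on k (A \<times> B) (\<lambda>z. (fst z, 0) + (0, Y z))"
    proof (intro Ck_on_add opAB)
      have "smooth_on (A \<times> B) (\<lambda>z. (fst z, 0 :: real))"
        by (intro smooth_on_Pair smooth_on_fst smooth_on_const smooth_on_ident opAB)
      then show "Ck_on k (A \<times> B) (\<lambda>z. (fst z, 0 :: real))" by (simp add: smooth_on_def)
      show "Ck_on k (A \<times> B) (\<lambda>z. (0 :: real, Y z))"
        by (rule Ck_on_bounded_linear[OF bounded_linear_Pair[OF bounded_linear_zero bounded_linear_ident] opAB Suc])
    qed
    then have G: "Ck_on k (A \<times> B) (\<lambda>z. (fst z, Y z))" by simp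
    have im: "(\<lambda>z. (fst z, Y z)) ` (A \<times> B) \<subseteq> U" using YU by auto
    have comp: "Ck_on k (A \<times> B) (\<lambda>z. H (fst z, Y z))" if "smooth_on U H" for H :: "real \<times> real \<Rightarrow> real"
      using that Ck_on_compose[OF opAB U im _ G, of H] by (simp add: smooth_on_def)
    have "Ck_on k (A \<times> B) (\<lambda>(x, c). partial_t F (x, Y (x, c)))"
      using comp[OF smooth_on_partial_t[OF F]] by (simp add: case_prod_unfold)
    then have R: "Ck_on k (A \<times> B) R"
      unfolding R_def A_def by (rule Ck_on_primitive_from[OF B])
    have eR: "Ck_on k (A \<times> B) (\<lambda>z. exp (R z))"
      by (rule Ck_on_compose[OF opAB open_UNIV _ Ck_on_exp R]) simp
    show ?case
    proof (rule Ck_on_Suc_partials[OF opAB, where ?f1.0 = "\<lambda>z. F (fst z, Y z)" and ?f2.0 = "\<lambda>z. exp (R z)"])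
      fix s t assume st: "(s, t) \<in> A \<times> B"
      show "((\<lambda>s. Y (s, t)) has_vector_derivative F (fst (s, t), Y (s, t))) (at s)"
        using Yder[of s t] st by (simp add: has_real_derivative_iff_has_vector_derivative)
      show "((\<lambda>t. Y (s, t)) has_vector_derivative exp (R (s, t))) (at t)"
        using dYc[of s t] st by (simp add: has_real_derivative_iff_has_vector_derivative)
    qed (use comp[OF F] eR in auto)
  qed
  then have smY: "smooth_on (A \<times> B) Y" by (simp add: smooth_on_def)
  have diffY: "Y differentiable (at (x, c))" if "x \<in> A" "c \<in> B" for x c
    using smooth_on_imp_differentiable[OF smY] that by auto
  show thesis
  proof (rule that[of h "b/2" Y, folded A_def B_def])
    fix x c assume xc: "x \<in> A" "c \<in> B"
    show "partial_s Y (x, c) = F (x, Y (x, c))"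
      using Yder[OF xc] by (intro partial_s_eqI[OF diffY[OF xc]]) (simp add: has_real_derivative_iff_has_vector_derivative)
    have "partial_t Y (x, c) = exp (R (x, c))"
      using dYc[OF xc] by (intro partial_t_eqI[OF diffY[OF xc]]) (simp add: has_real_derivative_iff_has_vector_derivative)
    then show "partial_t Y (x, c) \<noteq> 0" by simp
  qed (use pos smY Y0 YU in auto)
qed

section \<open>First integrals, arc length, and parallel frames\<close>

text \<open>The value of \<open>h\<close> at a point is the initial value of the integral curve of
  slope \<open>F\<close> through it, that is, the second component of the inverse of (x, c)
  \<mapsto> (x, Y(x, c)). The latter is locally invertible because the derivative of the flow in c
  is nonzero.\<close>

lemma first_integral_graph:
  fixes F :: "real \<times> real \<Rightarrow> real"
  assumes U: "open U" and F: "smooth_on U F" and p: "p \<in> U"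
  obtains V h where "open V" "p \<in> V" "V \<subseteq> U" "smooth_on V h"
    and "\<And>q. q \<in> V \<Longrightarrow> partial_s h q + F q * partial_t h q = 0"
    and "\<And>q. q \<in> V \<Longrightarrow> partial_t h q \<noteq> (0::real)"
proof -
  obtain x0 y0 where p0: "p = (x0, y0)" by (cases p)
  obtain h0 r Y where pos: "0 < h0" "0 < r" and smY': "smooth_on ({x0-h0<..<x0+h0} \<times> {y0-r<..<y0+r}) Y"
    and Y0: "\<And>c. c \<in> {y0-r<..<y0+r} \<Longrightarrow> Y (x0, c) = c"
    and YU': "\<And>x c. x \<in> {x0-h0<..<x0+h0} \<Longrightarrow> c \<in> {y0-r<..<y0+r} \<Longrightarrow> (x, Y (x, c)) \<in> U"
    and Ys': "\<And>x c. x \<in> {x0-h0<..<x0+h0} \<Longrightarrow> c \<in> {y0-r<..<y0+r} \<Longrightarrow> partial_s Y (x, c) = F (x, Y (x, c))"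
    and Yt': "\<And>x c. x \<in> {x0-h0<..<x0+h0} \<Longrightarrow> c \<in> {y0-r<..<y0+r} \<Longrightarrow> partial_t Y (x, c) \<noteq> 0"
    by (rule scalar_flow[OF U F p[unfolded p0]], rule that)
  define S where "S = {x0-h0<..<x0+h0} \<times> {y0-r<..<y0+r}"
  have S: "open S" "p \<in> S" using pos by (auto simp: S_def p0 intro: open_Times)
  define G where "G = (\<lambda>z. (fst z, Y z))"
  have smY: "smooth_on S Y" using smY' by (simp add: S_def)
  have smG: "smooth_on S G"
    unfolding G_def by (intro smooth_on_Pair smooth_on_fst smooth_on_ident S smY)
  have Ys: "partial_s Y z = F (G z)" and Yt: "partial_t Y z \<noteq> 0" and GU: "G z \<in> U" if "z \<in> S" for z
    using that Ys'[of "fst z" "snd z"] Yt'[of "fst z" "snd z"] YU'[of "fst z" "snd z"] by (auto simp: S_def G_def)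
  have dG: "(G has_derivative (\<lambda>v. (fst v, fst v * F (G z) + snd v * partial_t Y z))) (at z)" if z: "z \<in> S" for z
  proof -
    have "(Y has_derivative frechet_derivative Y (at z)) (at z)"
      by (rule smooth_on_has_derivative[OF smY z])
    moreover have "frechet_derivative Y (at z) = (\<lambda>v. fst v * F (G z) + snd v * partial_t Y z)"
      using frechet_derivative_eq_partials[OF smooth_on_imp_differentiable[OF smY z]] Ys[OF z] by auto
    ultimately show ?thesis
      unfolding G_def by (auto intro!: derivative_eq_intros simp: G_def)
  qed
  have "frechet_derivative G (at p) = (\<lambda>v. (fst v, fst v * F (G p) + snd v * partial_t Y p))"
    using frechet_derivative_at[OF dG[OF S(2)]] by simp
  then have inj: "inj (frechet_derivative G (at p))"
    using Yt[OF S(2)] by (auto simp: inj_on_def)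
  obtain U' V g where *: "open U'" "U' \<subseteq> S" "p \<in> U'" "open V" "homeomorphism U' V G g" "smooth_on V g"
    using smooth_local_inverse[OF S(1) smG S(2) inj] by metis
  define h where "h = (\<lambda>q. snd (g q))"
  have smh: "smooth_on V h" unfolding h_def by (intro smooth_on_snd * )
  have VG: "V = G ` U'" using *(5) by (simp add: homeomorphism_def)
  \<comment> \<open>Differentiation of h(x, Y(x, c)) = c. It shows that (1, F) is mapped to 0, while
    the vertical vector of length \<open>partial_t Y\<close> is mapped to 1.\<close>
  have key: "frechet_derivative h (at q) (fst v, fst v * F q + snd v * d) = snd v"
    if q: "q \<in> V" "z \<in> U'" "q = G z" "d = partial_t Y z" for q z d v
  proof -
    have z: "z \<in> S" using q * by auto
    have "((\<lambda>z. h (G z)) has_derivative (\<lambda>v. frechet_derivative h (at q) (fst v, fst v * F q + snd v * d))) (at z)"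
      using has_derivative_compose[OF dG[OF z], of h "frechet_derivative h (at q)"]
        smooth_on_has_derivative[OF smh q(1)] q by simp
    moreover have "h (G z) = snd z" if "z \<in> U'" for z
      using that *(5) by (simp add: h_def homeomorphism_def)
    ultimately have "((\<lambda>z. snd z) has_derivative (\<lambda>v. frechet_derivative h (at q) (fst v, fst v * F q + snd v * d))) (at z)"
      using has_derivative_cong_open[OF *(1) q(2), of "\<lambda>z. h (G z)" snd] by simp
    moreover have "((\<lambda>z. snd z) has_derivative snd) (at z)" by (auto intro!: derivative_eq_intros)
    ultimately have "(\<lambda>v. frechet_derivative h (at q) (fst v, fst v * F q + snd v * d)) = snd"
      by (rule has_derivative_unique)
    from fun_cong[OF this, of v] show ?thesis by simp
  qed
  show thesis
  proof (rule that[OF *(4) _ _ smh])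
    have "G p = p" using Y0 pos by (simp add: G_def p0)
    then show "p \<in> V" using *(3) VG by (metis imageI)
    show "V \<subseteq> U" using GU *(2) VG by auto
    fix q assume q: "q \<in> V"
    then obtain z where z: "z \<in> U'" "q = G z" using VG by blast
    have dif: "h differentiable (at q)" by (rule smooth_on_imp_differentiable[OF smh q])
    have 1: "frechet_derivative h (at q) (1, F q) = 0"
      using key[OF q z refl, of "(1, 0)"] by simp
    have 2: "frechet_derivative h (at q) (0, partial_t Y z) = 1"
      using key[OF q z refl, of "(0, 1)"] by simp
    show "partial_s h q + F q * partial_t h q = 0"
      using 1 by (simp add: frechet_derivative_eq_partials[OF dif])
    show "partial_t h q \<noteq> 0"
      using 2 by (auto simp: frechet_derivative_eq_partials[OF dif])
  qed
qed

lemma in_span_plane_iff: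
  fixes X v :: "real \<times> real"
  assumes "fst X \<noteq> 0"
  shows "v \<in> span {X} \<longleftrightarrow> snd v = snd X / fst X * fst v"
proof
  assume "v \<in> span {X}"
  then show "snd v = snd X / fst X * fst v" using assms by (auto simp: span_singleton)
next
  assume *: "snd v = snd X / fst X * fst v"
  have "v = (fst v / fst X) *\<^sub>R X" using * assms by (simp add: prod_eq_iff)
  then show "v \<in> span {X}" by (metis span_base span_scale singletonI)
qed

text \<open>Where the field is not vertical its integral lines are graphs of slope
  \<open>snd X / fst X\<close>. The kernel is no larger than the line, because a first integral of
  this slope has nonzero t-derivative.\<close>

lemma first_integral_nonvertical:
  fixes X :: "real \<times> real \<Rightarrow> real \<times> real"
  assumes U: "open U" and X: "smooth_on U X" and p: "p \<in> U" "fst (X p) \<noteq> 0"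
  obtains V h where "open V" "p \<in> V" "V \<subseteq> U" "smooth_on V h"
    and "\<And>q v. q \<in> V \<Longrightarrow> frechet_derivative h (at q) v = (0::real) \<longleftrightarrow> v \<in> span {X q}"
proof -
  define U1 where "U1 = {q \<in> U. fst (X q) \<noteq> 0}"
  have contX: "continuous_on U (\<lambda>q. fst (X q))"
    by (intro continuous_intros smooth_on_imp_continuous_on X)
  have "open (U \<inter> (\<lambda>q. fst (X q)) -` {x. x \<noteq> 0})"
    using contX U by (rule continuous_open_preimage) (simp add: open_Collect_neq continuous_on_id continuous_on_const)
  moreover have "U1 = U \<inter> (\<lambda>q. fst (X q)) -` {x. x \<noteq> 0}" by (auto simp: U1_def)
  ultimately have U1: "open U1" by simp
  have X1: "smooth_on U1 X" by (rule smooth_on_subset[OF X]) (auto simp: U1_def)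
  have smF: "smooth_on U1 (\<lambda>q. snd (X q) / fst (X q))"
    by (intro smooth_on_divide smooth_on_fst smooth_on_snd U1 X1) (simp add: U1_def)
  have p1: "p \<in> U1" using p by (simp add: U1_def)
  obtain V h where V: "open V" "p \<in> V" "V \<subseteq> U1" and h: "smooth_on V h"
    and h0: "\<And>q. q \<in> V \<Longrightarrow> partial_s h q + snd (X q) / fst (X q) * partial_t h q = 0"
    and h1: "\<And>q. q \<in> V \<Longrightarrow> partial_t h q \<noteq> 0"
    by (rule first_integral_graph[OF U1 smF p1], rule that)
  show thesis
  proof (rule that[OF V(1,2) _ h])
    show "V \<subseteq> U" using V(3) by (auto simp: U1_def)
    fix q v assume q: "q \<in> V"
    have X0: "fst (X q) \<noteq> 0" using q V(3) by (auto simp: U1_def)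
    have "frechet_derivative h (at q) v = fst v * partial_s h q + snd v * partial_t h q"
      using frechet_derivative_eq_partials[OF smooth_on_imp_differentiable[OF h q]] by simp
    also have "\<dots> = (snd v - snd (X q) / fst (X q) * fst v) * partial_t h q"
      using h0[OF q] by (simp add: algebra_simps eq_neg_iff_add_eq_0[symmetric])
    finally show "frechet_derivative h (at q) v = 0 \<longleftrightarrow> v \<in> span {X q}"
      using h1[OF q] in_span_plane_iff[OF X0, of v] by auto
  qed
qed

lemma bounded_linear_swap_plane: "bounded_linear (prod.swap :: real \<times> real \<Rightarrow> real \<times> real)"
  unfolding prod.swap_def by (intro bounded_linear_Pair bounded_linear_fst bounded_linear_snd)

text \<open>If the vector at the point is vertical, exchanging the two coordinates makes it
  nonvertical.\<close>

lemma first_integral: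
  fixes X :: "real \<times> real \<Rightarrow> real \<times> real"
  assumes U: "open U" and X: "smooth_on U X" and p: "p \<in> U" "X p \<noteq> 0"
  obtains V h where "open V" "p \<in> V" "V \<subseteq> U" "smooth_on V h"
    and "\<And>q v. q \<in> V \<Longrightarrow> frechet_derivative h (at q) v = (0::real) \<longleftrightarrow> v \<in> span {X q}"
proof (cases "fst (X p) = 0")
  case False
  show thesis by (rule first_integral_nonvertical[OF U X p(1) False], rule that)
next
  case True
  let ?s = "prod.swap :: real \<times> real \<Rightarrow> real \<times> real"
  define U' where "U' = ?s -` U"
  define X' where "X' = (\<lambda>q. ?s (X (?s q)))"
  have cs: "continuous_on S ?s" for S by (intro linear_continuous_on bounded_linear_swap_plane)
  have vim: "open (?s -` S)" if "open S" for S using that cs by (intro open_vimage)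
  have U': "open U'" unfolding U'_def by (rule vim[OF U])
  have sms: "smooth_on S ?s" if "open S" for S
    using smooth_on_bounded_linear[OF bounded_linear_swap_plane that smooth_on_ident[OF that]] .
  have "smooth_on U' (\<lambda>q. X (?s q))"
    by (rule smooth_on_compose[OF U' U _ X sms[OF U']]) (auto simp: U'_def)
  then have smX': "smooth_on U' X'"
    unfolding X'_def by (rule smooth_on_bounded_linear[OF bounded_linear_swap_plane U'])
  have p': "?s p \<in> U'" "fst (X' (?s p)) \<noteq> 0" using p True by (auto simp: U'_def X'_def prod_eq_iff)
  obtain V' h' where V': "open V'" "?s p \<in> V'" "V' \<subseteq> U'" and h': "smooth_on V' h'"
    and ker: "\<And>q v. q \<in> V' \<Longrightarrow> frechet_derivative h' (at q) v = (0::real) \<longleftrightarrow> v \<in> span {X' q}"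
    by (rule first_integral_nonvertical[OF U' smX' p'], rule that)
  define V where "V = ?s -` V'"
  have V: "open V" unfolding V_def by (rule vim[OF V'(1)])
  have im: "?s ` V \<subseteq> V'" by (auto simp: V_def)
  show thesis
  proof (rule that[of V "\<lambda>q. h' (?s q)"])
    show "open V" by (rule V)
    show "p \<in> V" "V \<subseteq> U" using V' by (auto simp: V_def U'_def)
    show "smooth_on V (\<lambda>q. h' (?s q))" by (rule smooth_on_compose[OF V V'(1) im h' sms[OF V]])
    fix q v assume q: "q \<in> V"
    then have q': "?s q \<in> V'" by (auto simp: V_def)
    have "((\<lambda>q. h' (?s q)) has_derivative (\<lambda>v. frechet_derivative h' (at (?s q)) (?s v))) (at q)"
      by (rule has_derivative_compose[OF bounded_linear_imp_has_derivative[OF bounded_linear_swap_plane]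
            smooth_on_has_derivative[OF h' q']])
    then have "frechet_derivative (\<lambda>q. h' (?s q)) (at q) v = frechet_derivative h' (at (?s q)) (?s v)"
      using frechet_derivative_at by metis
    then show "frechet_derivative (\<lambda>q. h' (?s q)) (at q) v = 0 \<longleftrightarrow> v \<in> span {X q}"
      using ker[OF q', of "?s v"] by (force simp: X'_def span_singleton prod_eq_iff)
  qed
qed

section \<open>Arc length and parallel orthonormal frames\<close>

lemma smooth_antiderivative:
  fixes v :: "real \<Rightarrow> real"
  assumes v: "smooth_on {l<..<m} v"
  obtains P where "smooth_on {l<..<m} P" "\<And>x. x \<in> {l<..<m} \<Longrightarrow> (P has_real_derivative v x) (at x)"
proof (cases "l < m")
  case True
  have "\<exists>F. \<forall>x :: real. ereal l < x \<longrightarrow> x < ereal m \<longrightarrow> (F has_vector_derivative v x) (at x)"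
    by (rule einterval_antiderivative)
      (use True smooth_on_imp_continuous_on[OF v] in \<open>auto simp: continuous_on_eq_continuous_at\<close>)
  then obtain P where P: "\<And>x. x \<in> {l<..<m} \<Longrightarrow> (P has_vector_derivative v x) (at x)" by auto
  have "Ck_on k {l<..<m} v" for k using v by (simp add: smooth_on_def)
  then have "smooth_on {l<..<m} P"
    by (intro smooth_on_real_if_derivative[where f' = v] P) auto
  then show ?thesis using that P by (auto simp: has_real_derivative_iff_has_vector_derivative)
next
  case False
  then show ?thesis using that[of v] v by auto
qed

text \<open>\<tau> is the arc length and \<sigma> its inverse. Since \<sigma>' = 1 / v(\<sigma>),
  the inverse gains one order of regularity at a time.\<close>

lemma positive_speed_reparametrization:
  fixes v :: "real \<Rightarrow> real"
  assumes K: "K = {l<..<m}" "l < m" and v: "smooth_on K v" and pos: "\<And>x. x \<in> K \<Longrightarrow> v x > 0"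
  obtains K' \<sigma> \<tau> where "open_interval K'" "\<tau> ` K = K'" "\<sigma> ` K' = K"
    "\<And>x. x \<in> K \<Longrightarrow> \<sigma> (\<tau> x) = x" "\<And>y. y \<in> K' \<Longrightarrow> \<tau> (\<sigma> y) = y"
    "smooth_on K \<tau>" "smooth_on K' \<sigma>"
    "\<And>x. x \<in> K \<Longrightarrow> (\<tau> has_real_derivative v x) (at x)"
    "\<And>y. y \<in> K' \<Longrightarrow> (\<sigma> has_real_derivative inverse (v (\<sigma> y))) (at y)"
proof -
  obtain \<tau> where \<tau>: "smooth_on K \<tau>" "\<And>x. x \<in> K \<Longrightarrow> (\<tau> has_real_derivative v x) (at x)"
    using smooth_antiderivative[OF v[unfolded K]] unfolding K by metis
  have opK: "open K" by (simp add: K)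
  have mono: "\<tau> x < \<tau> y" if "x \<in> K" "y \<in> K" "x < y" for x y
  proof (rule DERIV_pos_imp_increasing[OF that(3)])
    fix z assume "x \<le> z" "z \<le> y"
    then have "z \<in> K" using that(1,2) by (simp add: K)
    then show "\<exists>d. (\<tau> has_real_derivative d) (at z) \<and> 0 < d" using \<tau>(2) pos by blast
  qed
  have inj: "inj_on \<tau> K"
    by (rule inj_onI) (metis mono less_irrefl linorder_less_linear)
  define K' where "K' = \<tau> ` K"
  define \<sigma> where "\<sigma> = inv_into K \<tau>"
  have \<sigma>\<tau>: "\<sigma> (\<tau> x) = x" if "x \<in> K" for x using inj that by (simp add: \<sigma>_def)
  have \<tau>\<sigma>: "\<tau> (\<sigma> y) = y" and \<sigma>K: "\<sigma> y \<in> K" if "y \<in> K'" for y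
    using that by (auto simp: \<sigma>_def K'_def f_inv_into_f inv_into_into)
  have cont: "continuous_on K \<tau>" by (rule smooth_on_imp_continuous_on[OF \<tau>(1)])
  have opK': "open K'" unfolding K'_def by (rule invariance_of_domain[OF cont opK inj])
  have "connected K'" unfolding K'_def by (rule connected_continuous_image[OF cont]) (simp add: K)
  then have oi: "open_interval K'"
    using opK' K by (auto simp: open_interval_def is_interval_connected_1 K'_def)
  have d\<sigma>: "(\<sigma> has_real_derivative inverse (v (\<sigma> y))) (at y)" if y: "y \<in> K'" for y
  proof -
    have x: "\<sigma> y \<in> K" by (rule \<sigma>K[OF y])
    have "(\<sigma> has_derivative (*) (inverse (v (\<sigma> y)))) (at (\<tau> (\<sigma> y)))"
    proof (rule has_derivative_inverse_strong[OF opK x cont \<sigma>\<tau>])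
      show "(\<tau> has_derivative (*) (v (\<sigma> y))) (at (\<sigma> y))"
        using \<tau>(2)[OF x] by (simp add: has_field_derivative_def)
      show "(*) (v (\<sigma> y)) \<circ> (*) (inverse (v (\<sigma> y))) = id"
        using pos[OF x] by (auto simp: fun_eq_iff)
    qed
    then show ?thesis using \<tau>\<sigma>[OF y] by (simp add: has_field_derivative_def)
  qed
  have "smooth_on K (\<lambda>x. inverse (v x))"
    by (intro smooth_on_inverse opK v) (use pos in force)
  then have inv: "Ck_on k K (\<lambda>x. inverse (v x))" for k by (simp add: smooth_on_def)
  have "smooth_on K' \<sigma>"
  proof (rule smooth_on_real_if_derivative[OF opK'])
    show "(\<sigma> has_vector_derivative inverse (v (\<sigma> y))) (at y)" if "y \<in> K'" for y
      using d\<sigma>[OF that] by (simp add: has_real_derivative_iff_has_vector_derivative)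
    show "Ck_on k K' (\<lambda>y. inverse (v (\<sigma> y)))" if "Ck_on k K' \<sigma>" for k
      by (rule Ck_on_compose[OF opK' opK _ inv that]) (use \<sigma>K in auto)
  qed
  moreover have "\<sigma> ` K' = K" using \<sigma>\<tau> \<sigma>K by (force simp: K'_def)
  ultimately show thesis
    using that[OF oi _ _ \<sigma>\<tau> \<tau>\<sigma> \<tau>(1) _ \<tau>(2) d\<sigma>] by (simp add: K'_def)
qed

text \<open>The defect of the expansion is orthogonal to \<open>CARD('m)\<close> nonzero orthogonal
  vectors. They span the space, so the defect is orthogonal to itself.\<close>

lemma orthonormal_expansion:
  fixes e :: "'n::finite \<Rightarrow> real^'m" and v x :: "real^'m"
  assumes dim: "CARD('m::finite) = CARD('n) + 1"
    and v: "v \<bullet> v = 1" and ev: "\<And>i. e i \<bullet> v = 0" and ee: "\<And>i j. e i \<bullet> e j = (if i = j then 1 else 0)"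
  shows "x = (x \<bullet> v) *\<^sub>R v + (\<Sum>i\<in>UNIV. (x \<bullet> e i) *\<^sub>R e i)"
proof -
  define S where "S = insert v (range e)"
  have inj: "inj e" by (rule injI) (metis ee zero_neq_one)
  have vn: "v \<notin> range e" using ev v ee by (metis rangeE zero_neq_one)
  have cardS: "card S = CARD('m)" using vn dim by (simp add: S_def card_image[OF inj])
  have "pairwise orthogonal S"
    unfolding S_def pairwise_def orthogonal_def using ev ee by (auto simp: inner_commute)
  moreover have "0 \<notin> S" using v ee by (auto simp: S_def) (metis inner_zero_left zero_neq_one)
  ultimately have ind: "independent S" by (rule pairwise_orthogonal_independent)
  have span: "UNIV \<subseteq> span S"
    by (rule card_ge_dim_independent[OF _ ind]) (simp_all add: cardS)
  define y where "y = x - ((x \<bullet> v) *\<^sub>R v + (\<Sum>i\<in>UNIV. (x \<bullet> e i) *\<^sub>R e i))"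
  have "y \<bullet> v = 0" using v ev by (simp add: y_def inner_diff_left inner_add_left inner_sum_left)
  moreover have "y \<bullet> e j = 0" for j
  proof -
    have "(\<Sum>i\<in>UNIV. (x \<bullet> e i) * (e i \<bullet> e j)) = (\<Sum>i\<in>UNIV. if i = j then x \<bullet> e j else 0)"
      by (rule sum.cong) (auto simp: ee)
    also have "\<dots> = x \<bullet> e j" by simp
    finally show ?thesis
      using ev by (simp add: y_def inner_diff_left inner_add_left inner_sum_left inner_commute[of v])
  qed
  ultimately have "\<And>z. z \<in> S \<Longrightarrow> orthogonal y z" by (auto simp: S_def orthogonal_def)
  then have "orthogonal y y" using span by (intro orthogonal_to_span[of y S]) auto
  then show ?thesis by (simp add: y_def orthogonal_self)
qed

lemma orthonormal_complement_of_unit_vector: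
  fixes v :: "real^'m"
  assumes dim: "CARD('m::finite) = CARD('n::finite) + 1" and v: "v \<bullet> v = 1"
  obtains e :: "'n::finite \<Rightarrow> real^'m" where "\<And>i. e i \<bullet> v = 0" "\<And>i j. e i \<bullet> e j = (if i = j then 1 else 0)"
proof -
  have "dim {y \<in> UNIV. \<forall>x \<in> span {v}. orthogonal x y} + dim (span {v}) = dim (UNIV :: (real^'m) set)"
    by (rule dim_subspace_orthogonal_to_vectors) auto
  moreover have "dim (span {v}) = 1" using v by (simp add: dim_span) auto
  moreover have "{y \<in> UNIV. \<forall>x \<in> span {v}. orthogonal x y} = {v}\<^sup>\<bottom>"
    by (auto simp: orthogonal_comp_def span_singleton orthogonal_def)
  ultimately have dimv: "dim ({v}\<^sup>\<bottom>) = CARD('n)" using dim by simp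
  obtain B where B: "B \<subseteq> {v}\<^sup>\<bottom>" "pairwise orthogonal B" "\<And>x. x \<in> B \<Longrightarrow> norm x = 1" "independent B" "card B = dim ({v}\<^sup>\<bottom>)"
    using orthonormal_basis_subspace[OF subspace_orthogonal_comp] by metis
  have "finite B" using B(4) independent_imp_finite by blast
  then obtain e where e: "bij_betw e (UNIV :: 'n set) B"
    using B(5) dimv finite_same_card_bij[of "UNIV :: 'n set" B] by auto
  show thesis
  proof (rule that)
    show "e i \<bullet> v = 0" for i
    proof -
      have "e i \<in> {v}\<^sup>\<bottom>" using e B(1) by (auto simp: bij_betw_def)
      then show ?thesis by (simp add: orthogonal_comp_def orthogonal_def inner_commute)
    qed
    show "e i \<bullet> e j = (if i = j then 1 else 0)" for i j
    proof (cases "i = j")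
      case True
      have "norm (e i) = 1" using e B(3) by (auto simp: bij_betw_def)
      then show ?thesis using True by (simp add: dot_square_norm)
    next
      case False
      then have "e i \<in> B" "e j \<in> B" "e i \<noteq> e j" using e by (auto simp: bij_betw_def inj_on_def)
      then show ?thesis using B(2) False by (auto simp: pairwise_def orthogonal_def)
    qed
  qed
qed

text \<open>At unit speed, the chosen multiple of \<gamma>' is the one that keeps \<xi> orthogonal
  to \<gamma>'. The equation is linear, so its Lipschitz constant depends on the curve alone; hence
  \<delta> is fixed before the initial vector and serves all members of a frame.\<close>

lemma parallel_normal_field:
  fixes \<gamma> :: "real \<Rightarrow> 'a::euclidean_space"
  assumes I: "open I" and \<gamma>: "smooth_on I \<gamma>" and s0: "s0 \<in> I"
  obtains \<delta> where "\<delta> > 0" "{s0-\<delta><..<s0+\<delta>} \<subseteq> I"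
    "\<And>e. \<exists>\<xi>. smooth_on {s0-\<delta><..<s0+\<delta>} \<xi> \<and> \<xi> s0 = e \<and>
      (\<forall>s\<in>{s0-\<delta><..<s0+\<delta>}. (\<xi> has_vector_derivative - (\<xi> s \<bullet> velocity (velocity \<gamma>) s) *\<^sub>R velocity \<gamma> s) (at s))"
proof -
  obtain a where a: "a > 0" "cball s0 a \<subseteq> I" using I s0 open_contains_cball by blast
  have smg: "smooth_on I (velocity \<gamma>)" "smooth_on I (velocity (velocity \<gamma>))"
    by (intro smooth_on_velocity I \<gamma>)+
  define N where "N = (\<lambda>s. norm (velocity (velocity \<gamma>) s) * norm (velocity \<gamma> s))"
  have "continuous_on (cball s0 a) N"
    unfolding N_def by (intro continuous_intros continuous_on_subset[OF _ a(2)] smooth_on_imp_continuous_on smg)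
  then have "bounded (N ` cball s0 a)"
    by (intro compact_imp_bounded compact_continuous_image compact_cball)
  then obtain K where K: "K > 0" "\<And>s. s \<in> cball s0 a \<Longrightarrow> N s \<le> K"
    unfolding bounded_pos by (metis abs_le_D1 imageI real_norm_def)
  define \<delta> where "\<delta> = min a (1 / (2 * K))"
  have \<delta>: "0 < \<delta>" "\<delta> \<le> a" using a K by (auto simp: \<delta>_def)
  have "K * \<delta> \<le> K * (1 / (2 * K))" using K by (intro mult_left_mono) (auto simp: \<delta>_def)
  then have K\<delta>: "K * \<delta> < 1" using K by simp
  have sub: "{s0-\<delta>..s0+\<delta>} \<subseteq> cball s0 a" using \<delta> by (auto simp: dist_real_def)
  let ?F = "\<lambda>s x. - (x \<bullet> velocity (velocity \<gamma>) s) *\<^sub>R velocity \<gamma> s"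
  have cont: "continuous_on ({s0-\<delta>..s0+\<delta>} \<times> UNIV) (\<lambda>(s, x). ?F s x)"
    unfolding case_prod_unfold
    by (intro continuous_intros continuous_on_compose2[OF smooth_on_imp_continuous_on[OF smg(1)]]
        continuous_on_compose2[OF smooth_on_imp_continuous_on[OF smg(2)]]) (use sub a in auto)
  have lip: "norm (?F s x - ?F s y) \<le> K * norm (x - y)" if s: "s \<in> {s0-\<delta>..s0+\<delta>}" for s x y
  proof -
    have "?F s x - ?F s y = - (((x - y) \<bullet> velocity (velocity \<gamma>) s) *\<^sub>R velocity \<gamma> s)"
      by (simp add: inner_diff_left algebra_simps)
    then have "norm (?F s x - ?F s y) = \<bar>(x - y) \<bullet> velocity (velocity \<gamma>) s\<bar> * norm (velocity \<gamma> s)"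
      by simp
    also have "\<dots> \<le> (norm (x - y) * norm (velocity (velocity \<gamma>) s)) * norm (velocity \<gamma> s)"
      by (intro mult_right_mono Cauchy_Schwarz_ineq2) auto
    also have "\<dots> = norm (x - y) * N s" by (simp add: N_def)
    also have "\<dots> \<le> norm (x - y) * K" using K(2) sub s by (intro mult_left_mono) auto
    finally show ?thesis by (simp add: mult.commute)
  qed
  show thesis
  proof (rule that[OF \<delta>(1)])
    let ?J = "{s0-\<delta><..<s0+\<delta>}"
    show J: "?J \<subseteq> I" using sub a(2) by (auto simp: dist_real_def subset_iff)
    fix e :: 'a
    obtain \<xi> where \<xi>: "\<xi> s0 = e" "\<And>s. s \<in> {s0-\<delta>..s0+\<delta>} \<Longrightarrow> (\<xi> has_vector_derivative ?F s (\<xi> s)) (at s within {s0-\<delta>..s0+\<delta>})"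
      using picard_lindelof[OF \<delta>(1) _ K\<delta> cont lip] K(1) by (metis less_eq_real_def)
    have d: "(\<xi> has_vector_derivative ?F s (\<xi> s)) (at s)" if s: "s \<in> ?J" for s
    proof -
      have "at s within {s0-\<delta>..s0+\<delta>} = at s"
        using s by (intro at_within_interior) (auto simp: interior_atLeastAtMost_real)
      then show ?thesis using \<xi>(2)[of s] s by simp
    qed
    have "smooth_on ?J \<xi>"
    proof (rule smooth_on_real_if_derivative[OF open_greaterThanLessThan d])
      fix k assume k: "Ck_on k ?J \<xi>"
      have "Ck_on k ?J (velocity \<gamma>)" "Ck_on k ?J (velocity (velocity \<gamma>))"
        using smg[THEN smooth_on_subset, OF J] by (auto simp: smooth_on_def)
      then show "Ck_on k ?J (\<lambda>s. ?F s (\<xi> s))"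
        by (intro Ck_on_bilinear[OF bounded_bilinear_scaleR] Ck_on_bilinear[OF bounded_bilinear_inner]
          Ck_on_bounded_linear[OF bounded_linear_minus[OF bounded_linear_ident]] k) auto
    qed
    then show "\<exists>\<xi>. smooth_on ?J \<xi> \<and> \<xi> s0 = e \<and> (\<forall>s\<in>?J. (\<xi> has_vector_derivative ?F s (\<xi> s)) (at s))"
      using \<xi>(1) d by blast
  qed
qed

lemma constant_on_interval:
  fixes f :: "real \<Rightarrow> 'a::real_normed_vector"
  assumes "is_interval S" "\<And>x. x \<in> S \<Longrightarrow> (f has_vector_derivative 0) (at x)" "x \<in> S" "y \<in> S"
  shows "f x = f y"
proof -
  have "convex S" using assms(1) by (simp add: is_interval_convex_1)
  from has_vector_derivative_bound[OF this _ _ assms(3,4), of f "\<lambda>_. 0" 0] assms(2)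
  show ?thesis using has_vector_derivative_at_within by fastforce
qed

text \<open>The derivative of \<xi> . \<gamma>' is \<xi> . \<gamma>'' - (\<xi> . \<gamma>'')
  |\<gamma>'|^2 = 0, so the fields stay normal. Their derivatives, being tangent to the curve, are
  then orthogonal to all of them, and the mutual inner products are constant. The explicit
  derivative is exported for differentiating components of chords.\<close>

lemma parallel_frame_exists:
  fixes \<gamma> :: "real \<Rightarrow> real^'m"
  assumes dim: "CARD('m::finite) = CARD('n::finite) + 1"
    and \<gamma>: "unit_speed_curve I \<gamma>" and s0: "s0 \<in> I"
  obtains \<delta> and \<xi> :: "'n::finite \<Rightarrow> real \<Rightarrow> real^'m" where "\<delta> > 0" "{s0-\<delta><..<s0+\<delta>} \<subseteq> I"
    "parallel_orthonormal_frame {s0-\<delta><..<s0+\<delta>} \<gamma> \<xi>"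
    "\<And>s i. s \<in> {s0-\<delta><..<s0+\<delta>} \<Longrightarrow>
      (\<xi> i has_vector_derivative - (velocity (velocity \<gamma>) s \<bullet> \<xi> i s) *\<^sub>R velocity \<gamma> s) (at s)"
proof -
  have I: "open I" and sm: "smooth_on I \<gamma>" and unit: "\<And>s. s \<in> I \<Longrightarrow> velocity \<gamma> s \<bullet> velocity \<gamma> s = 1"
    using \<gamma> by (auto simp: unit_speed_curve_def open_interval_def dot_square_norm)
  have sm1: "smooth_on I (velocity \<gamma>)" by (rule smooth_on_velocity[OF I sm])
  obtain e :: "'n::finite \<Rightarrow> real^'m" where e: "\<And>i. e i \<bullet> velocity \<gamma> s0 = 0" "\<And>i j. e i \<bullet> e j = (if i = j then 1 else 0)"
    using orthonormal_complement_of_unit_vector[OF dim unit[OF s0]] by metis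
  obtain \<delta> where \<delta>: "\<delta> > 0" "{s0-\<delta><..<s0+\<delta>} \<subseteq> I"
    and ex: "\<And>e. \<exists>\<xi>. smooth_on {s0-\<delta><..<s0+\<delta>} \<xi> \<and> \<xi> s0 = e \<and>
      (\<forall>s\<in>{s0-\<delta><..<s0+\<delta>}. (\<xi> has_vector_derivative - (\<xi> s \<bullet> velocity (velocity \<gamma>) s) *\<^sub>R velocity \<gamma> s) (at s))"
    by (rule parallel_normal_field[OF I sm s0], rule that)
  define J where "J = {s0-\<delta><..<s0+\<delta>}"
  have J: "is_interval J" "s0 \<in> J" "J \<subseteq> I" using \<delta> by (auto simp: J_def is_interval_oo)
  have "\<exists>\<xi>. \<forall>i. smooth_on J (\<xi> i) \<and> \<xi> i s0 = e i \<and>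
      (\<forall>s\<in>J. (\<xi> i has_vector_derivative - (\<xi> i s \<bullet> velocity (velocity \<gamma>) s) *\<^sub>R velocity \<gamma> s) (at s))"
    using ex unfolding J_def by (intro choice allI) blast
  then obtain \<xi> where \<xi>: "\<And>i. smooth_on J (\<xi> i)" "\<And>i. \<xi> i s0 = e i"
    "\<And>i s. s \<in> J \<Longrightarrow> (\<xi> i has_vector_derivative - (\<xi> i s \<bullet> velocity (velocity \<gamma>) s) *\<^sub>R velocity \<gamma> s) (at s)"
    by blast
  have d1: "(velocity \<gamma> has_vector_derivative velocity (velocity \<gamma>) s) (at s)" if "s \<in> J" for s
    using smooth_on_has_vector_derivative[OF sm1] that J by blast
  have n: "\<xi> i s \<bullet> velocity \<gamma> s = 0" if s: "s \<in> J" for i s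
  proof -
    have "\<xi> i s \<bullet> velocity \<gamma> s = \<xi> i s0 \<bullet> velocity \<gamma> s0"
    proof (rule constant_on_interval[OF J(1) _ s J(2)])
      fix s assume s: "s \<in> J"
      have "((\<lambda>s. \<xi> i s \<bullet> velocity \<gamma> s) has_vector_derivative
          \<xi> i s \<bullet> velocity (velocity \<gamma>) s + (- (\<xi> i s \<bullet> velocity (velocity \<gamma>) s) *\<^sub>R velocity \<gamma> s) \<bullet> velocity \<gamma> s) (at s)"
        by (rule bounded_bilinear.has_vector_derivative[OF bounded_bilinear_inner \<xi>(3)[OF s] d1[OF s]])
      then show "((\<lambda>s. \<xi> i s \<bullet> velocity \<gamma> s) has_vector_derivative 0) (at s)"
        using unit J s by auto
    qed
    then show ?thesis by (simp add: \<xi> e)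
  qed
  have o: "\<xi> i s \<bullet> \<xi> j s = (if i = j then 1 else 0)" if s: "s \<in> J" for i j s
  proof -
    have "\<xi> i s \<bullet> \<xi> j s = \<xi> i s0 \<bullet> \<xi> j s0"
    proof (rule constant_on_interval[OF J(1) _ s J(2)])
      fix s assume s: "s \<in> J"
      show "((\<lambda>s. \<xi> i s \<bullet> \<xi> j s) has_vector_derivative 0) (at s)"
        using bounded_bilinear.has_vector_derivative[OF bounded_bilinear_inner \<xi>(3)[OF s, of i] \<xi>(3)[OF s, of j]]
          n[OF s] by (simp add: inner_commute[of "velocity \<gamma> s"])
    qed
    then show ?thesis by (simp add: \<xi> e)
  qed
  show thesis
  proof (rule that[OF \<delta>, folded J_def])
    show "(\<xi> i has_vector_derivative - (velocity (velocity \<gamma>) s \<bullet> \<xi> i s) *\<^sub>R velocity \<gamma> s) (at s)" if "s \<in> J" for s i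
      using \<xi>(3)[OF that, of i] by (simp add: inner_commute)
    have "velocity (\<xi> i) s \<in> span {velocity \<gamma> s}" if "s \<in> J" for s i
      using vector_derivative_at[OF \<xi>(3)[OF that, of i]] by (metis span_base span_scale singletonI)
    then show "parallel_orthonormal_frame J \<gamma> \<xi>"
      using \<xi>(1) n o by (simp add: parallel_orthonormal_frame_def)
  qed
qed

section \<open>Surfaces\<close>

text \<open>One point is fixed because what follows is linear algebra in a single tangent plane.
  Facts about all points of an open set are obtained by instantiating the locale at each of
  them.\<close>

locale surface_at =
  fixes U :: "(real \<times> real) set" and g :: "real \<times> real \<Rightarrow> 'a::euclidean_space" and p :: "real \<times> real"
  assumes surface: "immersed_surface U g" and pU: "p \<in> U"
begin

abbreviation D :: "real \<times> real \<Rightarrow> 'a" where "D \<equiv> frechet_derivative g (at p)"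
abbreviation II :: "real \<times> real \<Rightarrow> real \<times> real \<Rightarrow> 'a" where "II \<equiv> second_fundamental_form g p"

lemma open_U: "open U" and smooth_g: "smooth_on U g"
  using surface by (auto simp: immersed_surface_def)

lemma inj_D: "inj D"
  using surface pU by (auto simp: immersed_surface_def)

lemma differentiable_g: "g differentiable (at p)"
  by (rule smooth_on_imp_differentiable[OF smooth_g pU])

lemma linear_D: "linear D"
  by (rule linear_frechet_derivative[OF differentiable_g])

lemma D_eq: "D v = fst v *\<^sub>R partial_s g p + snd v *\<^sub>R partial_t g p"
  by (rule frechet_derivative_eq_partials[OF differentiable_g])

lemma D_eq_0_iff: "D v = 0 \<longleftrightarrow> v = 0"
  using inj_D linear_D by (metis linear_injective_0 linear_0)

lemma subspace_tangent_plane: "subspace (tangent_plane g p)"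
  unfolding tangent_plane_def by (rule linear_subspace_image[OF linear_D subspace_UNIV])

lemma D_in_tangent_plane: "D v \<in> tangent_plane g p"
  by (simp add: tangent_plane_def)

lemma in_normal_space_iff: "x \<in> normal_space g p \<longleftrightarrow> (\<forall>v. D v \<bullet> x = 0)"
  by (auto simp: normal_space_def tangent_plane_def orthogonal_comp_def orthogonal_def)

lemma subspace_normal_space: "subspace (normal_space g p)"
  unfolding normal_space_def by (rule subspace_orthogonal_comp)

text \<open>The tangent plane meets its orthogonal complement only in 0, so the definite description
  has at most one solution.\<close>

lemma tangential_part_eqI:
  assumes "y \<in> tangent_plane g p" "x - y \<in> normal_space g p"
  shows "tangential_part g p x = y"
  unfolding tangential_part_def
proof (rule the_equality)
  show "y \<in> tangent_plane g p \<and> x - y \<in> normal_space g p" using assms by simp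
  fix z assume z: "z \<in> tangent_plane g p \<and> x - z \<in> normal_space g p"
  have "y - z \<in> tangent_plane g p"
    using z assms subspace_diff[OF subspace_tangent_plane] by blast
  then obtain v where v: "y - z = D v" by (auto simp: tangent_plane_def)
  have "(x - z) - (x - y) \<in> normal_space g p"
    using z assms subspace_diff[OF subspace_normal_space] by blast
  then have "y - z \<in> normal_space g p" by simp
  then have "D v \<bullet> D v = 0" using v in_normal_space_iff by metis
  then show "z = y" using v by simp
qed

text \<open>The Gram-Schmidt step. It gives a formula for the projection in arbitrary coordinates,
  from which smoothness of tangential and normal parts is read off.\<close>

definition orthogonal_partial_t :: 'a where
  "orthogonal_partial_t = partial_t g p - ((partial_s g p \<bullet> partial_t g p) / (partial_s g p \<bullet> partial_s g p)) *\<^sub>R partial_s g p"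

lemma partial_s_eq_D: "partial_s g p = D (1, 0)" and partial_t_eq_D: "partial_t g p = D (0, 1)"
  by (simp_all add: partial_s_def partial_t_def)

lemma partial_s_nonzero: "partial_s g p \<noteq> 0" and partial_t_nonzero: "partial_t g p \<noteq> 0"
  unfolding partial_s_eq_D partial_t_eq_D D_eq_0_iff by (auto simp: zero_prod_def)

lemma orthogonal_partial_t_eq_D: 
  "orthogonal_partial_t = D (- (partial_s g p \<bullet> partial_t g p) / (partial_s g p \<bullet> partial_s g p), 1)"
  by (simp add: orthogonal_partial_t_def D_eq)

lemma orthogonal_partial_t_nonzero: "orthogonal_partial_t \<noteq> 0"
  unfolding orthogonal_partial_t_eq_D D_eq_0_iff by (auto simp: zero_prod_def)

lemma partial_s_orthogonal: "partial_s g p \<bullet> orthogonal_partial_t = 0"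
  using partial_s_nonzero by (simp add: orthogonal_partial_t_def inner_diff_right)

lemma tangential_part_orthogonal_basis:
  assumes e: "e1 \<in> tangent_plane g p" "e2 \<in> tangent_plane g p" "e1 \<bullet> e2 = 0" "e1 \<noteq> 0" "e2 \<noteq> 0"
    and sp: "tangent_plane g p \<subseteq> span {e1, e2}"
  shows "tangential_part g p x = ((x \<bullet> e1) / (e1 \<bullet> e1)) *\<^sub>R e1 + ((x \<bullet> e2) / (e2 \<bullet> e2)) *\<^sub>R e2" (is "_ = ?y")
proof (rule tangential_part_eqI)
  show "?y \<in> tangent_plane g p"
    by (intro subspace_add[OF subspace_tangent_plane] subspace_scale[OF subspace_tangent_plane] e)
  have "orthogonal (x - ?y) z" if "z \<in> {e1, e2}" for z
    using that e by (auto simp: orthogonal_def inner_diff_left inner_add_left inner_commute[of e2 e1])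
  then have "orthogonal (x - ?y) z" if "z \<in> tangent_plane g p" for z
    using that sp orthogonal_to_span[of z "{e1, e2}" "x - ?y"] by blast
  then show "x - ?y \<in> normal_space g p"
    unfolding in_normal_space_iff using D_in_tangent_plane by (metis orthogonal_def inner_commute)
qed

lemma tangent_plane_subset_span:
  assumes "partial_s g p \<in> span S" "partial_t g p \<in> span S"
  shows "tangent_plane g p \<subseteq> span S"
  unfolding tangent_plane_def using assms by (auto simp: D_eq intro!: span_add span_scale)

lemma tangential_part_eq:
  "tangential_part g p x = ((x \<bullet> partial_s g p) / (partial_s g p \<bullet> partial_s g p)) *\<^sub>R partial_s g p
    + ((x \<bullet> orthogonal_partial_t) / (orthogonal_partial_t \<bullet> orthogonal_partial_t)) *\<^sub>R orthogonal_partial_t"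
proof (rule tangential_part_orthogonal_basis)
  show "partial_s g p \<in> tangent_plane g p" "orthogonal_partial_t \<in> tangent_plane g p"
    unfolding partial_s_eq_D orthogonal_partial_t_eq_D by (rule D_in_tangent_plane)+
  let ?S = "span {partial_s g p, orthogonal_partial_t}"
  have "orthogonal_partial_t + ((partial_s g p \<bullet> partial_t g p) / (partial_s g p \<bullet> partial_s g p)) *\<^sub>R partial_s g p \<in> ?S"
    by (intro span_add span_scale span_base) auto
  then have "partial_t g p \<in> ?S" by (simp add: orthogonal_partial_t_def)
  then show "tangent_plane g p \<subseteq> ?S"
    by (intro tangent_plane_subset_span) (auto intro: span_base)
qed (use partial_s_nonzero orthogonal_partial_t_nonzero partial_s_orthogonal in auto)

lemma linear_tangential_part: "linear (tangential_part g p)"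
  unfolding tangential_part_eq[abs_def]
  by (rule linearI) (simp_all add: inner_add_left add_divide_distrib scaleR_add_left scaleR_add_right)

lemma linear_normal_part: "linear (normal_part g p)"
  unfolding normal_part_def[abs_def] by (intro linear_compose_sub linear_id[unfolded id_def] linear_tangential_part)

lemma tangential_part_in_tangent_plane: "tangential_part g p x \<in> tangent_plane g p"
  unfolding tangential_part_eq partial_s_eq_D orthogonal_partial_t_eq_D
  by (intro subspace_add[OF subspace_tangent_plane] subspace_scale[OF subspace_tangent_plane] D_in_tangent_plane)

lemma normal_part_in_normal_space: "normal_part g p x \<in> normal_space g p"
proof -
  have "normal_part g p x \<bullet> partial_s g p = 0" "normal_part g p x \<bullet> orthogonal_partial_t = 0"
    using partial_s_nonzero orthogonal_partial_t_nonzero partial_s_orthogonal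
    by (simp_all add: normal_part_def tangential_part_eq inner_diff_left inner_add_left
        inner_commute[of orthogonal_partial_t "partial_s g p"])
  moreover from this have "normal_part g p x \<bullet> partial_t g p = 0"
    by (simp add: orthogonal_partial_t_def inner_diff_right)
  ultimately show ?thesis
    by (simp add: in_normal_space_iff D_eq inner_add_right inner_commute[of _ "normal_part g p x"])
qed

lemma normal_part_tangent: "x \<in> tangent_plane g p \<Longrightarrow> normal_part g p x = 0"
  using tangential_part_eqI[of x x] subspace_0[OF subspace_normal_space] by (simp add: normal_part_def)

lemma normal_part_eq_0_iff: "normal_part g p x = 0 \<longleftrightarrow> x \<in> tangent_plane g p"
  using normal_part_tangent tangential_part_in_tangent_plane[of x] by (auto simp: normal_part_def)

lemma normal_part_eq_if_diff_tangent:
  assumes "x - y \<in> tangent_plane g p"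
  shows "normal_part g p x = normal_part g p y"
  using normal_part_tangent[OF assms] by (simp add: linear_diff[OF linear_normal_part])

text \<open>Symmetry of the mixed partials merges the two cross terms. After projection this
  exhibits the second fundamental form as symmetric and bilinear.\<close>

lemma second_derivative_eq:
  "frechet_derivative (\<lambda>q. frechet_derivative g (at q) v) (at p) u
    = (fst u * fst v) *\<^sub>R partial_s (partial_s g) p + (fst u * snd v + snd u * fst v) *\<^sub>R partial_s (partial_t g) p
      + (snd u * snd v) *\<^sub>R partial_t (partial_t g) p"
proof -
  let ?f = "\<lambda>q. fst v *\<^sub>R partial_s g q + snd v *\<^sub>R partial_t g q"
  have "frechet_derivative (\<lambda>q. frechet_derivative g (at q) v) (at p) = frechet_derivative ?f (at p)"
    by (rule frechet_derivative_cong[OF open_U pU])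
      (rule frechet_derivative_eq_partials[OF smooth_on_imp_differentiable[OF smooth_g]])
  moreover have ds: "(partial_s g has_derivative frechet_derivative (partial_s g) (at p)) (at p)"
    and dt: "(partial_t g has_derivative frechet_derivative (partial_t g) (at p)) (at p)"
    by (intro smooth_on_has_derivative[OF _ pU] smooth_on_partial_s smooth_on_partial_t smooth_g)+
  have "(?f has_derivative (\<lambda>w. fst v *\<^sub>R frechet_derivative (partial_s g) (at p) w + snd v *\<^sub>R frechet_derivative (partial_t g) (at p) w)) (at p)"
    by (intro has_derivative_add has_derivative_scaleR_right ds dt)
  from fun_cong[OF frechet_derivative_at[OF this], of u]
  have "frechet_derivative ?f (at p) u = fst v *\<^sub>R frechet_derivative (partial_s g) (at p) u + snd v *\<^sub>R frechet_derivative (partial_t g) (at p) u"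
    by (rule sym)
  moreover have "frechet_derivative (partial_s g) (at p) u = fst u *\<^sub>R partial_s (partial_s g) p + snd u *\<^sub>R partial_s (partial_t g) p"
    using frechet_derivative_eq_partials[OF smooth_on_imp_differentiable[OF smooth_on_partial_s[OF smooth_g] pU]]
      partial_commute[OF open_U smooth_g pU] by simp
  moreover have "frechet_derivative (partial_t g) (at p) u = fst u *\<^sub>R partial_s (partial_t g) p + snd u *\<^sub>R partial_t (partial_t g) p"
    using frechet_derivative_eq_partials[OF smooth_on_imp_differentiable[OF smooth_on_partial_t[OF smooth_g] pU]] by simp
  ultimately show ?thesis by (simp add: algebra_simps)
qed

lemma II_eq:
  "II u v = (fst u * fst v) *\<^sub>R normal_part g p (partial_s (partial_s g) p)
    + (fst u * snd v + snd u * fst v) *\<^sub>R normal_part g p (partial_s (partial_t g) p)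
    + (snd u * snd v) *\<^sub>R normal_part g p (partial_t (partial_t g) p)"
  unfolding second_fundamental_form_def second_derivative_eq
  by (simp add: linear_add[OF linear_normal_part] linear_cmul[OF linear_normal_part])

lemma II_sym: "II u v = II v u"
  by (simp add: II_eq mult.commute add.commute)

lemma II_add_right: "II u (v + w) = II u v + II u w"
  by (simp add: II_eq algebra_simps)

lemma II_scale_right: "II u (a *\<^sub>R v) = a *\<^sub>R II u v"
  by (simp add: II_eq algebra_simps)

lemma II_add_left: "II (u + w) v = II u v + II w v"
  by (metis II_sym II_add_right)

lemma II_scale_left: "II (a *\<^sub>R u) v = a *\<^sub>R II u v"
  by (metis II_sym II_scale_right)

lemma II_normal: "II u v \<in> normal_space g p"
  unfolding second_fundamental_form_def by (rule normal_part_in_normal_space)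

lemma shape_operator_unique:
  assumes "\<And>v. D w \<bullet> D v = D w' \<bullet> D v"
  shows "w = w'"
proof -
  have "D (w - w') \<bullet> D (w - w') = 0"
    using assms[of "w - w'"] by (simp add: linear_diff[OF linear_D] inner_diff_left)
  then show ?thesis using D_eq_0_iff[of "w - w'"] by simp
qed

lemma shape_operator_eqI:
  assumes "\<And>v. D w \<bullet> D v = II u v \<bullet> \<xi>"
  shows "shape_operator g p \<xi> u = w"
  unfolding shape_operator_def
proof (rule the_equality)
  show "\<forall>v. D w \<bullet> D v = II u v \<bullet> \<xi>" using assms by simp
  show "w' = w" if "\<forall>v. D w' \<bullet> D v = II u v \<bullet> \<xi>" for w'
    by (rule shape_operator_unique) (simp add: that assms)
qed

text \<open>The composition of \<open>D\<close> with its adjoint is injective, hence onto, so the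
  functional v \<mapsto> II u v . \<xi> is represented by a vector of the parameter plane. This
  gives the definite description in \<open>shape_operator\<close> its meaning.\<close>

lemma shape_operator: "D (shape_operator g p \<xi> u) \<bullet> D v = II u v \<bullet> \<xi>"
proof -
  define z where "z = (II u (1, 0) \<bullet> \<xi>, II u (0, 1) \<bullet> \<xi>)"
  have z: "II u v \<bullet> \<xi> = z \<bullet> v" for v
  proof -
    have "II u v = II u (fst v *\<^sub>R (1, 0) + snd v *\<^sub>R (0, 1))" by simp
    also have "\<dots> = fst v *\<^sub>R II u (1, 0) + snd v *\<^sub>R II u (0, 1)"
      by (simp only: II_add_right II_scale_right)
    finally show ?thesis by (simp add: z_def inner_add_left inner_prod_def mult.commute)
  qed
  have lin: "linear (adjoint D \<circ> D)" by (intro linear_compose linear_D adjoint_linear)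
  have "inj (adjoint D \<circ> D)"
  proof (rule linear_injective_0[OF lin, THEN iffD2], intro allI impI)
    fix w assume "(adjoint D \<circ> D) w = 0"
    then have "D w \<bullet> D w = 0" using adjoint_works[OF linear_D, of w "D w"] by simp
    then show "w = 0" using D_eq_0_iff by simp
  qed
  then have "surj (adjoint D \<circ> D)" by (rule linear_injective_imp_surjective[OF lin]) simp
  then obtain w where w: "adjoint D (D w) = z" by (metis comp_apply surjD)
  have "D w \<bullet> D v = II u v \<bullet> \<xi>" for v
    using adjoint_works[OF linear_D, of v "D w"] w z by (simp add: inner_commute)
  then show ?thesis using shape_operator_eqI by metis
qed

text \<open>Trades eigenvectors of all shape operators for conjugacy with the orthogonal direction,
  the form in which principal directions are used from here on. Forward, the test vector \<xi> = II
  u v gives |II u v|^2 = 0; backward, the eigenvalue for \<xi> is II u u . \<xi> / |D u|^2.\<close>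

lemma principal_direction_iff:
  "principal_direction g p u \<longleftrightarrow> u \<noteq> 0 \<and> (\<forall>v. D u \<bullet> D v = 0 \<longrightarrow> II u v = 0)"
proof (intro iffI conjI allI impI)
  assume pr: "principal_direction g p u"
  then show "u \<noteq> 0" by (simp add: principal_direction_def)
  fix v assume v: "D u \<bullet> D v = 0"
  obtain a where a: "shape_operator g p (II u v) u = a *\<^sub>R u"
    using pr II_normal unfolding principal_direction_def by blast
  have "II u v \<bullet> II u v = D (a *\<^sub>R u) \<bullet> D v" using shape_operator[of "II u v" u v] a by simp
  also have "\<dots> = 0" using v by (simp add: linear_cmul[OF linear_D])
  finally show "II u v = 0" by simp
next
  assume *: "u \<noteq> 0 \<and> (\<forall>v. D u \<bullet> D v = 0 \<longrightarrow> II u v = 0)"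
  then have pos: "D u \<bullet> D u \<noteq> 0" by (simp add: D_eq_0_iff)
  have "shape_operator g p \<xi> u = ((II u u \<bullet> \<xi>) / (D u \<bullet> D u)) *\<^sub>R u" for \<xi>
  proof (rule shape_operator_eqI)
    fix v
    define c where "c = (D u \<bullet> D v) / (D u \<bullet> D u)"
    have "D u \<bullet> D (v - c *\<^sub>R u) = 0"
      using pos by (simp add: c_def linear_diff[OF linear_D] linear_cmul[OF linear_D] inner_diff_right)
    then have "II u (v - c *\<^sub>R u) = 0" using * by blast
    moreover have "II u v = II u ((v - c *\<^sub>R u) + c *\<^sub>R u)" by simp
    ultimately have "II u v = c *\<^sub>R II u u" by (simp only: II_add_right II_scale_right add_0_left)
    then show "D (((II u u \<bullet> \<xi>) / (D u \<bullet> D u)) *\<^sub>R u) \<bullet> D v = II u v \<bullet> \<xi>"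
      by (simp add: c_def linear_cmul[OF linear_D])
  qed
  then show "principal_direction g p u" using * by (auto simp: principal_direction_def)
qed

lemma orthogonal_directions_basis:
  assumes "D u \<bullet> D v = 0" "u \<noteq> 0" "v \<noteq> 0"
  obtains a b where "x = a *\<^sub>R u + b *\<^sub>R v"
proof -
  have "independent {u, v}"
  proof (rule independent_insertI)
    show "independent {v}" using assms(3) by simp
    show "u \<notin> span {v}"
    proof
      assume "u \<in> span {v}"
      then obtain k where "u = k *\<^sub>R v" by (auto simp: span_singleton)
      then have "D u \<bullet> D u = k * (D u \<bullet> D v)" by (simp add: linear_cmul[OF linear_D])
      then show False using assms D_eq_0_iff by simp
    qed
  qed
  moreover have "u \<noteq> v" using assms D_eq_0_iff[of u] by auto
  ultimately have "UNIV \<subseteq> span {u, v}"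
    by (intro card_ge_dim_independent) auto
  then have "x \<in> span {u, v}" by blast
  then obtain a where "x - a *\<^sub>R u \<in> span {v}" by (auto simp: span_breakdown_eq[of x u "{v}"])
  then obtain b where "x - a *\<^sub>R u = b *\<^sub>R v" by (auto simp: span_singleton)
  then show thesis using that[of a b] by (simp add: algebra_simps)
qed

text \<open>An orthogonal conjugate pair diagonalizes the first and the second form at once, so
  proportionality has to be checked on the two diagonal entries only.\<close>

lemma umbilic_if:
  assumes uv: "D u \<bullet> D v = 0" "u \<noteq> 0" "v \<noteq> 0" "II u v = 0"
    and H: "II u u = (D u \<bullet> D u) *\<^sub>R H" "II v v = (D v \<bullet> D v) *\<^sub>R H" "H \<in> normal_space g p"
  shows "umbilic g p"
  unfolding umbilic_def
proof (intro bexI[OF _ H(3)] allI)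
  fix x y
  obtain a b where x: "x = a *\<^sub>R u + b *\<^sub>R v" by (rule orthogonal_directions_basis[OF uv(1-3)])
  obtain c d where y: "y = c *\<^sub>R u + d *\<^sub>R v" by (rule orthogonal_directions_basis[OF uv(1-3)])
  have "II v u = 0" using uv(4) II_sym by metis
  then have "II x y = (a * c) *\<^sub>R II u u + (b * d) *\<^sub>R II v v"
    using uv(4) by (simp add: x y II_add_left II_add_right II_scale_left II_scale_right mult.commute)
  also have "\<dots> = (a * c * (D u \<bullet> D u) + b * d * (D v \<bullet> D v)) *\<^sub>R H" by (simp add: H algebra_simps)
  also have "a * c * (D u \<bullet> D u) + b * d * (D v \<bullet> D v) = D x \<bullet> D y"
    using uv(1) by (simp add: x y linear_add[OF linear_D] linear_cmul[OF linear_D] inner_add_left inner_add_right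
        inner_commute[of "D v" "D u"])
  finally show "II x y = (D x \<bullet> D y) *\<^sub>R H" .
qed

text \<open>In orthogonal coordinates the vectors orthogonal to one coordinate direction are the
  multiples of the other, and tangency of the mixed derivative kills the mixed term of II.\<close>

lemma coordinate_directions_principal:
  assumes "partial_s g p \<bullet> partial_t g p = 0" "partial_s (partial_t g) p \<in> tangent_plane g p"
  shows "principal_direction g p (1, 0)" "principal_direction g p (0, 1)"
proof -
  have n: "normal_part g p (partial_s (partial_t g) p) = 0" by (rule normal_part_tangent[OF assms(2)])
  show "principal_direction g p (1, 0)"
    unfolding principal_direction_iff
  proof (intro conjI allI impI)
    fix v assume "D (1, 0) \<bullet> D v = 0"
    then have "fst v * (partial_s g p \<bullet> partial_s g p) = 0"
      using assms(1) unfolding D_eq by (simp add: inner_add_right)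
    then have "fst v = 0" using partial_s_nonzero by simp
    then show "II (1, 0) v = 0" unfolding II_eq by (simp add: n)
  qed (simp add: zero_prod_def)
  show "principal_direction g p (0, 1)"
    unfolding principal_direction_iff
  proof (intro conjI allI impI)
    fix v assume "D (0, 1) \<bullet> D v = 0"
    then have "snd v * (partial_t g p \<bullet> partial_t g p) = 0"
      using assms(1) unfolding D_eq by (simp add: inner_add_right inner_commute[of "partial_t g p" "partial_s g p"])
    then have "snd v = 0" using partial_t_nonzero by simp
    then show "II (0, 1) v = 0" unfolding II_eq by (simp add: n)
  qed (simp add: zero_prod_def)
qed

end

section \<open>Criteria for a flat normal bundle and for geodesic curvature\<close>

lemma smooth_on_tangential_part:
  assumes g: "immersed_surface U g" and \<eta>: "smooth_on V \<eta>" and V: "open V" "V \<subseteq> U"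
  shows "smooth_on V (\<lambda>q. tangential_part g q (\<eta> q))"
proof -
  have s: "surface_at U g q" if "q \<in> V" for q
    using g V that by unfold_locales auto
  have sg: "smooth_on V (partial_s g)" "smooth_on V (partial_t g)"
    using g V by (auto simp: immersed_surface_def intro: smooth_on_subset[OF smooth_on_partial_s] smooth_on_subset[OF smooth_on_partial_t])
  define b where "b = (\<lambda>q. partial_t g q - ((partial_s g q \<bullet> partial_t g q) / (partial_s g q \<bullet> partial_s g q)) *\<^sub>R partial_s g q)"
  have b: "surface_at.orthogonal_partial_t g q = b q" if "q \<in> V" for q
    using surface_at.orthogonal_partial_t_def[OF s[OF that]] by (simp add: b_def)
  have smb: "smooth_on V b"
    unfolding b_def by (intro smooth_on_diff smooth_on_scaleR smooth_on_divide smooth_on_inner sg V)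
      (use surface_at.partial_s_nonzero[OF s] in auto)
  have "smooth_on V (\<lambda>q. ((\<eta> q \<bullet> partial_s g q) / (partial_s g q \<bullet> partial_s g q)) *\<^sub>R partial_s g q
      + ((\<eta> q \<bullet> b q) / (b q \<bullet> b q)) *\<^sub>R b q)"
    by (intro smooth_on_add smooth_on_scaleR smooth_on_divide smooth_on_inner sg V \<eta> smb)
      (use surface_at.partial_s_nonzero[OF s] surface_at.orthogonal_partial_t_nonzero[OF s] b in auto)
  then show ?thesis
    using smooth_on_cong[OF V(1), of "\<lambda>q. tangential_part g q (\<eta> q)"] surface_at.tangential_part_eq[OF s] b by simp
qed

lemma smooth_on_normal_part:
  assumes "immersed_surface U g" "smooth_on V \<eta>" "open V" "V \<subseteq> U"
  shows "smooth_on V (\<lambda>q. normal_part g q (\<eta> q))"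
  unfolding normal_part_def by (intro smooth_on_diff smooth_on_tangential_part[OF assms(1)] assms)

text \<open>In orthogonal coordinates whose mixed second derivative is tangent, the covariant derivatives
  of a normal field along the coordinates differ from its ordinary derivatives by multiples of the
  coordinate vectors, so they commute like the latter.\<close>

lemma flat_normal_bundle_if_orthogonal_conjugate:
  fixes g :: "real \<times> real \<Rightarrow> 'a::euclidean_space"
  assumes g: "immersed_surface U g"
    and orth: "\<And>q. q \<in> U \<Longrightarrow> partial_s g q \<bullet> partial_t g q = 0"
    and conj: "\<And>q. q \<in> U \<Longrightarrow> partial_s (partial_t g) q \<in> tangent_plane g q"
  shows "flat_normal_bundle U g"
  unfolding flat_normal_bundle_def
proof (intro allI impI ballI)
  fix V \<eta> q u v
  assume *: "open V \<and> V \<subseteq> U \<and> smooth_on V \<eta> \<and> (\<forall>q\<in>V. \<eta> q \<in> normal_space g q)" and q: "q \<in> V"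
  then have V: "open V" "V \<subseteq> U" and \<eta>: "smooth_on V \<eta>" and n: "\<And>q. q \<in> V \<Longrightarrow> \<eta> q \<in> normal_space g q" by auto
  have s: "surface_at U g q" if "q \<in> V" for q
    using g V that by unfold_locales auto
  have orth': "partial_s g q \<bullet> partial_t g q = 0" and conj': "partial_s (partial_t g) q \<in> tangent_plane g q"
    if "q \<in> V" for q using orth conj subsetD[OF V(2) that] by blast+
  have smg: "smooth_on U g" and opU: "open U" using g by (auto simp: immersed_surface_def)
  have sg: "smooth_on V (partial_s g)" "smooth_on V (partial_t g)"
    using V smg by (auto intro: smooth_on_subset[OF smooth_on_partial_s] smooth_on_subset[OF smooth_on_partial_t])
  have s\<eta>: "smooth_on V (partial_s \<eta>)" "smooth_on V (partial_t \<eta>)"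
    by (intro smooth_on_partial_s smooth_on_partial_t \<eta>)+
  define a b where "a = (\<lambda>q. (partial_s \<eta> q \<bullet> partial_s g q) / (partial_s g q \<bullet> partial_s g q))"
    and "b = (\<lambda>q. (partial_t \<eta> q \<bullet> partial_t g q) / (partial_t g q \<bullet> partial_t g q))"
  define N1 N2 where "N1 = (\<lambda>q. partial_s \<eta> q - a q *\<^sub>R partial_s g q)"
    and "N2 = (\<lambda>q. partial_t \<eta> q - b q *\<^sub>R partial_t g q)"
  have sma: "smooth_on V a" "smooth_on V b"
    unfolding a_def b_def
    by (intro smooth_on_divide smooth_on_inner s\<eta> sg V; use surface_at.partial_s_nonzero[OF s] surface_at.partial_t_nonzero[OF s] in simp)+
  have smN: "smooth_on V N1" "smooth_on V N2"
    unfolding N1_def N2_def by (intro smooth_on_diff smooth_on_scaleR sma s\<eta> sg V)+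
  have tp: "tangential_part g q x = ((x \<bullet> partial_s g q) / (partial_s g q \<bullet> partial_s g q)) *\<^sub>R partial_s g q
      + ((x \<bullet> partial_t g q) / (partial_t g q \<bullet> partial_t g q)) *\<^sub>R partial_t g q" if "q \<in> V" for q x
  proof (rule surface_at.tangential_part_orthogonal_basis[OF s[OF that]])
    show "partial_s g q \<in> tangent_plane g q" "partial_t g q \<in> tangent_plane g q"
      using surface_at.partial_s_eq_D[OF s[OF that]] surface_at.partial_t_eq_D[OF s[OF that]] surface_at.D_in_tangent_plane[OF s[OF that]] by metis+
    show "tangent_plane g q \<subseteq> span {partial_s g q, partial_t g q}"
      by (rule surface_at.tangent_plane_subset_span[OF s[OF that]]) (auto intro: span_base)
  qed (rule orth'[OF that] surface_at.partial_s_nonzero[OF s[OF that]] surface_at.partial_t_nonzero[OF s[OF that]])+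
  have z: "\<eta> q \<bullet> x = 0" if "q \<in> V" "x \<in> tangent_plane g q" for q x
    using n[OF that(1)] that(2) surface_at.in_normal_space_iff[OF s[OF that(1)]] by (auto simp: tangent_plane_def inner_commute)
  have in_tp: "partial_s g q \<in> tangent_plane g q" "partial_t g q \<in> tangent_plane g q" if "q \<in> V" for q
    using surface_at.partial_s_eq_D[OF s[OF that]] surface_at.partial_t_eq_D[OF s[OF that]] surface_at.D_in_tangent_plane[OF s[OF that]] by metis+
  have prod_rule: "partial_s (\<lambda>q. A q \<bullet> B q) q = A q \<bullet> partial_s B q + partial_s A q \<bullet> B q"
      "partial_t (\<lambda>q. A q \<bullet> B q) q = A q \<bullet> partial_t B q + partial_t A q \<bullet> B q"
    if "smooth_on V A" "smooth_on V B" "q \<in> V" for A B :: "real \<times> real \<Rightarrow> 'a" and q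
  proof -
    have "((\<lambda>q. A q \<bullet> B q) has_derivative (\<lambda>h. A q \<bullet> frechet_derivative B (at q) h + frechet_derivative A (at q) h \<bullet> B q)) (at q)"
      by (intro has_derivative_inner smooth_on_has_derivative[OF that(1,3)] smooth_on_has_derivative[OF that(2,3)])
    from fun_cong[OF frechet_derivative_at[OF this], of "(1, 0)"] fun_cong[OF frechet_derivative_at[OF this], of "(0, 1)"]
    show "partial_s (\<lambda>q. A q \<bullet> B q) q = A q \<bullet> partial_s B q + partial_s A q \<bullet> B q"
      "partial_t (\<lambda>q. A q \<bullet> B q) q = A q \<bullet> partial_t B q + partial_t A q \<bullet> B q"
      unfolding partial_s_def partial_t_def by (simp_all only:)
  qed
  have zero: "partial_s (\<lambda>q. \<eta> q \<bullet> B q) q = 0" "partial_t (\<lambda>q. \<eta> q \<bullet> B q) q = 0"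
    if "\<And>q. q \<in> V \<Longrightarrow> B q \<in> tangent_plane g q" "q \<in> V" for B q
  proof -
    have "frechet_derivative (\<lambda>q. \<eta> q \<bullet> B q) (at q) = frechet_derivative (\<lambda>q. 0) (at q)"
      by (rule frechet_derivative_cong[OF V(1) that(2)]) (simp add: z that)
    then show "partial_s (\<lambda>q. \<eta> q \<bullet> B q) q = 0" "partial_t (\<lambda>q. \<eta> q \<bullet> B q) q = 0"
      by (simp_all add: partial_s_def partial_t_def)
  qed
  have comm: "partial_t (partial_s g) q = partial_s (partial_t g) q" if "q \<in> V" for q
    using partial_commute[OF opU smg subsetD[OF V(2) that]] by simp
  \<comment> \<open>Differentiating \<eta> . g_t = 0 in s leaves \<eta>_s . g_t alone, since g_st is
    tangent and thus orthogonal to \<eta>. The tangential part of \<eta>_s is therefore a multiple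
    of g_s.\<close>
  have st: "partial_s \<eta> q \<bullet> partial_t g q = 0" if q: "q \<in> V" for q
    using prod_rule(1)[OF \<eta> sg(2) q] zero(1)[OF in_tp(2) q] z[OF q conj'[OF q]] by simp
  have ts: "partial_t \<eta> q \<bullet> partial_s g q = 0" if q: "q \<in> V" for q
    using prod_rule(2)[OF \<eta> sg(1) q] zero(2)[OF in_tp(1) q] z[OF q conj'[OF q]] comm[OF q] by simp
  have N: "normal_connection g w \<eta> q = fst w *\<^sub>R N1 q + snd w *\<^sub>R N2 q" if q: "q \<in> V" for q w
  proof -
    have "normal_part g q (partial_s \<eta> q) = N1 q" "normal_part g q (partial_t \<eta> q) = N2 q"
      using st[OF q] ts[OF q] by (simp_all add: normal_part_def tp[OF q] N1_def N2_def a_def b_def)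
    then show ?thesis
      unfolding normal_connection_def frechet_derivative_eq_partials[OF smooth_on_imp_differentiable[OF \<eta> q]]
      by (simp add: linear_add[OF surface_at.linear_normal_part[OF s[OF q]]] linear_cmul[OF surface_at.linear_normal_part[OF s[OF q]]])
  qed
  have NN: "normal_connection g w1 (normal_connection g w2 \<eta>) q
      = (fst w1 * fst w2) *\<^sub>R normal_part g q (partial_s N1 q) + (fst w1 * snd w2) *\<^sub>R normal_part g q (partial_s N2 q)
      + (snd w1 * fst w2) *\<^sub>R normal_part g q (partial_t N1 q) + (snd w1 * snd w2) *\<^sub>R normal_part g q (partial_t N2 q)" for w1 w2
  proof -
    have "frechet_derivative (normal_connection g w2 \<eta>) (at q) = frechet_derivative (\<lambda>q. fst w2 *\<^sub>R N1 q + snd w2 *\<^sub>R N2 q) (at q)"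
      by (rule frechet_derivative_cong[OF V(1) q N])
    moreover
    have "((\<lambda>q. fst w2 *\<^sub>R N1 q + snd w2 *\<^sub>R N2 q) has_derivative
        (\<lambda>h. fst w2 *\<^sub>R frechet_derivative N1 (at q) h + snd w2 *\<^sub>R frechet_derivative N2 (at q) h)) (at q)"
      by (intro has_derivative_add has_derivative_scaleR_right smooth_on_has_derivative[OF smN(1) q] smooth_on_has_derivative[OF smN(2) q])
    from fun_cong[OF frechet_derivative_at[OF this], of w1]
    have "frechet_derivative (\<lambda>q. fst w2 *\<^sub>R N1 q + snd w2 *\<^sub>R N2 q) (at q) w1
        = fst w2 *\<^sub>R frechet_derivative N1 (at q) w1 + snd w2 *\<^sub>R frechet_derivative N2 (at q) w1"
      by (rule sym)
    ultimately have "frechet_derivative (normal_connection g w2 \<eta>) (at q) w1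
        = fst w2 *\<^sub>R frechet_derivative N1 (at q) w1 + snd w2 *\<^sub>R frechet_derivative N2 (at q) w1"
      by (simp only:)
    also have "\<dots> = (fst w1 * fst w2) *\<^sub>R partial_s N1 q + (fst w1 * snd w2) *\<^sub>R partial_s N2 q
      + (snd w1 * fst w2) *\<^sub>R partial_t N1 q + (snd w1 * snd w2) *\<^sub>R partial_t N2 q"
      unfolding frechet_derivative_eq_partials[OF smooth_on_imp_differentiable[OF smN(1) q]]
        frechet_derivative_eq_partials[OF smooth_on_imp_differentiable[OF smN(2) q]]
      by (simp add: algebra_simps)
    finally show ?thesis
      unfolding normal_connection_def[of g w1]
      by (simp only: linear_add[OF surface_at.linear_normal_part[OF s[OF q]]] linear_cmul[OF surface_at.linear_normal_part[OF s[OF q]]])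
  qed
  have diff_rule: "partial_t N1 q = partial_t (partial_s \<eta>) q - (a q *\<^sub>R partial_t (partial_s g) q + partial_t a q *\<^sub>R partial_s g q)"
    "partial_s N2 q = partial_s (partial_t \<eta>) q - (b q *\<^sub>R partial_s (partial_t g) q + partial_s b q *\<^sub>R partial_t g q)"
  proof -
    have "(N1 has_derivative (\<lambda>h. frechet_derivative (partial_s \<eta>) (at q) h -
        (a q *\<^sub>R frechet_derivative (partial_s g) (at q) h + frechet_derivative a (at q) h *\<^sub>R partial_s g q))) (at q)"
      unfolding N1_def
      by (intro has_derivative_diff has_derivative_scaleR smooth_on_has_derivative[OF s\<eta>(1) q]
          smooth_on_has_derivative[OF sma(1) q] smooth_on_has_derivative[OF sg(1) q])
    from fun_cong[OF frechet_derivative_at[OF this], of "(0, 1)"]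
    show "partial_t N1 q = partial_t (partial_s \<eta>) q - (a q *\<^sub>R partial_t (partial_s g) q + partial_t a q *\<^sub>R partial_s g q)"
      unfolding partial_t_def by (rule sym)
    have "(N2 has_derivative (\<lambda>h. frechet_derivative (partial_t \<eta>) (at q) h -
        (b q *\<^sub>R frechet_derivative (partial_t g) (at q) h + frechet_derivative b (at q) h *\<^sub>R partial_t g q))) (at q)"
      unfolding N2_def
      by (intro has_derivative_diff has_derivative_scaleR smooth_on_has_derivative[OF s\<eta>(2) q]
          smooth_on_has_derivative[OF sma(2) q] smooth_on_has_derivative[OF sg(2) q])
    from fun_cong[OF frechet_derivative_at[OF this], of "(1, 0)"]
    show "partial_s N2 q = partial_s (partial_t \<eta>) q - (b q *\<^sub>R partial_s (partial_t g) q + partial_s b q *\<^sub>R partial_t g q)"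
      unfolding partial_s_def by (rule sym)
  qed
  have cj: "partial_s (partial_t g) q \<in> tangent_plane g q" by (rule conj'[OF q])
  \<comment> \<open>The mixed second derivatives of \<eta> cancel. What remains are multiples of
    g_s, g_t and g_st, all of them tangent.\<close>
  have "partial_s N2 q - partial_t N1 q \<in> tangent_plane g q"
  proof -
    have "partial_s N2 q - partial_t N1 q = (a q - b q) *\<^sub>R partial_s (partial_t g) q + partial_t a q *\<^sub>R partial_s g q - partial_s b q *\<^sub>R partial_t g q"
      unfolding diff_rule comm[OF q] partial_commute[OF V(1) \<eta> q] by (simp add: algebra_simps)
    also have "\<dots> \<in> tangent_plane g q"
      using surface_at.subspace_tangent_plane[OF s[OF q]] cj in_tp[OF q] by (intro subspace_diff subspace_add subspace_scale) auto
    finally show ?thesis .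
  qed
  then have "normal_part g q (partial_s N2 q) = normal_part g q (partial_t N1 q)"
    by (rule surface_at.normal_part_eq_if_diff_tangent[OF s[OF q]])
  then show "normal_connection g u (normal_connection g v \<eta>) q - normal_connection g v (normal_connection g u \<eta>) q = 0"
    unfolding NN by (simp add: algebra_simps)
qed

text \<open>Here X is the unit conormal. Differentiating T . X = 0 for the unit tangent T gives T' .
  X = -k |W'|, and |T| = 1 gives T' . W' = 0, so the tangential part of T' / |W'| is -k X. Both
  halves of the theorem know the geodesic curvature in the form X' = k W'.\<close>

lemma geodesic_curvature_eq:
  fixes g :: "real \<times> real \<Rightarrow> 'a::euclidean_space" and c :: "real \<Rightarrow> real \<times> real"
  assumes "surface_at U g (c t)" and K: "open K" "t \<in> K"
    and W: "\<And>\<tau>. \<tau> \<in> K \<Longrightarrow> ((\<lambda>\<tau>. g (c \<tau>)) has_vector_derivative W' \<tau>) (at \<tau>)"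
    and W': "W' differentiable (at t)" "W' t \<noteq> 0" "W' t \<in> tangent_plane g (c t)"
    and X: "\<And>\<tau>. \<tau> \<in> K \<Longrightarrow> X \<tau> \<bullet> W' \<tau> = 0" "X t \<bullet> X t = 1" "X t \<in> tangent_plane g (c t)"
      "(X has_vector_derivative k *\<^sub>R W' t) (at t)"
    and sp: "tangent_plane g (c t) \<subseteq> span {X t, W' t}"
  shows "geodesic_curvature g c t = \<bar>k\<bar>"
proof -
  interpret surface_at U g "c t" by fact
  define T where "T = (\<lambda>\<tau>. inverse (norm (W' \<tau>)) *\<^sub>R W' \<tau>)"
  have vel: "velocity (g \<circ> c) \<tau> = W' \<tau>" if "\<tau> \<in> K" for \<tau>
    using vector_derivative_at[OF W[OF that]] by (simp add: comp_def)
  have "T differentiable (at t)"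
  proof -
    have "(\<lambda>\<tau>. norm (W' \<tau>)) differentiable (at t)"
      by (rule differentiable_compose[OF _ W'(1), of norm]) (use W'(2) differentiable_norm_at in auto)
    then show ?thesis
      unfolding T_def using W' by (intro differentiable_scaleR differentiable_inverse) auto
  qed
  then obtain T' where T': "(T has_vector_derivative T') (at t)"
    by (meson vector_derivative_works)
  have TX: "T' \<bullet> X t = - k * norm (W' t)"
  proof -
    have "((\<lambda>\<tau>. T \<tau> \<bullet> X \<tau>) has_vector_derivative T t \<bullet> (k *\<^sub>R W' t) + T' \<bullet> X t) (at t)"
      by (rule bounded_bilinear.has_vector_derivative[OF bounded_bilinear_inner T' X(4)])
    moreover have "((\<lambda>\<tau>. T \<tau> \<bullet> X \<tau>) has_vector_derivative 0) (at t)"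
      by (rule has_vector_derivative_transform_within_open[OF has_vector_derivative_const K])
        (use X(1) in \<open>simp add: T_def inner_commute\<close>)
    ultimately have "T t \<bullet> (k *\<^sub>R W' t) + T' \<bullet> X t = 0"
      by (rule vector_derivative_unique_at)
    moreover have "T t \<bullet> (k *\<^sub>R W' t) = k * norm (W' t)"
      using W'(2) by (simp add: T_def dot_square_norm power2_eq_square)
    ultimately show ?thesis unfolding mult_minus_left by linarith
  qed
  have TW: "T' \<bullet> W' t = 0"
  proof -
    \<comment> \<open>W' is assumed nonzero at t only. Continuity extends this to a neighbourhood,
      on which T is a unit vector and can be differentiated as such.\<close>
    have ev: "\<forall>\<^sub>F \<tau> in at t. W' \<tau> \<noteq> 0"
      using differentiable_imp_continuous_within[OF W'(1)] W'(2) tendsto_imp_eventually_ne unfolding continuous_within by blast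
    obtain S where S: "open S" "t \<in> S" and S': "\<forall>x\<in>S. x \<noteq> t \<longrightarrow> x \<in> UNIV \<longrightarrow> W' x \<noteq> 0"
      using ev unfolding eventually_at_topological by blast
    have nz: "W' \<tau> \<noteq> 0" if "\<tau> \<in> S" for \<tau> using S' W'(2) that by (cases "\<tau> = t") auto
    have "((\<lambda>\<tau>. T \<tau> \<bullet> T \<tau>) has_vector_derivative T t \<bullet> T' + T' \<bullet> T t) (at t)"
      by (rule bounded_bilinear.has_vector_derivative[OF bounded_bilinear_inner T' T'])
    moreover have "((\<lambda>\<tau>. T \<tau> \<bullet> T \<tau>) has_vector_derivative 0) (at t)"
    proof (rule has_vector_derivative_transform_within_open[OF has_vector_derivative_const[of 1] S])
      show "1 = T \<tau> \<bullet> T \<tau>" if "\<tau> \<in> S" for \<tau>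
        using nz[OF that] by (simp add: T_def dot_square_norm power2_eq_square)
    qed
    ultimately have "T t \<bullet> T' + T' \<bullet> T t = 0" by (rule vector_derivative_unique_at)
    then have "T' \<bullet> T t = 0" by (simp add: inner_commute)
    then show ?thesis using W'(2) by (simp add: T_def)
  qed
  have "velocity (\<lambda>\<tau>. sgn (velocity (g \<circ> c) \<tau>)) t = T'"
    by (rule vector_derivative_at, rule has_vector_derivative_transform_within_open[OF T' K])
      (simp add: vel T_def sgn_div_norm)
  then have *: "velocity (\<lambda>\<tau>. sgn (velocity (g \<circ> c) \<tau>)) t /\<^sub>R norm (velocity (g \<circ> c) t) = inverse (norm (W' t)) *\<^sub>R T'"
    by (simp add: vel K)
  have "X t \<noteq> 0" using X(2) by auto
  then have "tangential_part g (c t) (inverse (norm (W' t)) *\<^sub>R T') = - k *\<^sub>R X t"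
    using tangential_part_orthogonal_basis[OF X(3) W'(3) X(1)[OF K(2)] _ W'(2) sp] X(2) TX TW W'(2) by simp
  moreover have "norm (X t) = 1" using X(2) by (simp add: norm_eq_1)
  ultimately show ?thesis unfolding geodesic_curvature_def * by simp
qed

section \<open>The construction\<close>

text \<open>The inner bracket is the reflection of c' in the hyperplane orthogonal to c: the
  inversion is conformal with factor 1 / |c|^2.\<close>

lemma has_vector_derivative_inversion:
  fixes c :: "real \<Rightarrow> 'a::real_inner"
  assumes N: "(c has_vector_derivative c') (at x)" and nz: "c x \<bullet> c x \<noteq> 0"
  shows "((\<lambda>x. inverse (c x \<bullet> c x) *\<^sub>R c x) has_vector_derivative
      inverse (c x \<bullet> c x) *\<^sub>R (c' - (2 * (c' \<bullet> c x) / (c x \<bullet> c x)) *\<^sub>R c x)) (at x)"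
proof -
  have "((\<lambda>x. c x \<bullet> c x) has_vector_derivative c x \<bullet> c' + c' \<bullet> c x) (at x)"
    by (rule bounded_bilinear.has_vector_derivative[OF bounded_bilinear_inner N N])
  then have "((\<lambda>x. c x \<bullet> c x) has_real_derivative 2 * (c' \<bullet> c x)) (at x)"
    by (simp add: has_real_derivative_iff_has_vector_derivative inner_commute)
  from DERIV_inverse_fun[OF this nz]
  have "((\<lambda>x. inverse (c x \<bullet> c x)) has_real_derivative - (inverse (c x \<bullet> c x) * (2 * (c' \<bullet> c x)) * inverse (c x \<bullet> c x))) (at x)"
    by (rule DERIV_cong) (simp add: power2_eq_square mult_ac)
  from has_vector_derivative_scaleR[OF this N] show ?thesis
    by (rule has_vector_derivative_eq_rhs) (simp add: scaleR_diff_right divide_inverse mult_ac)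
qed

locale construction =
  fixes I J and \<gamma> :: "real \<Rightarrow> real^'m::finite" and \<xi> :: "'n::finite \<Rightarrow> real \<Rightarrow> real^'m" and k \<phi> \<beta>
    and \<alpha> :: "real \<Rightarrow> real^'n"
  assumes data: "construction_data I J \<gamma> \<xi> k \<phi> \<beta> \<alpha>"
begin

abbreviation f :: "real \<times> real \<Rightarrow> real^'m" where "f \<equiv> construction_map \<gamma> \<xi> \<phi> \<beta> \<alpha>"
abbreviation R :: "(real \<times> real) set" where "R \<equiv> regular_points I J \<gamma> \<xi> \<phi> \<beta> \<alpha>"

definition N :: "real \<Rightarrow> real \<Rightarrow> real^'m" where
  "N s t = deriv \<phi> s *\<^sub>R velocity \<gamma> s + (\<Sum>i\<in>UNIV. (\<beta> i s + \<alpha> t $ i) *\<^sub>R \<xi> i s)"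

text \<open>\<open>A\<close> is the t-derivative of \<open>N\<close>, and \<open>\<mu>\<close> below
  is the factor in dN/ds = \<mu> \<gamma>'.\<close>

definition A :: "real \<Rightarrow> real \<Rightarrow> real^'m" where
  "A s t = (\<Sum>i\<in>UNIV. (velocity \<alpha> t $ i) *\<^sub>R \<xi> i s)"

definition \<mu> :: "real \<Rightarrow> real \<Rightarrow> real" where
  "\<mu> s t = deriv (deriv \<phi>) s - (\<Sum>i\<in>UNIV. (\<beta> i s + \<alpha> t $ i) * k i s)"

definition reflection :: "real \<Rightarrow> real \<Rightarrow> real^'m \<Rightarrow> real^'m" where
  "reflection s t v = v - (2 * (v \<bullet> N s t) / (N s t \<bullet> N s t)) *\<^sub>R N s t"

lemma I: "open I" "is_interval I" and J: "open J" "is_interval J"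
  and sm_\<gamma>: "smooth_on I \<gamma>" and sm_\<phi>: "smooth_on I \<phi>" and sm_\<beta>: "\<And>i. smooth_on I (\<beta> i)"
  and sm_\<alpha>: "smooth_on J \<alpha>" and sm_\<xi>: "\<And>i. smooth_on I (\<xi> i)"
  using data by (auto simp: construction_data_def unit_speed_curve_def open_interval_def parallel_orthonormal_frame_def)

lemma unit_\<gamma>: "s \<in> I \<Longrightarrow> velocity \<gamma> s \<bullet> velocity \<gamma> s = 1"
  using data by (auto simp: construction_data_def unit_speed_curve_def dot_square_norm)

lemma frame: "s \<in> I \<Longrightarrow> \<xi> i s \<bullet> velocity \<gamma> s = 0" "s \<in> I \<Longrightarrow> \<xi> i s \<bullet> \<xi> j s = (if i = j then 1 else 0)"
  and k: "s \<in> I \<Longrightarrow> velocity (velocity \<gamma>) s = (\<Sum>i\<in>UNIV. k i s *\<^sub>R \<xi> i s)"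
  and \<beta>k: "s \<in> I \<Longrightarrow> deriv (\<beta> i) s + deriv \<phi> s * k i s = 0"
  using data by (auto simp: construction_data_def parallel_orthonormal_frame_def)

lemma sum_frame_inner: "s \<in> I \<Longrightarrow> (\<Sum>i\<in>UNIV. a i *\<^sub>R \<xi> i s) \<bullet> \<xi> j s = a j"
proof -
  assume "s \<in> I"
  then have "(\<Sum>i\<in>UNIV. a i *\<^sub>R \<xi> i s) \<bullet> \<xi> j s = (\<Sum>i\<in>UNIV. if i = j then a j else 0)"
    unfolding inner_sum_left by (intro sum.cong) (auto simp: frame)
  then show ?thesis by simp
qed

lemma sum_frame_inner_tangent: "s \<in> I \<Longrightarrow> (\<Sum>i\<in>UNIV. a i *\<^sub>R \<xi> i s) \<bullet> velocity \<gamma> s = 0"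
  by (simp add: inner_sum_left frame)

lemma sum_frame_inner_sum: "s \<in> I \<Longrightarrow> (\<Sum>i\<in>UNIV. a i *\<^sub>R \<xi> i s) \<bullet> (\<Sum>i\<in>UNIV. b i *\<^sub>R \<xi> i s) = (\<Sum>i\<in>UNIV. a i * b i)"
  by (simp add: inner_sum_right sum_frame_inner mult.commute)

lemma d\<gamma>: "s \<in> I \<Longrightarrow> (\<gamma> has_vector_derivative velocity \<gamma> s) (at s)"
  by (rule smooth_on_has_vector_derivative[OF sm_\<gamma>])

lemma dd\<gamma>: "s \<in> I \<Longrightarrow> (velocity \<gamma> has_vector_derivative (\<Sum>i\<in>UNIV. k i s *\<^sub>R \<xi> i s)) (at s)"
  using smooth_on_has_vector_derivative[OF smooth_on_velocity[OF I(1) sm_\<gamma>]] k by metis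

text \<open>That \<xi> is parallel only says that \<xi>' is some multiple of \<gamma>'.
  Differentiating \<xi> . \<gamma>' = 0 identifies the factor.\<close>

lemma d\<xi>: 
  assumes s: "s \<in> I"
  shows "(\<xi> i has_vector_derivative - k i s *\<^sub>R velocity \<gamma> s) (at s)"
proof -
  have d: "(\<xi> i has_vector_derivative velocity (\<xi> i) s) (at s)"
    by (rule smooth_on_has_vector_derivative[OF sm_\<xi> s])
  obtain c where c: "velocity (\<xi> i) s = c *\<^sub>R velocity \<gamma> s"
    using data s unfolding construction_data_def parallel_orthonormal_frame_def span_singleton by blast
  have "((\<lambda>s. \<xi> i s \<bullet> velocity \<gamma> s) has_vector_derivative \<xi> i s \<bullet> (\<Sum>i\<in>UNIV. k i s *\<^sub>R \<xi> i s) + velocity (\<xi> i) s \<bullet> velocity \<gamma> s) (at s)"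
    by (rule bounded_bilinear.has_vector_derivative[OF bounded_bilinear_inner d dd\<gamma>[OF s]])
  moreover have "((\<lambda>s. \<xi> i s \<bullet> velocity \<gamma> s) has_vector_derivative 0) (at s)"
    by (rule has_vector_derivative_transform_within_open[OF has_vector_derivative_const I(1) s]) (simp add: frame)
  ultimately have "\<xi> i s \<bullet> (\<Sum>i\<in>UNIV. k i s *\<^sub>R \<xi> i s) + velocity (\<xi> i) s \<bullet> velocity \<gamma> s = 0"
    by (rule vector_derivative_unique_at)
  moreover have "\<xi> i s \<bullet> (\<Sum>i\<in>UNIV. k i s *\<^sub>R \<xi> i s) = k i s"
    by (subst inner_commute) (rule sum_frame_inner[OF s])
  moreover have "velocity (\<xi> i) s \<bullet> velocity \<gamma> s = c"
    using unit_\<gamma>[OF s] by (simp add: c)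
  ultimately have "k i s + c = 0" by simp
  then have "c = - k i s" by simp
  then show ?thesis using d c by simp
qed

lemma d\<phi>: "s \<in> I \<Longrightarrow> (\<phi> has_real_derivative deriv \<phi> s) (at s)"
  by (rule smooth_on_has_real_derivative[OF sm_\<phi>])

lemma dd\<phi>: "s \<in> I \<Longrightarrow> (deriv \<phi> has_real_derivative deriv (deriv \<phi>) s) (at s)"
  by (rule smooth_on_has_real_derivative[OF smooth_on_deriv[OF I(1) sm_\<phi>]])

lemma d\<beta>:
  assumes "s \<in> I"
  shows "(\<beta> i has_real_derivative - deriv \<phi> s * k i s) (at s)"
proof -
  have "deriv (\<beta> i) s = - deriv \<phi> s * k i s" using \<beta>k[OF assms, of i] by simp
  then show ?thesis using smooth_on_has_real_derivative[OF sm_\<beta> assms, of i] by simp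
qed

text \<open>The condition \<beta>' + \<phi>' k = 0 says precisely that the normal components of
  dN/ds cancel, which leaves a multiple of \<gamma>'.\<close>

lemma N_s:
  assumes s: "s \<in> I"
  shows "((\<lambda>s. N s t) has_vector_derivative \<mu> s t *\<^sub>R velocity \<gamma> s) (at s)"
proof -
  have 1: "((\<lambda>s. deriv \<phi> s *\<^sub>R velocity \<gamma> s) has_vector_derivative
      deriv \<phi> s *\<^sub>R (\<Sum>i\<in>UNIV. k i s *\<^sub>R \<xi> i s) + deriv (deriv \<phi>) s *\<^sub>R velocity \<gamma> s) (at s)"
    by (rule has_vector_derivative_scaleR[OF dd\<phi>[OF s] dd\<gamma>[OF s]])
  have 2: "((\<lambda>s. (\<beta> i s + \<alpha> t $ i) *\<^sub>R \<xi> i s) has_vector_derivative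
      (\<beta> i s + \<alpha> t $ i) *\<^sub>R (- k i s *\<^sub>R velocity \<gamma> s) + (- deriv \<phi> s * k i s) *\<^sub>R \<xi> i s) (at s)" for i
    by (rule has_vector_derivative_scaleR[OF _ d\<xi>[OF s]]) (use d\<beta>[OF s] in \<open>auto intro!: derivative_eq_intros\<close>)
  have "((\<lambda>s. N s t) has_vector_derivative
      (deriv \<phi> s *\<^sub>R (\<Sum>i\<in>UNIV. k i s *\<^sub>R \<xi> i s) + deriv (deriv \<phi>) s *\<^sub>R velocity \<gamma> s)
      + (\<Sum>i\<in>UNIV. (\<beta> i s + \<alpha> t $ i) *\<^sub>R (- k i s *\<^sub>R velocity \<gamma> s) + (- deriv \<phi> s * k i s) *\<^sub>R \<xi> i s)) (at s)"
    unfolding N_def by (intro has_vector_derivative_add 1 has_vector_derivative_sum 2)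
  moreover have "(\<Sum>i\<in>UNIV. (\<beta> i s + \<alpha> t $ i) *\<^sub>R (- k i s *\<^sub>R velocity \<gamma> s) + (- deriv \<phi> s * k i s) *\<^sub>R \<xi> i s)
      = - ((\<Sum>i\<in>UNIV. (\<beta> i s + \<alpha> t $ i) * k i s) *\<^sub>R velocity \<gamma> s) - deriv \<phi> s *\<^sub>R (\<Sum>i\<in>UNIV. k i s *\<^sub>R \<xi> i s)"
    by (simp add: sum_subtractf sum_negf scaleR_sum_left scaleR_sum_right)
  ultimately show ?thesis by (simp add: \<mu>_def scaleR_diff_left)
qed

lemma d\<alpha>: "t \<in> J \<Longrightarrow> ((\<lambda>t. \<alpha> t $ i) has_real_derivative velocity \<alpha> t $ i) (at t)"
  using bounded_linear.has_vector_derivative[OF bounded_linear_vec_nth smooth_on_has_vector_derivative[OF sm_\<alpha>]]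
  by (simp add: has_real_derivative_iff_has_vector_derivative)

lemma N_t:
  assumes t: "t \<in> J"
  shows "((\<lambda>t. N s t) has_vector_derivative A s t) (at t)"
proof -
  have 2: "((\<lambda>t. (\<beta> i s + \<alpha> t $ i) *\<^sub>R \<xi> i s) has_vector_derivative
      (\<beta> i s + \<alpha> t $ i) *\<^sub>R 0 + (velocity \<alpha> t $ i) *\<^sub>R \<xi> i s) (at t)" for i
    by (rule has_vector_derivative_scaleR[OF _ has_vector_derivative_const]) (use d\<alpha>[OF t] in \<open>auto intro!: derivative_eq_intros\<close>)
  have "((\<lambda>t. N s t) has_vector_derivative
      0 + (\<Sum>i\<in>UNIV. (\<beta> i s + \<alpha> t $ i) *\<^sub>R 0 + (velocity \<alpha> t $ i) *\<^sub>R \<xi> i s)) (at t)"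
    unfolding N_def by (intro has_vector_derivative_add has_vector_derivative_const has_vector_derivative_sum 2)
  then show ?thesis by (simp add: A_def)
qed

lemma N_\<gamma>: "s \<in> I \<Longrightarrow> velocity \<gamma> s \<bullet> N s t = deriv \<phi> s"
  by (simp add: N_def inner_add_right unit_\<gamma> inner_commute[of "velocity \<gamma> s" "sum _ _"] sum_frame_inner_tangent)

lemma A_\<gamma>: "s \<in> I \<Longrightarrow> A s t \<bullet> velocity \<gamma> s = 0"
  by (simp add: A_def sum_frame_inner_tangent)

lemma N_N: "s \<in> I \<Longrightarrow> N s t \<bullet> N s t = construction_denom \<phi> \<beta> \<alpha> (s, t)"
  by (simp add: N_def construction_denom_def inner_add_left inner_add_right unit_\<gamma> sum_frame_inner_tangent
      inner_commute[of "velocity \<gamma> s" "sum _ _"] sum_frame_inner_sum power2_eq_square)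

lemma f_eq: "f (s, t) = \<gamma> s - (2 * \<phi> s) *\<^sub>R (inverse (construction_denom \<phi> \<beta> \<alpha> (s, t)) *\<^sub>R N s t)"
  by (simp add: construction_map_def N_def)

lemma f_eq': "s \<in> I \<Longrightarrow> f (s, t) = \<gamma> s - (2 * \<phi> s) *\<^sub>R (inverse (N s t \<bullet> N s t) *\<^sub>R N s t)"
  by (simp add: f_eq N_N)

text \<open>The points at which the formula makes sense. The partial derivatives are computed on
  this set first, because regularity is itself a condition on them.\<close>

definition S :: "(real \<times> real) set" where
  "S = {x \<in> I \<times> J. construction_denom \<phi> \<beta> \<alpha> x \<noteq> 0}"

lemma opIJ: "open (I \<times> J)" using I J by (intro open_Times)

lemma sm_fst: "smooth_on I c \<Longrightarrow> smooth_on (I \<times> J) (\<lambda>x. c (fst x))"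
  by (rule smooth_on_compose[OF opIJ I(1) _ _ smooth_on_fst[OF opIJ smooth_on_ident[OF opIJ]]]) auto

lemma sm_snd: "smooth_on J c \<Longrightarrow> smooth_on (I \<times> J) (\<lambda>x. c (snd x))"
  by (rule smooth_on_compose[OF opIJ J(1) _ _ smooth_on_snd[OF opIJ smooth_on_ident[OF opIJ]]]) auto

lemma sm_denom: "smooth_on (I \<times> J) (construction_denom \<phi> \<beta> \<alpha>)"
  unfolding construction_denom_def case_prod_unfold
  by (intro smooth_on_add smooth_on_sum smooth_on_power sm_fst opIJ smooth_on_vec_nth sm_snd sm_\<alpha> sm_\<beta> smooth_on_deriv[OF I(1) sm_\<phi>])

lemma S_eq: "S = I \<times> J \<inter> construction_denom \<phi> \<beta> \<alpha> -` (- {0})"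
  by (auto simp: S_def)

lemma opS: "open S"
  unfolding S_eq by (rule continuous_open_preimage[OF smooth_on_imp_continuous_on[OF sm_denom] opIJ]) auto

lemma S_sub: "S \<subseteq> I \<times> J" by (auto simp: S_def)

lemma sm_f: "smooth_on S f"
proof -
  have "smooth_on S (\<lambda>x. \<gamma> (fst x) - (2 * \<phi> (fst x)) *\<^sub>R (inverse (construction_denom \<phi> \<beta> \<alpha> x) *\<^sub>R
      (deriv \<phi> (fst x) *\<^sub>R velocity \<gamma> (fst x) + (\<Sum>i\<in>UNIV. (\<beta> i (fst x) + \<alpha> (snd x) $ i) *\<^sub>R \<xi> i (fst x)))))"
    by (intro smooth_on_diff smooth_on_scaleR smooth_on_mult smooth_on_const smooth_on_inverse smooth_on_add smooth_on_sum opS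
      smooth_on_vec_nth smooth_on_subset[OF _ S_sub] sm_fst sm_snd sm_denom sm_\<gamma> sm_\<phi> sm_\<beta> sm_\<alpha> sm_\<xi>
      smooth_on_deriv[OF I(1) sm_\<phi>] smooth_on_velocity[OF I(1) sm_\<gamma>]) (simp add: S_def)
  moreover have "f = (\<lambda>x. \<gamma> (fst x) - (2 * \<phi> (fst x)) *\<^sub>R (inverse (construction_denom \<phi> \<beta> \<alpha> x) *\<^sub>R
      (deriv \<phi> (fst x) *\<^sub>R velocity \<gamma> (fst x) + (\<Sum>i\<in>UNIV. (\<beta> i (fst x) + \<alpha> (snd x) $ i) *\<^sub>R \<xi> i (fst x)))))"
    by (auto simp: construction_map_def fun_eq_iff)
  ultimately show ?thesis by simp
qed

lemma S_D: "(s, t) \<in> S \<Longrightarrow> s \<in> I" "(s, t) \<in> S \<Longrightarrow> t \<in> J" "(s, t) \<in> S \<Longrightarrow> N s t \<bullet> N s t \<noteq> 0"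
  by (auto simp: S_def N_N)

lemma df: "p \<in> S \<Longrightarrow> f differentiable (at p)"
  by (rule smooth_on_imp_differentiable[OF sm_f])

lemma f_t_slice:
  assumes "(s, t) \<in> S"
  shows "((\<lambda>t. f (s, t)) has_vector_derivative - (2 * \<phi> s / (N s t \<bullet> N s t)) *\<^sub>R reflection s t (A s t)) (at t)"
proof -
  note s = S_D(1)[OF assms] and t = S_D(2)[OF assms] and nz = S_D(3)[OF assms]
  have "((\<lambda>t. \<gamma> s - (2 * \<phi> s) *\<^sub>R (inverse (N s t \<bullet> N s t) *\<^sub>R N s t)) has_vector_derivative
      0 - (2 * \<phi> s) *\<^sub>R (inverse (N s t \<bullet> N s t) *\<^sub>R (A s t - (2 * (A s t \<bullet> N s t) / (N s t \<bullet> N s t)) *\<^sub>R N s t))) (at t)"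
    by (intro has_vector_derivative_diff has_vector_derivative_const
        bounded_linear.has_vector_derivative[OF bounded_linear_scaleR_right] has_vector_derivative_inversion[OF N_t[OF t] nz])
  then show ?thesis
    unfolding f_eq'[OF s] by (rule has_vector_derivative_eq_rhs) (simp add: reflection_def divide_inverse)
qed

lemma partial_t_f: "(s, t) \<in> S \<Longrightarrow> partial_t f (s, t) = - (2 * \<phi> s / (N s t \<bullet> N s t)) *\<^sub>R reflection s t (A s t)"
  by (rule partial_t_eqI[OF df f_t_slice])

text \<open>Two contributions have the same direction. Differentiating the inversion reflects \<mu>
  \<gamma>', and \<gamma>' together with the term that contains \<phi>' is the reflection of
  \<gamma>', because \<gamma>' . N = \<phi>'.\<close>

lemma partial_s_f:
  assumes st: "(s, t) \<in> S"
  shows "partial_s f (s, t) = (1 - 2 * \<phi> s * \<mu> s t / (N s t \<bullet> N s t)) *\<^sub>R reflection s t (velocity \<gamma> s)"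
proof (rule partial_s_eqI[OF df[OF st]])
  note s = S_D(1)[OF st] and nz = S_D(3)[OF st]
  let ?h = "N s t \<bullet> N s t"
  have 1: "((\<lambda>s. 2 * \<phi> s) has_real_derivative 2 * deriv \<phi> s) (at s)"
    using d\<phi>[OF s] by (auto intro!: derivative_eq_intros)
  have "((\<lambda>s. \<gamma> s - (2 * \<phi> s) *\<^sub>R (inverse (N s t \<bullet> N s t) *\<^sub>R N s t)) has_vector_derivative
      velocity \<gamma> s - ((2 * \<phi> s) *\<^sub>R (inverse ?h *\<^sub>R (\<mu> s t *\<^sub>R velocity \<gamma> s - (2 * ((\<mu> s t *\<^sub>R velocity \<gamma> s) \<bullet> N s t) / ?h) *\<^sub>R N s t))
        + (2 * deriv \<phi> s) *\<^sub>R (inverse ?h *\<^sub>R N s t))) (at s)"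
    by (intro has_vector_derivative_diff d\<gamma>[OF s] has_vector_derivative_scaleR 1 has_vector_derivative_inversion[OF N_s[OF s] nz])
  then have "((\<lambda>s. \<gamma> s - (2 * \<phi> s) *\<^sub>R (inverse (N s t \<bullet> N s t) *\<^sub>R N s t)) has_vector_derivative
      (1 - 2 * \<phi> s * \<mu> s t / ?h) *\<^sub>R reflection s t (velocity \<gamma> s)) (at s)"
    by (rule has_vector_derivative_eq_rhs) (simp add: reflection_def N_\<gamma>[OF s] divide_inverse algebra_simps)
  then show "((\<lambda>s. f (s, t)) has_vector_derivative (1 - 2 * \<phi> s * \<mu> s t / ?h) *\<^sub>R reflection s t (velocity \<gamma> s)) (at s)"
    by (rule has_vector_derivative_transform_within_open[OF _ I(1) s]) (simp add: f_eq')
qed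

lemma reflection_inner:
  assumes "(s, t) \<in> S"
  shows "reflection s t v \<bullet> reflection s t w = v \<bullet> w"
proof -
  let ?n = "N s t"
  have "reflection s t v \<bullet> reflection s t w
      = v \<bullet> w - (2 * (w \<bullet> ?n) / (?n \<bullet> ?n)) * (v \<bullet> ?n) - (2 * (v \<bullet> ?n) / (?n \<bullet> ?n)) * (?n \<bullet> w)
        + (2 * (v \<bullet> ?n) / (?n \<bullet> ?n)) * (2 * (w \<bullet> ?n) / (?n \<bullet> ?n)) * (?n \<bullet> ?n)"
    by (simp add: reflection_def inner_diff_left inner_diff_right algebra_simps)
  also have "\<dots> = v \<bullet> w" using S_D(3)[OF assms] by (simp add: inner_commute[of ?n w])
  finally show ?thesis .
qed

text \<open>Both f and the reflected \<gamma>' depend on t only through N / |N|^2, with coefficients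
  -2 \<phi> and -2 \<phi>', so their t-derivatives are proportional.\<close>

lemma reflection_velocity_derivative:
  assumes "(s, t) \<in> S" "\<phi> s \<noteq> 0"
  shows "((\<lambda>t. reflection s t (velocity \<gamma> s)) has_vector_derivative (deriv \<phi> s / \<phi> s) *\<^sub>R partial_t f (s, t)) (at t)"
proof -
  note s = S_D(1)[OF assms(1)] and t = S_D(2)[OF assms(1)] and nz = S_D(3)[OF assms(1)]
  have eq: "reflection s t (velocity \<gamma> s) = velocity \<gamma> s - (2 * deriv \<phi> s) *\<^sub>R (inverse (N s t \<bullet> N s t) *\<^sub>R N s t)" for t
    by (simp add: reflection_def N_\<gamma>[OF s] divide_inverse)
  have "((\<lambda>t. velocity \<gamma> s - (2 * deriv \<phi> s) *\<^sub>R (inverse (N s t \<bullet> N s t) *\<^sub>R N s t)) has_vector_derivative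
      0 - (2 * deriv \<phi> s) *\<^sub>R (inverse (N s t \<bullet> N s t) *\<^sub>R (A s t - (2 * (A s t \<bullet> N s t) / (N s t \<bullet> N s t)) *\<^sub>R N s t))) (at t)"
    by (intro has_vector_derivative_diff has_vector_derivative_const
        bounded_linear.has_vector_derivative[OF bounded_linear_scaleR_right] has_vector_derivative_inversion[OF N_t[OF t] nz])
  moreover have "(deriv \<phi> s / \<phi> s) *\<^sub>R partial_t f (s, t) = - (2 * deriv \<phi> s * inverse (N s t \<bullet> N s t)) *\<^sub>R reflection s t (A s t)"
    using assms(2) by (simp add: partial_t_f[OF assms(1)] divide_inverse)
  ultimately show ?thesis
    unfolding eq by (elim has_vector_derivative_eq_rhs) (simp add: reflection_def divide_inverse)
qed

lemma R_sub: "R \<subseteq> S"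
  by (auto simp: S_def regular_points_def)

lemma R_eq: "R = {p \<in> S. inj (frechet_derivative f (at p))}"
  by (auto simp: S_def regular_points_def)

lemma partials_orthogonal: "p \<in> S \<Longrightarrow> partial_s f p \<bullet> partial_t f p = 0"
  by (cases p) (auto simp: partial_s_f partial_t_f reflection_inner S_D A_\<gamma> inner_commute[of "velocity \<gamma> _"])

text \<open>Orthogonal vectors are dependent only if one of them is zero. This turns regularity into
  two open conditions.\<close>

lemma regular_iff: "p \<in> R \<longleftrightarrow> p \<in> S \<and> partial_s f p \<noteq> 0 \<and> partial_t f p \<noteq> 0"
proof (cases "p \<in> S")
  case True
  note D = frechet_derivative_eq_partials[OF df[OF True]]
  have lin: "linear (frechet_derivative f (at p))" by (rule linear_frechet_derivative[OF df[OF True]])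
  have "inj (frechet_derivative f (at p)) \<longleftrightarrow> partial_s f p \<noteq> 0 \<and> partial_t f p \<noteq> 0"
  proof
    assume inj: "inj (frechet_derivative f (at p))"
    then have "frechet_derivative f (at p) v = 0 \<Longrightarrow> v = 0" for v
      using lin linear_injective_0 by blast
    from this[of "(1, 0)"] this[of "(0, 1)"] show "partial_s f p \<noteq> 0 \<and> partial_t f p \<noteq> 0"
      unfolding partial_s_def partial_t_def by (auto simp: zero_prod_def)
  next
    assume nz: "partial_s f p \<noteq> 0 \<and> partial_t f p \<noteq> 0"
    have "v = 0" if v: "frechet_derivative f (at p) v = 0" for v
    proof -
      have *: "fst v *\<^sub>R partial_s f p + snd v *\<^sub>R partial_t f p = 0" using v D by metis
      have "partial_s f p \<bullet> (fst v *\<^sub>R partial_s f p + snd v *\<^sub>R partial_t f p) = fst v * (partial_s f p \<bullet> partial_s f p)"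
        using partials_orthogonal[OF True] by (simp add: inner_add_right)
      then have "fst v = 0" using * nz by simp
      then show ?thesis using * nz by (simp add: prod_eq_iff)
    qed
    then show "inj (frechet_derivative f (at p))" using lin linear_injective_0 by blast
  qed
  then show ?thesis using True by (simp add: R_eq)
next
  case False
  then show ?thesis using R_sub by auto
qed

lemma opR: "open R"
proof -
  have "open (S \<inter> partial_s f -` (- {0}))"
    by (rule continuous_open_preimage[OF smooth_on_imp_continuous_on[OF smooth_on_partial_s[OF sm_f]] opS]) (simp add: open_Compl)
  moreover have "open (S \<inter> partial_t f -` (- {0}))"
    by (rule continuous_open_preimage[OF smooth_on_imp_continuous_on[OF smooth_on_partial_t[OF sm_f]] opS]) (simp add: open_Compl)
  ultimately have "open ((S \<inter> partial_s f -` (- {0})) \<inter> (S \<inter> partial_t f -` (- {0})))" by (rule open_Int)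
  moreover have "R = (S \<inter> partial_s f -` (- {0})) \<inter> (S \<inter> partial_t f -` (- {0}))"
    using regular_iff by auto
  ultimately show ?thesis by simp
qed

lemma immersed: "immersed_surface R f"
  unfolding immersed_surface_def using opR smooth_on_subset[OF sm_f R_sub] by (auto simp: regular_points_def)

lemma at_R: "p \<in> R \<Longrightarrow> surface_at R f p"
  by unfold_locales (rule immersed)

lemma R_D:
  assumes "(s, t) \<in> R"
  shows "(s, t) \<in> S" "\<phi> s \<noteq> 0" "1 - 2 * \<phi> s * \<mu> s t / (N s t \<bullet> N s t) \<noteq> 0" "partial_t f (s, t) \<noteq> 0"
proof -
  show S: "(s, t) \<in> S" and t: "partial_t f (s, t) \<noteq> 0" using assms regular_iff by auto
  have "partial_s f (s, t) \<noteq> 0" using assms regular_iff by auto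
  then show "1 - 2 * \<phi> s * \<mu> s t / (N s t \<bullet> N s t) \<noteq> 0"
    unfolding partial_s_f[OF S] by (metis scaleR_zero_left)
  show "\<phi> s \<noteq> 0" using t unfolding partial_t_f[OF S] by auto
qed

text \<open>Write df/ds = c X with X the reflected \<gamma>'. The t-derivative of X is a multiple of
  df/dt, so that of c X lies in the span of X and df/dt. At a regular point c is nonzero, so X
  itself is a multiple of df/ds.\<close>

lemma mixed_tangent:
  assumes "p \<in> R"
  shows "partial_s (partial_t f) p \<in> tangent_plane f p"
proof -
  obtain s t where p: "p = (s, t)" by (cases p)
  have st: "(s, t) \<in> R" using assms p by simp
  note S = R_D(1)[OF st] and s = S_D(1)[OF R_D(1)[OF st]]
  interpret surface_at R f p by (rule at_R[OF assms])
  define c where "c = (\<lambda>t. 1 - 2 * \<phi> s * \<mu> s t / (N s t \<bullet> N s t))"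
  define X where "X = (\<lambda>t. reflection s t (velocity \<gamma> s))"
  have X: "(X has_vector_derivative (deriv \<phi> s / \<phi> s) *\<^sub>R partial_t f (s, t)) (at t)"
    unfolding X_def by (rule reflection_velocity_derivative[OF S R_D(2)[OF st]])
  have Xs: "partial_s f p = c t *\<^sub>R X t" using partial_s_f[OF S] by (simp add: p c_def X_def)
  have "smooth_on J (\<lambda>t. \<mu> s t)"
    unfolding \<mu>_def by (intro smooth_on_diff smooth_on_sum smooth_on_mult smooth_on_add smooth_on_vec_nth smooth_on_const sm_\<alpha> J)
  moreover have "((\<lambda>t. N s t \<bullet> N s t) has_vector_derivative N s t \<bullet> A s t + A s t \<bullet> N s t) (at t)"
    using N_t[OF S_D(2)[OF S]] by (intro bounded_bilinear.has_vector_derivative[OF bounded_bilinear_inner])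
  ultimately have "(\<lambda>t. \<mu> s t) differentiable (at t)" "(\<lambda>t. N s t \<bullet> N s t) differentiable (at t)"
    using S_D(2)[OF S] by (auto simp: smooth_on_imp_differentiable dest: differentiableI_vector)
  then have "c differentiable (at t)"
    unfolding c_def by (intro differentiable_diff differentiable_divide differentiable_mult differentiable_const S_D(3)[OF S])
  then obtain c' where c': "(c has_real_derivative c') (at t)"
    by (meson real_differentiable_def)
  have "((\<lambda>t. c t *\<^sub>R X t) has_vector_derivative c t *\<^sub>R ((deriv \<phi> s / \<phi> s) *\<^sub>R partial_t f (s, t)) + c' *\<^sub>R X t) (at t)"
    by (rule has_vector_derivative_scaleR[OF c' X])
  moreover obtain K where K: "open K" "t \<in> K" "{s} \<times> K \<subseteq> S"
  proof -
    obtain A' B where "open A'" "open B" "(s, t) \<in> A' \<times> B" "A' \<times> B \<subseteq> S"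
      using open_prod_elim[OF opS S] by metis
    then show ?thesis by (intro that[of B]) auto
  qed
  ultimately have "((\<lambda>t. partial_s f (s, t)) has_vector_derivative c t *\<^sub>R ((deriv \<phi> s / \<phi> s) *\<^sub>R partial_t f (s, t)) + c' *\<^sub>R X t) (at t)"
    by (elim has_vector_derivative_transform_within_open[OF _ K(1,2)]) (use K(3) in \<open>auto simp: partial_s_f c_def X_def\<close>)
  then have "partial_t (partial_s f) (s, t) = c t *\<^sub>R ((deriv \<phi> s / \<phi> s) *\<^sub>R partial_t f (s, t)) + c' *\<^sub>R X t"
    by (rule partial_t_eqI[OF smooth_on_imp_differentiable[OF smooth_on_partial_s[OF sm_f] S]])
  moreover have "X t = inverse (c t) *\<^sub>R partial_s f p"
    using R_D(3)[OF st] by (simp add: Xs c_def)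
  ultimately have "partial_s (partial_t f) p = (c t * (deriv \<phi> s / \<phi> s)) *\<^sub>R partial_t f p + (c' * inverse (c t)) *\<^sub>R partial_s f p"
    using partial_commute[OF opS sm_f S] by (simp add: p)
  also have "\<dots> \<in> tangent_plane f p"
    unfolding partial_s_eq_D partial_t_eq_D
    by (intro subspace_add[OF subspace_tangent_plane] subspace_scale[OF subspace_tangent_plane] D_in_tangent_plane)
  finally show ?thesis .
qed

lemma flat: "flat_normal_bundle R f"
  by (rule flat_normal_bundle_if_orthogonal_conjugate[OF immersed]) (use R_sub partials_orthogonal mixed_tangent in auto)

lemma coordinate_curves_principal:
  assumes "p \<in> R"
  shows "principal_direction f p (1, 0)" "principal_direction f p (0, 1)"
  using surface_at.coordinate_directions_principal[OF at_R[OF assms] _ mixed_tangent[OF assms]]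
    partials_orthogonal[OF subsetD[OF R_sub assms]] by simp_all

lemma s_curves:
  assumes "open_interval K" "\<forall>s\<in>K. (s, t) \<in> R"
  shows "line_of_curvature R f K (\<lambda>s. (s, t))"
proof -
  have K: "open K" using assms(1) by (simp add: open_interval_def)
  have "velocity (\<lambda>s. (s, t)) s = (1, 0)" for s
    by (rule vector_derivative_at) (auto intro!: derivative_eq_intros simp: has_vector_derivative_def)
  then show ?thesis
    unfolding line_of_curvature_def using assms coordinate_curves_principal
    by (auto intro!: smooth_on_Pair smooth_on_ident smooth_on_const K)
qed

lemma t_curves:
  assumes "open_interval K" "\<forall>t\<in>K. (s, t) \<in> R"
  shows "line_of_curvature R f K (\<lambda>t. (s, t))"
proof -
  have K: "open K" using assms(1) by (simp add: open_interval_def)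
  have "velocity (\<lambda>t. (s, t)) t = (0, 1)" for t
    by (rule vector_derivative_at) (auto intro!: derivative_eq_intros simp: has_vector_derivative_def)
  then show ?thesis
    unfolding line_of_curvature_def using assms coordinate_curves_principal
    by (auto intro!: smooth_on_Pair smooth_on_ident smooth_on_const K)
qed

lemma t_curve_geodesic_curvature:
  assumes "(s, t) \<in> R"
  shows "geodesic_curvature f (\<lambda>t. (s, t)) t = \<bar>deriv \<phi> s / \<phi> s\<bar>"
proof -
  note S = R_D(1)[OF assms]
  obtain A' K where "open A'" and K: "open K" "(s, t) \<in> A' \<times> K" "A' \<times> K \<subseteq> R"
    using open_prod_elim[OF opR assms] by metis
  have KS: "(s, t) \<in> S" if "t \<in> K" for t using K that R_sub by auto
  interpret surface_at R f "(s, t)" by (rule at_R[OF assms])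
  define X where "X = (\<lambda>t. reflection s t (velocity \<gamma> s))"
  have Xs: "X t = inverse (1 - 2 * \<phi> s * \<mu> s t / (N s t \<bullet> N s t)) *\<^sub>R partial_s f (s, t)"
    using R_D(3)[OF assms] by (simp add: partial_s_f[OF S] X_def)
  have Xs': "partial_s f (s, t) = (1 - 2 * \<phi> s * \<mu> s t / (N s t \<bullet> N s t)) *\<^sub>R X t"
    by (simp add: partial_s_f[OF S] X_def)
  show ?thesis
  proof (rule geodesic_curvature_eq[where K = K and X = X and W' = "\<lambda>t. partial_t f (s, t)" and U = R])
    show "surface_at R f (s, t)" by (rule at_R[OF assms])
    show "open K" "t \<in> K" using K by auto
    show "((\<lambda>\<tau>. f (s, \<tau>)) has_vector_derivative partial_t f (s, \<tau>)) (at \<tau>)" if "\<tau> \<in> K" for \<tau>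
      by (rule has_vector_derivative_partial_t[OF df[OF KS[OF that]]])
    show "(\<lambda>t. partial_t f (s, t)) differentiable (at t)"
      using has_vector_derivative_partial_t[OF smooth_on_imp_differentiable[OF smooth_on_partial_t[OF sm_f] S]]
      by (rule differentiableI_vector)
    show "partial_t f (s, t) \<noteq> 0" by (rule R_D(4)[OF assms])
    show "partial_t f (s, t) \<in> tangent_plane f (s, t)" unfolding partial_t_eq_D by (rule D_in_tangent_plane)
    show "X \<tau> \<bullet> partial_t f (s, \<tau>) = 0" if "\<tau> \<in> K" for \<tau>
      using KS[OF that] by (simp add: X_def partial_t_f reflection_inner S_D A_\<gamma> inner_commute[of "velocity \<gamma> s"])
    show "X t \<bullet> X t = 1" using S by (simp add: X_def reflection_inner S_D unit_\<gamma>)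
    show "X t \<in> tangent_plane f (s, t)"
      unfolding Xs partial_s_eq_D by (rule subspace_scale[OF subspace_tangent_plane D_in_tangent_plane])
    show "(X has_vector_derivative (deriv \<phi> s / \<phi> s) *\<^sub>R partial_t f (s, t)) (at t)"
      unfolding X_def by (rule reflection_velocity_derivative[OF S R_D(2)[OF assms]])
    show "tangent_plane f (s, t) \<subseteq> span {X t, partial_t f (s, t)}"
      by (rule tangent_plane_subset_span) (auto simp: Xs' intro: span_base span_scale)
  qed
qed

text \<open>The regular values of t may form several intervals. The value |\<phi>' / \<phi>| does
  not involve t, so one constant serves them all.\<close>

lemma t_curves_constant_geodesic_curvature: "constant_geodesic_curvature f {t. (s, t) \<in> R} (\<lambda>t. (s, t))"
  unfolding constant_geodesic_curvature_def using t_curve_geodesic_curvature by auto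

end

section \<open>Curvature line coordinates\<close>

lemma smooth_second_fundamental_form:
  assumes g: "immersed_surface U g"
  shows "smooth_on U (\<lambda>q. second_fundamental_form g q u v)"
proof -
  have U: "open U" "smooth_on U g" using g by (auto simp: immersed_surface_def)
  have "smooth_on U (\<lambda>q. frechet_derivative (\<lambda>q. frechet_derivative g (at q) v) (at q) u)"
    by (intro smooth_on_frechet_derivative U)
  then show ?thesis
    unfolding second_fundamental_form_def by (rule smooth_on_normal_part[OF g _ U(1)]) simp
qed

context surface_at
begin

text \<open>A quarter turn for the induced metric, scaled by the area element. Without normalization
  its coefficients stay polynomial in the first derivatives of \<open>g\<close>, and u \<mapsto> II
  u (rotate u) is a quadratic form.\<close>

definition rotate :: "real \<times> real \<Rightarrow> real \<times> real" where
  "rotate u = (- (D u \<bullet> D (0, 1)), D u \<bullet> D (1, 0))"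

lemma D_rotate: "D (rotate u) = - (D u \<bullet> D (0, 1)) *\<^sub>R D (1, 0) + (D u \<bullet> D (1, 0)) *\<^sub>R D (0, 1)"
  by (simp add: rotate_def D_eq[of "(_, _)"])

lemma rotate_orthogonal: "D u \<bullet> D (rotate u) = 0"
  by (simp add: D_rotate inner_add_right inner_diff_right)

lemma rotate_antisym: "D (rotate u) \<bullet> D v = - (D (rotate v) \<bullet> D u)"
  by (simp add: D_rotate inner_add_left inner_diff_left inner_commute algebra_simps)

lemma rotate_nonzero: "u \<noteq> 0 \<Longrightarrow> rotate u \<noteq> 0"
proof
  assume u: "u \<noteq> 0" "rotate u = 0"
  then have "D u \<bullet> D (1, 0) = 0" "D u \<bullet> D (0, 1) = 0" by (auto simp: rotate_def zero_prod_def)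
  moreover have "D u = fst u *\<^sub>R D (1, 0) + snd u *\<^sub>R D (0, 1)"
    using D_eq[of u] unfolding partial_s_eq_D partial_t_eq_D .
  then have "D u \<bullet> D u = fst u * (D u \<bullet> D (1, 0)) + snd u * (D u \<bullet> D (0, 1))"
    by (metis inner_add_right inner_scaleR_right)
  ultimately have "D u \<bullet> D u = 0" by simp
  then show False using u D_eq_0_iff by simp
qed

lemma II_rotate: "II u (rotate v) = (D v \<bullet> D (1, 0)) *\<^sub>R II u (0, 1) - (D v \<bullet> D (0, 1)) *\<^sub>R II u (1, 0)"
proof -
  have "rotate v = (D v \<bullet> D (1, 0)) *\<^sub>R (0, 1) + (- (D v \<bullet> D (0, 1))) *\<^sub>R (1, 0)" by (simp add: rotate_def)
  then show ?thesis by (simp only: II_add_right II_scale_right) simp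
qed

lemma principal_direction_scaleR:
  assumes "principal_direction g p u" "a \<noteq> 0"
  shows "principal_direction g p (a *\<^sub>R u)"
  using assms unfolding principal_direction_iff by (auto simp: linear_cmul[OF linear_D] II_scale_left)

text \<open>The quadratic form \<open>u \<mapsto> II u (rotate u) \<bullet> \<zeta>\<close> vanishes on the principal directions; for this
  \<open>\<zeta>\<close> it is nondegenerate when the point is not umbilic.\<close>

lemma polar_form_nonzero:
  assumes u: "principal_direction g p u" and nu: "\<not> umbilic g p"
  defines "v \<equiv> rotate u"
  defines "\<zeta> \<equiv> II u u /\<^sub>R (D u \<bullet> D u) - II v v /\<^sub>R (D v \<bullet> D v)"
  shows "(II u (rotate v) + II v (rotate u)) \<bullet> \<zeta> \<noteq> 0"
proof
  assume 0: "(II u (rotate v) + II v (rotate u)) \<bullet> \<zeta> = 0"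
  have u0: "u \<noteq> 0" and up: "\<And>w. D u \<bullet> D w = 0 \<Longrightarrow> II u w = 0" using u principal_direction_iff by auto
  have v0: "v \<noteq> 0" unfolding v_def by (rule rotate_nonzero[OF u0])
  have uv: "D u \<bullet> D v = 0" unfolding v_def by (rule rotate_orthogonal)
  have pos: "D u \<bullet> D u \<noteq> 0" "D v \<bullet> D v \<noteq> 0" using u0 v0 D_eq_0_iff by auto
  have IIuv: "II u v = 0" by (rule up[OF uv])
  \<comment> \<open>Only \<open>a\<close> is needed, since the other term of II u (rotate v)
    contains II u v = 0. Antisymmetry of the turn yields a = -|D v|^2 / |D u|^2.\<close>
  obtain a b where ab: "rotate v = a *\<^sub>R u + b *\<^sub>R v" by (rule orthogonal_directions_basis[OF uv u0 v0])
  have "D (rotate v) \<bullet> D u = - (D v \<bullet> D v)" using rotate_antisym[of v u] by (simp add: v_def)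
  moreover have "D (rotate v) \<bullet> D u = a * (D u \<bullet> D u)"
    using uv by (simp add: ab linear_add[OF linear_D] linear_cmul[OF linear_D] inner_add_left inner_commute[of "D v" "D u"])
  ultimately have a: "a = - (D v \<bullet> D v) / (D u \<bullet> D u)" using pos by (simp add: field_simps)
  have "II u (rotate v) = a *\<^sub>R II u u" by (simp add: ab II_add_right II_scale_right IIuv)
  then have "II u (rotate v) + II v (rotate u) = - (D v \<bullet> D v) *\<^sub>R \<zeta>"
    using pos by (simp add: \<zeta>_def a v_def[symmetric] scaleR_diff_right divide_inverse)
  \<comment> \<open>\<zeta> is the difference of the two principal curvature vectors, so its
    vanishing means that they agree and the point is umbilic.\<close>
  then have "\<zeta> = 0" using 0 pos by simp
  then have H: "II v v /\<^sub>R (D v \<bullet> D v) = II u u /\<^sub>R (D u \<bullet> D u)" by (simp add: \<zeta>_def)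
  have "umbilic g p"
  proof (rule umbilic_if[OF uv u0 v0 IIuv])
    show "II u u = (D u \<bullet> D u) *\<^sub>R (II u u /\<^sub>R (D u \<bullet> D u))" using pos by simp
    show "II v v = (D v \<bullet> D v) *\<^sub>R (II u u /\<^sub>R (D u \<bullet> D u))" unfolding H[symmetric] using pos by simp
    show "II u u /\<^sub>R (D u \<bullet> D u) \<in> normal_space g p" by (intro subspace_scale[OF subspace_normal_space] II_normal)
  qed
  then show False using nu by simp
qed

end

text \<open>Near p the given line is spanned by x0 + m y0 with a continuous m. Pairing the principal
  condition with a fixed vector turns it into a quadratic equation for m with smooth coefficients.
  Its discriminant is positive near p, because p is not umbilic, so m depends smoothly on the
  coefficients.\<close>

lemma smooth_principal_field:
  fixes g :: "real \<times> real \<Rightarrow> 'a::euclidean_space"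
  assumes g: "immersed_surface U g" and nu: "\<And>q. q \<in> U \<Longrightarrow> \<not> umbilic g q"
    and L: "curvature_line_field U g L" and p: "p \<in> U"
  obtains V X where "open V" "p \<in> V" "V \<subseteq> U" "smooth_on V X"
    "\<And>q. q \<in> V \<Longrightarrow> principal_direction g q (X q)" "\<And>q. q \<in> V \<Longrightarrow> L q = span {X q}"
proof -
  obtain V0 X0 where V0: "open V0" "p \<in> V0" "V0 \<subseteq> U" and cX: "continuous_on V0 X0"
    and X0: "\<And>q. q \<in> V0 \<Longrightarrow> principal_direction g q (X0 q)" "\<And>q. q \<in> V0 \<Longrightarrow> L q = span {X0 q}"
    using L p unfolding curvature_line_field_def by metis
  have U: "open U" and smg: "smooth_on U g" using g by (auto simp: immersed_surface_def)
  have at: "surface_at U g q" if "q \<in> V0" for q using g V0 that by unfold_locales auto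
  interpret p: surface_at U g p by (rule at[OF V0(2)])
  define x0 y0 where "x0 = X0 p" and "y0 = p.rotate x0"
  \<comment> \<open>Frozen at p: at nearby points it merely extracts one scalar equation from the
    vector condition. The nonvanishing of the polar form at p extends to them by continuity.\<close>
  define \<zeta> where "\<zeta> = p.II x0 x0 /\<^sub>R (p.D x0 \<bullet> p.D x0) - p.II y0 y0 /\<^sub>R (p.D y0 \<bullet> p.D y0)"
  have x0: "x0 \<noteq> 0" using X0(1)[OF V0(2)] by (simp add: x0_def principal_direction_def)
  have y0: "y0 \<noteq> 0" unfolding y0_def by (rule p.rotate_nonzero[OF x0])
  have xy: "p.D x0 \<bullet> p.D y0 = 0" unfolding y0_def by (rule p.rotate_orthogonal)
  have pos: "p.D x0 \<bullet> p.D x0 \<noteq> 0" "p.D y0 \<bullet> p.D y0 \<noteq> 0" using x0 y0 p.D_eq_0_iff by auto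
  define G where "G = (\<lambda>q u v. frechet_derivative g (at q) u \<bullet> frechet_derivative g (at q) v)"
  define B where "B = (\<lambda>q u v. second_fundamental_form g q u v \<bullet> \<zeta>)"
  define F where "F = (\<lambda>q u v. G q v (1, 0) * B q u (0, 1) - G q v (0, 1) * B q u (1, 0))"
  have F: "F q u v = second_fundamental_form g q u (surface_at.rotate g q v) \<bullet> \<zeta>" if "q \<in> V0" for q u v
    by (simp add: F_def B_def G_def surface_at.II_rotate[OF at[OF that]] inner_diff_left)
  have smF: "smooth_on V0 (\<lambda>q. F q u v)" for u v
    unfolding F_def G_def B_def
    by (intro smooth_on_diff smooth_on_mult smooth_on_inner smooth_on_const V0 
      smooth_on_subset[OF smooth_on_frechet_derivative[OF smg] V0(3)] smooth_on_subset[OF smooth_second_fundamental_form[OF g] V0(3)])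
  have contF: "continuous_on V0 (\<lambda>q. F q u v)" for u v by (rule smooth_on_imp_continuous_on[OF smF])
  define a b c where "a = (\<lambda>q. F q x0 x0)" and "b = (\<lambda>q. (F q x0 y0 + F q y0 x0) / 2)" and "c = (\<lambda>q. F q y0 y0)"
  have b0: "b p \<noteq> 0"
    using p.polar_form_nonzero[OF X0(1)[OF V0(2)] nu[OF p]]
    by (simp add: b_def F[OF V0(2)] inner_add_left \<zeta>_def x0_def[symmetric] y0_def[symmetric])
  define P where "P = (\<lambda>x. (p.D x \<bullet> p.D x0) / (p.D x0 \<bullet> p.D x0))"
  define P' where "P' = (\<lambda>x. (p.D x \<bullet> p.D y0) / (p.D y0 \<bullet> p.D y0))"
  have decomp: "x = P x *\<^sub>R x0 + P' x *\<^sub>R y0" for x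
  proof -
    obtain r r' where r: "x = r *\<^sub>R x0 + r' *\<^sub>R y0" by (rule p.orthogonal_directions_basis[OF xy x0 y0])
    have "p.D x = r *\<^sub>R p.D x0 + r' *\<^sub>R p.D y0"
      by (simp only: r linear_add[OF p.linear_D] linear_cmul[OF p.linear_D])
    then have "P x = r" "P' x = r'"
      using xy pos by (simp_all add: P_def P'_def inner_add_left inner_commute[of "p.D y0" "p.D x0"])
    then show ?thesis using r by simp
  qed
  have blD: "bounded_linear p.D" using p.linear_D by (simp add: linear_conv_bounded_linear)
  have contD: "continuous_on V0 (\<lambda>q. p.D (X0 q))" by (rule bounded_linear.continuous_on[OF blD cX])
  have contP: "continuous_on V0 (\<lambda>q. P (X0 q))" "continuous_on V0 (\<lambda>q. P' (X0 q))"
    unfolding P_def P'_def using pos by (auto intro!: continuous_intros contD)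
  have Pp: "P (X0 p) = 1" "P' (X0 p) = 0"
    using pos xy by (simp_all add: P_def P'_def x0_def[symmetric] inner_commute)
  define m where "m = (\<lambda>q. P' (X0 q) / P (X0 q))"
  define V1 where "V1 = V0 \<inter> (\<lambda>q. P (X0 q)) -` (- {0})"
  have V1: "open V1" unfolding V1_def by (rule continuous_open_preimage[OF contP(1) V0(1)]) (simp add: open_Compl)
  have V1': "p \<in> V1" "V1 \<subseteq> V0" "\<And>q. q \<in> V1 \<Longrightarrow> P (X0 q) \<noteq> 0" using Pp V0 by (auto simp: V1_def)
  have contm: "continuous_on V1 m"
    unfolding m_def using V1' by (intro continuous_intros continuous_on_subset[OF contP(1)] continuous_on_subset[OF contP(2)]) auto
  have X0m: "X0 q = P (X0 q) *\<^sub>R (x0 + m q *\<^sub>R y0)" if "q \<in> V1" for q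
    using decomp[of "X0 q"] V1'(3)[OF that] by (simp add: m_def scaleR_add_right)
  have quad: "a q + 2 * b q * m q + c q * (m q)\<^sup>2 = 0" if q: "q \<in> V1" for q
  proof -
    have q0: "q \<in> V0" using q V1' by auto
    interpret q: surface_at U g q by (rule at[OF q0])
    let ?x = "x0 + m q *\<^sub>R y0"
    have "principal_direction g q (inverse (P (X0 q)) *\<^sub>R X0 q)"
      using X0(1)[OF q0] V1'(3)[OF q] by (intro q.principal_direction_scaleR) auto
    then have "principal_direction g q ?x" using X0m[OF q] V1'(3)[OF q] by (metis left_inverse scaleR_one scaleR_scaleR)
    then have "q.II ?x (q.rotate ?x) = 0" using q.principal_direction_iff q.rotate_orthogonal by blast
    then have "F q ?x ?x = 0" using F[OF q0] by simp
    moreover have "G q (u + v) w = G q u w + G q v w" "G q (r *\<^sub>R u) w = r * G q u w" for u v w r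
      by (simp_all add: G_def linear_add[OF q.linear_D] linear_cmul[OF q.linear_D] inner_add_left)
    moreover have "B q (u + v) w = B q u w + B q v w" "B q (r *\<^sub>R u) w = r * B q u w" for u v w r
      by (simp_all only: B_def q.II_add_left q.II_scale_left inner_add_left inner_scaleR_left)
    moreover have "2 * b q = F q x0 y0 + F q y0 x0" by (simp add: b_def)
    ultimately show ?thesis
      by (simp only: F_def a_def c_def) (simp add: algebra_simps power2_eq_square)
  qed
  \<comment> \<open>Half the derivative of the quadratic polynomial at its root m, whose square is
    the discriminant. It equals b at p, and its constant sign near p singles out the branch that m
    follows.\<close>
  define S where "S = (\<lambda>q. b q + c q * m q)"
  have contabc: "continuous_on V1 a" "continuous_on V1 b" "continuous_on V1 c"
    unfolding a_def b_def c_def by (intro continuous_intros continuous_on_subset[OF contF V1'(2)]; simp)+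
  have contS: "continuous_on V1 S" unfolding S_def by (intro continuous_intros contm contabc)
  have Sp: "S p = b p" using Pp by (simp add: S_def m_def)
  \<comment> \<open>The first condition fixes the sign of S and so the branch. The second keeps b +
    S nonzero for the division below.\<close>
  define V where "V = V1 \<inter> (\<lambda>q. (S q * b p, (b q + S q) * b p)) -` ({0<..} \<times> {0<..})"
  have V: "open V"
    unfolding V_def by (rule continuous_open_preimage) (intro continuous_intros contS contabc V1 open_Times open_greaterThan)+
  have Vp: "p \<in> V" using V1' b0 by (auto simp: V_def Sp not_less zero_less_mult_iff linorder_neq_iff)
  have VD: "q \<in> V1" "S q * b p > 0" "b q + S q \<noteq> 0" if "q \<in> V" for q using that by (auto simp: V_def)
  have S2: "(S q)\<^sup>2 = (b q)\<^sup>2 - a q * c q" if "q \<in> V1" for q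
  proof -
    have "(S q)\<^sup>2 = (b q)\<^sup>2 + c q * (2 * b q * m q + c q * (m q)\<^sup>2)"
      by (simp add: S_def power2_eq_square algebra_simps)
    also have "2 * b q * m q + c q * (m q)\<^sup>2 = - a q" using quad[OF that] by simp
    finally show ?thesis by simp
  qed
  have Ssqrt: "S q = sgn (b p) * sqrt ((b q)\<^sup>2 - a q * c q)" if "q \<in> V" for q
  proof -
    have "sqrt ((b q)\<^sup>2 - a q * c q) = \<bar>S q\<bar>" using S2[OF VD(1)[OF that]] by (metis real_sqrt_abs)
    then show ?thesis using VD(2)[OF that] by (auto simp: zero_less_mult_iff sgn_if)
  qed
  have disc: "(b q)\<^sup>2 - a q * c q > 0" if "q \<in> V" for q
    using S2[OF VD(1)[OF that]] VD(2)[OF that] by (metis less_irrefl mult_zero_left zero_less_power2)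
  have VV0: "V \<subseteq> V0" using V1'(2) by (auto simp: V_def)
  have smabc: "smooth_on V a" "smooth_on V b" "smooth_on V c"
    unfolding a_def b_def c_def
    by (intro smooth_on_divide smooth_on_add smooth_on_const V smooth_on_subset[OF smF VV0]; simp)+
  have smS: "smooth_on V (\<lambda>q. sgn (b p) * sqrt ((b q)\<^sup>2 - a q * c q))"
    by (intro smooth_on_mult smooth_on_const smooth_on_sqrt smooth_on_diff smooth_on_power V smabc disc)
  \<comment> \<open>The rationalized form of the root: the usual one would divide by c, which may
    vanish.\<close>
  have m_eq: "m q = - a q / (b q + sgn (b p) * sqrt ((b q)\<^sup>2 - a q * c q))" if "q \<in> V" for q
  proof -
    have "m q * (b q + S q) = - a q"
      using quad[OF VD(1)[OF that]] by (simp add: S_def power2_eq_square algebra_simps)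
    then show ?thesis using VD(3)[OF that] unfolding Ssqrt[OF that, symmetric] by (simp add: field_simps)
  qed
  have "smooth_on V (\<lambda>q. - a q / (b q + sgn (b p) * sqrt ((b q)\<^sup>2 - a q * c q)))"
    by (intro smooth_on_divide smooth_on_minus smooth_on_add smabc smS V) (use VD(3) Ssqrt in auto)
  then have smm: "smooth_on V m"
    using smooth_on_cong[OF V, of m "\<lambda>q. - a q / (b q + sgn (b p) * sqrt ((b q)\<^sup>2 - a q * c q))"] m_eq by simp
  show thesis
  proof (rule that[OF V Vp])
    show "V \<subseteq> U" using VV0 V0(3) by simp
    show "smooth_on V (\<lambda>q. x0 + m q *\<^sub>R y0)"
      by (intro smooth_on_add smooth_on_scaleR smooth_on_const smm V)
    fix q assume q: "q \<in> V"
    have q1: "q \<in> V1" and q0: "q \<in> V0" using VD(1)[OF q] V1' by auto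
    interpret q: surface_at U g q by (rule at[OF q0])
    have eq: "x0 + m q *\<^sub>R y0 = inverse (P (X0 q)) *\<^sub>R X0 q"
      using X0m[OF q1] V1'(3)[OF q1] by (metis left_inverse scaleR_one scaleR_scaleR)
    show "principal_direction g q (x0 + m q *\<^sub>R y0)"
      unfolding eq using X0(1)[OF q0] V1'(3)[OF q1] by (intro q.principal_direction_scaleR) auto
    show "L q = span {x0 + m q *\<^sub>R y0}"
      unfolding eq X0(2)[OF q0] using span_image_scale[of "{X0 q}" "\<lambda>_. inverse (P (X0 q))"] V1'(3)[OF q1] by simp
  qed
qed

text \<open>The left inverse is carried along because it makes \<psi> an immersion, shows that
  smaller rectangles have open images, and in the end provides the diffeomorphism.\<close>

definition curvature_coordinates ::
    "(real \<times> real) set \<Rightarrow> (real \<times> real \<Rightarrow> 'a::euclidean_space) \<Rightarrow> (real \<times> real \<Rightarrow> (real \<times> real) set)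
      \<Rightarrow> real set \<Rightarrow> real set \<Rightarrow> (real \<times> real \<Rightarrow> real \<times> real) \<Rightarrow> bool" where
  "curvature_coordinates U g L A B \<psi> \<longleftrightarrow>
     open_interval A \<and> open_interval B \<and> smooth_on (A \<times> B) \<psi> \<and>
     open (\<psi> ` (A \<times> B)) \<and> \<psi> ` (A \<times> B) \<subseteq> U \<and>
     (\<exists>\<Phi>. smooth_on (\<psi> ` (A \<times> B)) \<Phi> \<and> (\<forall>x\<in>A \<times> B. \<Phi> (\<psi> x) = x)) \<and>
     (\<forall>x\<in>A \<times> B. partial_t \<psi> x \<in> L (\<psi> x) \<and>
        frechet_derivative g (at (\<psi> x)) (partial_s \<psi> x) \<bullet> frechet_derivative g (at (\<psi> x)) (partial_t \<psi> x) = 0)"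

text \<open>The coordinates are first integrals h1 of X and h2 of the orthogonal field Y, and \<psi>
  inverts the pair. A vector in both kernels is a multiple of X and of Y, hence orthogonal to
  itself, so the pair is a local diffeomorphism. Along a t-line h1 is constant, so the line follows
  X.\<close>

lemma curvature_coordinates_exist:
  fixes g :: "real \<times> real \<Rightarrow> 'a::euclidean_space"
  assumes g: "immersed_surface U g" and nu: "\<And>q. q \<in> U \<Longrightarrow> \<not> umbilic g q"
    and L: "curvature_line_field U g L" and p: "p \<in> U"
  obtains l m l' m' \<psi> x0 where "curvature_coordinates U g L {l<..<m} {l'<..<m'} \<psi>"
    "x0 \<in> {l<..<m} \<times> {l'<..<m'}" "\<psi> x0 = p"
proof -
  obtain V0 X where V0: "open V0" "p \<in> V0" "V0 \<subseteq> U" and smX: "smooth_on V0 X"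
    and X: "\<And>q. q \<in> V0 \<Longrightarrow> principal_direction g q (X q)" "\<And>q. q \<in> V0 \<Longrightarrow> L q = span {X q}"
    by (rule smooth_principal_field[OF g nu L p], assumption, rule that)
  have smg: "smooth_on U g" using g by (simp add: immersed_surface_def)
  have at: "surface_at U g q" if "q \<in> V0" for q using g V0 that by unfold_locales auto
  define Y where "Y = (\<lambda>q. surface_at.rotate g q (X q))"
  have X_nz: "X q \<noteq> 0" if "q \<in> V0" for q using X(1)[OF that] by (simp add: principal_direction_def)
  have Y_nz: "Y q \<noteq> 0" if "q \<in> V0" for q
    unfolding Y_def by (rule surface_at.rotate_nonzero[OF at[OF that] X_nz[OF that]])
  have smD: "smooth_on V0 (\<lambda>q. frechet_derivative g (at q) v)" for v
    by (rule smooth_on_subset[OF smooth_on_frechet_derivative[OF smg] V0(3)])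
  have smDX: "smooth_on V0 (\<lambda>q. frechet_derivative g (at q) (X q))"
  proof -
    have "smooth_on V0 (\<lambda>q. fst (X q) *\<^sub>R partial_s g q + snd (X q) *\<^sub>R partial_t g q)"
      unfolding partial_s_def partial_t_def
      by (intro smooth_on_add smooth_on_scaleR smooth_on_fst smooth_on_snd smX V0 smD)
    then show ?thesis
      using smooth_on_cong[OF V0(1), of "\<lambda>q. frechet_derivative g (at q) (X q)"] surface_at.D_eq[OF at] by simp
  qed
  have "smooth_on V0 (\<lambda>q. (- (frechet_derivative g (at q) (X q) \<bullet> frechet_derivative g (at q) (0, 1)),
      frechet_derivative g (at q) (X q) \<bullet> frechet_derivative g (at q) (1, 0)))"
    by (intro smooth_on_Pair smooth_on_minus smooth_on_inner smDX smD V0)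
  then have smY: "smooth_on V0 Y"
    using smooth_on_cong[OF V0(1), of Y] surface_at.rotate_def[OF at] by (simp add: Y_def)
  obtain V1 h1 where V1: "open V1" "p \<in> V1" "V1 \<subseteq> V0" and h1: "smooth_on V1 h1"
    and k1: "\<And>q v. q \<in> V1 \<Longrightarrow> frechet_derivative h1 (at q) v = (0::real) \<longleftrightarrow> v \<in> span {X q}"
    by (rule first_integral[OF V0(1) smX V0(2) X_nz[OF V0(2)]], rule that)
  obtain V2 h2 where V2: "open V2" "p \<in> V2" "V2 \<subseteq> V0" and h2: "smooth_on V2 h2"
    and k2: "\<And>q v. q \<in> V2 \<Longrightarrow> frechet_derivative h2 (at q) v = (0::real) \<longleftrightarrow> v \<in> span {Y q}"
    by (rule first_integral[OF V0(1) smY V0(2) Y_nz[OF V0(2)]], rule that)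
  define W where "W = V1 \<inter> V2"
  have W: "open W" "p \<in> W" "W \<subseteq> V0" using V1 V2 by (auto simp: W_def)
  define \<Phi> where "\<Phi> = (\<lambda>q. (h1 q, h2 q))"
  have smh: "smooth_on W h1" "smooth_on W h2"
    using smooth_on_subset[OF h1] smooth_on_subset[OF h2] by (auto simp: W_def)
  have sm\<Phi>: "smooth_on W \<Phi>" unfolding \<Phi>_def by (intro smooth_on_Pair smh W)
  have D\<Phi>: "frechet_derivative \<Phi> (at q) = (\<lambda>v. (frechet_derivative h1 (at q) v, frechet_derivative h2 (at q) v))" if "q \<in> W" for q
  proof -
    have "(\<Phi> has_derivative (\<lambda>v. (frechet_derivative h1 (at q) v, frechet_derivative h2 (at q) v))) (at q)"
      unfolding \<Phi>_def by (intro has_derivative_Pair smooth_on_has_derivative[OF smh(1) that] smooth_on_has_derivative[OF smh(2) that])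
    from frechet_derivative_at[OF this] show ?thesis by simp
  qed
  have indep: "v = 0" if q: "q \<in> V0" and v: "v \<in> span {X q}" "v \<in> span {Y q}" for q v
  proof -
    interpret q: surface_at U g q by (rule at[OF q])
    obtain a b where ab: "v = a *\<^sub>R X q" "v = b *\<^sub>R Y q" using v unfolding span_singleton by blast
    have "q.D v \<bullet> q.D v = q.D (a *\<^sub>R X q) \<bullet> q.D (b *\<^sub>R Y q)" using ab by metis
    also have "\<dots> = a * b * (q.D (X q) \<bullet> q.D (Y q))" by (simp add: linear_cmul[OF q.linear_D])
    also have "\<dots> = 0" by (simp add: Y_def q.rotate_orthogonal)
    finally show ?thesis using q.D_eq_0_iff by simp
  qed
  have inj: "inj (frechet_derivative \<Phi> (at p))"
  proof -
    have lin: "linear (frechet_derivative \<Phi> (at p))"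
      by (rule linear_frechet_derivative[OF smooth_on_imp_differentiable[OF sm\<Phi> W(2)]])
    show ?thesis
    proof (rule linear_injective_0[OF lin, THEN iffD2], intro allI impI)
      fix v assume "frechet_derivative \<Phi> (at p) v = 0"
      then have "frechet_derivative h1 (at p) v = 0" "frechet_derivative h2 (at p) v = 0"
        by (simp_all add: D\<Phi>[OF W(2)] zero_prod_def)
      then show "v = 0" using k1[OF V1(2)] k2[OF V2(2)] indep[OF V0(2)] by blast
    qed
  qed
  obtain U' V' \<psi> where *: "open U'" "U' \<subseteq> W" "p \<in> U'" "open V'" "homeomorphism U' V' \<Phi> \<psi>" "smooth_on V' \<psi>"
    by (rule smooth_local_inverse[OF W(1) sm\<Phi> W(2) inj], rule that)
  have "\<Phi> p \<in> V'" using *(3,5) by (auto simp: homeomorphism_def)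
  then obtain A' B' where AB: "open A'" "open B'" "\<Phi> p \<in> A' \<times> B'" "A' \<times> B' \<subseteq> V'"
    using open_prod_elim[OF *(4)] by metis
  obtain r1 where r1: "r1 > 0" "ball (h1 p) r1 \<subseteq> A'" using AB(1,3) openE[of A' "h1 p"] by (auto simp: \<Phi>_def)
  obtain r2 where r2: "r2 > 0" "ball (h2 p) r2 \<subseteq> B'" using AB(2,3) openE[of B' "h2 p"] by (auto simp: \<Phi>_def)
  define A where "A = {h1 p - r1<..<h1 p + r1}"
  define B where "B = {h2 p - r2<..<h2 p + r2}"
  have AB': "A \<times> B \<subseteq> V'" using AB(4) r1 r2 unfolding A_def B_def ball_eq_greaterThanLessThan by blast
  have opAB: "open (A \<times> B)" by (auto simp: A_def B_def intro: open_Times)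
  have pAB: "\<Phi> p \<in> A \<times> B" using r1 r2 by (auto simp: A_def B_def \<Phi>_def)
  have \<Phi>\<psi>: "\<Phi> (\<psi> x) = x" and \<psi>U: "\<psi> x \<in> U'" if "x \<in> A \<times> B" for x
    using *(5) AB' that by (auto simp: homeomorphism_def)
  have \<psi>\<Phi>: "\<psi> (\<Phi> q) = q" if "q \<in> U'" for q using *(5) that by (simp add: homeomorphism_def)
  have im: "\<psi> ` (A \<times> B) = U' \<inter> \<Phi> -` (A \<times> B)"
  proof (intro set_eqI iffI)
    fix q assume "q \<in> \<psi> ` (A \<times> B)"
    then show "q \<in> U' \<inter> \<Phi> -` (A \<times> B)" using \<Phi>\<psi> \<psi>U by force
  next
    fix q assume q: "q \<in> U' \<inter> \<Phi> -` (A \<times> B)"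
    then have "q = \<psi> (\<Phi> q)" "\<Phi> q \<in> A \<times> B" using \<psi>\<Phi> by auto
    then show "q \<in> \<psi> ` (A \<times> B)" by (rule image_eqI)
  qed
  have sm\<Phi>': "smooth_on U' \<Phi>" by (rule smooth_on_subset[OF sm\<Phi> *(2)])
  have sm\<psi>: "smooth_on (A \<times> B) \<psi>" by (rule smooth_on_subset[OF *(6) AB'])
  have opim: "open (\<psi> ` (A \<times> B))"
    unfolding im by (rule continuous_open_preimage[OF smooth_on_imp_continuous_on[OF sm\<Phi>'] *(1) opAB])
  have deriv: "partial_t \<psi> x \<in> span {X (\<psi> x)}" "partial_s \<psi> x \<in> span {Y (\<psi> x)}" if x: "x \<in> A \<times> B" for x
  proof -
    have qW: "\<psi> x \<in> W" using \<psi>U[OF x] *(2) by blast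
    have "((\<lambda>x. \<Phi> (\<psi> x)) has_derivative (\<lambda>v. frechet_derivative \<Phi> (at (\<psi> x)) (frechet_derivative \<psi> (at x) v))) (at x)"
      by (rule has_derivative_compose[OF smooth_on_has_derivative[OF sm\<psi> x] smooth_on_has_derivative[OF sm\<Phi> qW]])
    then have "((\<lambda>x. x) has_derivative (\<lambda>v. frechet_derivative \<Phi> (at (\<psi> x)) (frechet_derivative \<psi> (at x) v))) (at x)"
      using has_derivative_cong_open[OF opAB x, of "\<lambda>x. \<Phi> (\<psi> x)" "\<lambda>x. x"] \<Phi>\<psi> by simp
    then have "(\<lambda>v. frechet_derivative \<Phi> (at (\<psi> x)) (frechet_derivative \<psi> (at x) v)) = (\<lambda>v. v)"
      by (rule has_derivative_unique[OF _ has_derivative_ident])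
    then have id: "frechet_derivative \<Phi> (at (\<psi> x)) (frechet_derivative \<psi> (at x) v) = v" for v by (rule fun_cong)
    have "frechet_derivative h1 (at (\<psi> x)) (partial_t \<psi> x) = 0" "frechet_derivative h2 (at (\<psi> x)) (partial_s \<psi> x) = 0"
      using id[of "(0, 1)"] id[of "(1, 0)"] unfolding D\<Phi>[OF qW] partial_s_def partial_t_def by simp_all
    then show "partial_t \<psi> x \<in> span {X (\<psi> x)}" "partial_s \<psi> x \<in> span {Y (\<psi> x)}"
      using k1 k2 qW by (auto simp: W_def)
  qed
  have cc: "curvature_coordinates U g L A B \<psi>"
    unfolding curvature_coordinates_def
  proof (intro conjI ballI)
    show "open_interval A" "open_interval B"
      using r1 r2 by (auto simp: open_interval_def A_def B_def is_interval_oo)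
    show "smooth_on (A \<times> B) \<psi>" by (rule sm\<psi>)
    show "open (\<psi> ` (A \<times> B))" by (rule opim)
    show "\<psi> ` (A \<times> B) \<subseteq> U" using im *(2) W(3) V0(3) by blast
    show "\<exists>\<Phi>. smooth_on (\<psi> ` (A \<times> B)) \<Phi> \<and> (\<forall>x\<in>A \<times> B. \<Phi> (\<psi> x) = x)"
      using smooth_on_subset[OF sm\<Phi>', of "\<psi> ` (A \<times> B)"] \<Phi>\<psi> im by blast
    fix x assume x: "x \<in> A \<times> B"
    have q: "\<psi> x \<in> V0" using \<psi>U[OF x] *(2) W(3) by blast
    show "partial_t \<psi> x \<in> L (\<psi> x)" using deriv(1)[OF x] X(2)[OF q] by simp
    interpret q: surface_at U g "\<psi> x" by (rule at[OF q])
    obtain a b where ab: "partial_t \<psi> x = a *\<^sub>R X (\<psi> x)" "partial_s \<psi> x = b *\<^sub>R Y (\<psi> x)"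
      using deriv[OF x] by (auto simp: span_singleton)
    show "q.D (partial_s \<psi> x) \<bullet> q.D (partial_t \<psi> x) = 0"
      unfolding ab using q.rotate_orthogonal[of "X (\<psi> x)"] by (simp add: linear_cmul[OF q.linear_D] Y_def inner_commute)
  qed
  show thesis
    by (rule that[OF cc[unfolded A_def B_def] pAB[unfolded A_def B_def] \<psi>\<Phi>[OF *(3)]])
qed

section \<open>Restriction and reparametrization of curvature line coordinates\<close>

lemma curvature_coordinates_inverse:
  assumes "curvature_coordinates U g L A B \<psi>"
  obtains \<Phi> where "smooth_on (\<psi> ` (A \<times> B)) \<Phi>" "\<And>x. x \<in> A \<times> B \<Longrightarrow> \<Phi> (\<psi> x) = x"
  using assms unfolding curvature_coordinates_def by blast

lemma image_eq_if_left_inverse: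
  assumes "\<And>x. x \<in> S \<Longrightarrow> \<Phi> (\<psi> x) = x" "T \<subseteq> S"
  shows "\<psi> ` T = \<psi> ` S \<inter> \<Phi> -` T"
proof (intro equalityI subsetI)
  fix y assume "y \<in> \<psi> ` T"
  then obtain x where "x \<in> T" "y = \<psi> x" by (rule imageE)
  then show "y \<in> \<psi> ` S \<inter> \<Phi> -` T" using assms by (metis IntI imageI subsetD vimageI)
next
  fix y assume "y \<in> \<psi> ` S \<inter> \<Phi> -` T"
  then obtain x where "x \<in> S" "y = \<psi> x" "\<Phi> y \<in> T" by blast
  then show "y \<in> \<psi> ` T" using assms(1) by (metis imageI)
qed

lemma curvature_coordinates_restrict:
  assumes cc: "curvature_coordinates U g L A B \<psi>"
    and A': "open_interval A'" "A' \<subseteq> A" and B': "open_interval B'" "B' \<subseteq> B"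
  shows "curvature_coordinates U g L A' B' \<psi>"
proof -
  obtain \<Phi> where \<Phi>: "smooth_on (\<psi> ` (A \<times> B)) \<Phi>" "\<And>x. x \<in> A \<times> B \<Longrightarrow> \<Phi> (\<psi> x) = x"
    by (rule curvature_coordinates_inverse[OF cc], rule that)
  have op: "open (\<psi> ` (A \<times> B))" using cc by (simp add: curvature_coordinates_def)
  have sub: "A' \<times> B' \<subseteq> A \<times> B" using A' B' by auto
  have "\<psi> ` (A' \<times> B') = \<psi> ` (A \<times> B) \<inter> \<Phi> -` (A' \<times> B')"
    by (rule image_eq_if_left_inverse[of "A \<times> B" \<Phi> \<psi>, OF \<Phi>(2) sub])
  moreover have "open (\<psi> ` (A \<times> B) \<inter> \<Phi> -` (A' \<times> B'))"
    using A' B' by (intro continuous_open_preimage smooth_on_imp_continuous_on[OF \<Phi>(1)] op open_Times)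
      (auto simp: open_interval_def)
  ultimately have op': "open (\<psi> ` (A' \<times> B'))" by simp
  have "smooth_on (\<psi> ` (A' \<times> B')) \<Phi>" using smooth_on_subset[OF \<Phi>(1)] sub by blast
  then have ex: "\<exists>\<Phi>. smooth_on (\<psi> ` (A' \<times> B')) \<Phi> \<and> (\<forall>x\<in>A' \<times> B'. \<Phi> (\<psi> x) = x)"
    using \<Phi>(2) sub by blast
  have sm: "smooth_on (A' \<times> B') \<psi>"
    using cc smooth_on_subset sub unfolding curvature_coordinates_def by blast
  show ?thesis
    unfolding curvature_coordinates_def
    using cc sub op' ex sm A'(1) B'(1) unfolding curvature_coordinates_def by blast
qed

lemma partials_of_product_reparametrization:
  assumes \<psi>: "\<psi> differentiable (at (\<sigma> s, \<tau> t))" and \<psi>1: "(\<lambda>(s, t). \<psi> (\<sigma> s, \<tau> t)) differentiable (at (s, t))"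
    and \<sigma>: "(\<sigma> has_real_derivative d) (at s)" and \<tau>: "(\<tau> has_real_derivative e) (at t)"
  shows "partial_s (\<lambda>(s, t). \<psi> (\<sigma> s, \<tau> t)) (s, t) = d *\<^sub>R partial_s \<psi> (\<sigma> s, \<tau> t)"
    "partial_t (\<lambda>(s, t). \<psi> (\<sigma> s, \<tau> t)) (s, t) = e *\<^sub>R partial_t \<psi> (\<sigma> s, \<tau> t)"
proof -
  have "((\<lambda>s. \<psi> (\<sigma> s, \<tau> t)) has_vector_derivative d *\<^sub>R partial_s \<psi> (\<sigma> s, \<tau> t)) (at s)"
    using vector_diff_chain_at[OF \<sigma>[unfolded has_real_derivative_iff_has_vector_derivative] has_vector_derivative_partial_s[OF \<psi>]]
    by (simp add: o_def)
  then show "partial_s (\<lambda>(s, t). \<psi> (\<sigma> s, \<tau> t)) (s, t) = d *\<^sub>R partial_s \<psi> (\<sigma> s, \<tau> t)"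
    by (intro partial_s_eqI[OF \<psi>1]) simp
  have "((\<lambda>t. \<psi> (\<sigma> s, \<tau> t)) has_vector_derivative e *\<^sub>R partial_t \<psi> (\<sigma> s, \<tau> t)) (at t)"
    using vector_diff_chain_at[OF \<tau>[unfolded has_real_derivative_iff_has_vector_derivative] has_vector_derivative_partial_t[OF \<psi>]]
    by (simp add: o_def)
  then show "partial_t (\<lambda>(s, t). \<psi> (\<sigma> s, \<tau> t)) (s, t) = e *\<^sub>R partial_t \<psi> (\<sigma> s, \<tau> t)"
    by (intro partial_t_eqI[OF \<psi>1]) simp
qed

lemma curvature_line_field_scaleR:
  assumes "curvature_line_field U g L" "q \<in> U" "v \<in> L q"
  shows "r *\<^sub>R v \<in> L q"
proof -
  obtain X where "L q = span {X}" using assms(1,2) unfolding curvature_line_field_def by blast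
  then show ?thesis using assms(3) by (simp add: span_scale)
qed

text \<open>Changing s and t separately rescales each partial derivative, which affects neither
  tangency to the lines of \<open>L\<close> nor orthogonality.\<close>

lemma curvature_coordinates_reparametrize:
  assumes g: "immersed_surface U g" and L: "curvature_line_field U g L"
    and cc: "curvature_coordinates U g L A B \<psi>"
    and A': "open_interval A'" "\<sigma> ` A' = A" "smooth_on A' \<sigma>" "smooth_on A \<sigma>'" "\<And>s. s \<in> A' \<Longrightarrow> \<sigma>' (\<sigma> s) = s"
    and B': "open_interval B'" "\<tau> ` B' = B" "smooth_on B' \<tau>" "smooth_on B \<tau>'" "\<And>t. t \<in> B' \<Longrightarrow> \<tau>' (\<tau> t) = t"
  shows "curvature_coordinates U g L A' B' (\<lambda>(s, t). \<psi> (\<sigma> s, \<tau> t))"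
proof -
  define \<psi>1 where "\<psi>1 = (\<lambda>(s, t). \<psi> (\<sigma> s, \<tau> t))"
  obtain \<Phi> where \<Phi>: "smooth_on (\<psi> ` (A \<times> B)) \<Phi>" "\<And>x. x \<in> A \<times> B \<Longrightarrow> \<Phi> (\<psi> x) = x"
    by (rule curvature_coordinates_inverse[OF cc], rule that)
  have op: "open (\<psi> ` (A \<times> B))" and sm: "smooth_on (A \<times> B) \<psi>" and sub: "\<psi> ` (A \<times> B) \<subseteq> U"
    and ops: "open A" "open B"
    using cc by (auto simp: curvature_coordinates_def open_interval_def)
  have opA': "open A'" "open B'" using A' B' by (auto simp: open_interval_def)
  have opAB: "open (A \<times> B)" "open (A' \<times> B')" using ops opA' by (auto intro: open_Times)
  let ?m = "\<lambda>x. (\<sigma> (fst x), \<tau> (snd x))"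
  have m: "?m ` (A' \<times> B') = A \<times> B"
  proof -
    have "?m ` (A' \<times> B') = (\<sigma> ` A') \<times> (\<tau> ` B')" by force
    then show ?thesis using A' B' by simp
  qed
  have \<psi>1: "\<psi>1 = (\<lambda>x. \<psi> (?m x))" by (simp add: \<psi>1_def fun_eq_iff)
  have im: "\<psi>1 ` (A' \<times> B') = \<psi> ` (A \<times> B)" unfolding \<psi>1 using m by (metis image_image)
  have smm: "smooth_on (A' \<times> B') ?m"
    by (intro smooth_on_Pair smooth_on_compose[OF opAB(2) opA'(1) _ A'(3) smooth_on_fst[OF opAB(2) smooth_on_ident[OF opAB(2)]]]
      smooth_on_compose[OF opAB(2) opA'(2) _ B'(3) smooth_on_snd[OF opAB(2) smooth_on_ident[OF opAB(2)]]] opAB) auto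
  have sm1: "smooth_on (A' \<times> B') \<psi>1"
    unfolding \<psi>1 by (rule smooth_on_compose[OF opAB(2,1) _ sm smm]) (simp add: m)
  let ?\<Phi> = "\<lambda>q. (\<sigma>' (fst (\<Phi> q)), \<tau>' (snd (\<Phi> q)))"
  have \<Phi>im: "\<Phi> ` \<psi> ` (A \<times> B) \<subseteq> A \<times> B" 
  proof
    fix y assume "y \<in> \<Phi> ` \<psi> ` (A \<times> B)"
    then obtain x where x: "x \<in> A \<times> B" "y = \<Phi> (\<psi> x)" by blast
    then show "y \<in> A \<times> B" unfolding x(2) \<Phi>(2)[OF x(1)] by blast
  qed
  have sm\<Phi>: "smooth_on (\<psi> ` (A \<times> B)) ?\<Phi>"
    by (intro smooth_on_Pair smooth_on_compose[OF op ops(1) _ A'(4) smooth_on_fst[OF op \<Phi>(1)]]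
      smooth_on_compose[OF op ops(2) _ B'(4) smooth_on_snd[OF op \<Phi>(1)]] op) (use \<Phi>im in force)+
  have inv: "?\<Phi> (\<psi>1 x) = x" if "x \<in> A' \<times> B'" for x
  proof -
    have "?m x \<in> A \<times> B" using m that by blast
    then show ?thesis using \<Phi>(2) A'(5) B'(5) that by (auto simp: \<psi>1)
  qed
  show ?thesis
    unfolding curvature_coordinates_def \<psi>1_def[symmetric]
  proof (intro conjI ballI)
    show "open_interval A'" "open_interval B'" "smooth_on (A' \<times> B') \<psi>1" by fact+
    show "open (\<psi>1 ` (A' \<times> B'))" "\<psi>1 ` (A' \<times> B') \<subseteq> U" using op sub by (simp_all add: im)
    show "\<exists>\<Phi>. smooth_on (\<psi>1 ` (A' \<times> B')) \<Phi> \<and> (\<forall>x\<in>A' \<times> B'. \<Phi> (\<psi>1 x) = x)"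
      using sm\<Phi> inv unfolding im by blast
    fix x assume x: "x \<in> A' \<times> B'"
    obtain s t where st: "x = (s, t)" by (cases x)
    have mx: "(\<sigma> s, \<tau> t) \<in> A \<times> B" using m x st by force
    have s: "s \<in> A'" and t: "t \<in> B'" using x st by auto
    note part = partials_of_product_reparametrization[OF smooth_on_imp_differentiable[OF sm mx]
        smooth_on_imp_differentiable[OF sm1 x, unfolded st \<psi>1_def]
        smooth_on_has_real_derivative[OF A'(3) s] smooth_on_has_real_derivative[OF B'(3) t], folded \<psi>1_def st]
    have \<psi>1x: "\<psi>1 x = \<psi> (\<sigma> s, \<tau> t)" by (simp add: \<psi>1_def st)
    have q: "\<psi>1 x \<in> U" using im sub x by blast
    interpret q: surface_at U g "\<psi>1 x" using g q by unfold_locales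
    have cx: "partial_t \<psi> (\<sigma> s, \<tau> t) \<in> L (\<psi>1 x)"
      "q.D (partial_s \<psi> (\<sigma> s, \<tau> t)) \<bullet> q.D (partial_t \<psi> (\<sigma> s, \<tau> t)) = 0"
      using cc mx unfolding curvature_coordinates_def \<psi>1x by blast+
    show "partial_t \<psi>1 x \<in> L (\<psi>1 x)"
      unfolding part by (rule curvature_line_field_scaleR[OF L q cx(1)])
    show "q.D (partial_s \<psi>1 x) \<bullet> q.D (partial_t \<psi>1 x) = 0"
      unfolding part using cx(2) by (simp add: linear_cmul[OF q.linear_D])
  qed
qed

section \<open>The surface in curvature line coordinates\<close>

locale curvature_patch =
  fixes U and g :: "real \<times> real \<Rightarrow> 'a::euclidean_space" and L A B \<psi>
  assumes g: "immersed_surface U g" and L: "curvature_line_field U g L"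
    and cc: "curvature_coordinates U g L A B \<psi>"
begin

lemma A: "open A" "is_interval A" and B: "open B" "is_interval B" and oi: "open_interval A" "open_interval B"
  and sm\<psi>: "smooth_on (A \<times> B) \<psi>" and \<psi>U: "x \<in> A \<times> B \<Longrightarrow> \<psi> x \<in> U"
  and \<psi>L: "x \<in> A \<times> B \<Longrightarrow> partial_t \<psi> x \<in> L (\<psi> x)"
  and op_image: "open (\<psi> ` (A \<times> B))" and image_sub: "\<psi> ` (A \<times> B) \<subseteq> U"
  using cc by (auto simp: curvature_coordinates_def open_interval_def)

lemma opAB: "open (A \<times> B)" using A B by (intro open_Times)

lemma at: "x \<in> A \<times> B \<Longrightarrow> surface_at U g (\<psi> x)"
  using g \<psi>U by unfold_locales

lemma smg: "smooth_on U g" and opU: "open U"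
  using g by (auto simp: immersed_surface_def)

lemma inj_\<psi>: "x \<in> A \<times> B \<Longrightarrow> inj (frechet_derivative \<psi> (at x))"
proof -
  assume x: "x \<in> A \<times> B"
  obtain \<Phi> where \<Phi>: "smooth_on (\<psi> ` (A \<times> B)) \<Phi>" "\<And>x. x \<in> A \<times> B \<Longrightarrow> \<Phi> (\<psi> x) = x"
    by (rule curvature_coordinates_inverse[OF cc], rule that)
  have q: "\<psi> x \<in> \<psi> ` (A \<times> B)" using x by blast
  have "((\<lambda>x. \<Phi> (\<psi> x)) has_derivative (\<lambda>v. frechet_derivative \<Phi> (at (\<psi> x)) (frechet_derivative \<psi> (at x) v))) (at x)"
    by (rule has_derivative_compose[OF smooth_on_has_derivative[OF sm\<psi> x] smooth_on_has_derivative[OF \<Phi>(1) q]])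
  then have "((\<lambda>x. x) has_derivative (\<lambda>v. frechet_derivative \<Phi> (at (\<psi> x)) (frechet_derivative \<psi> (at x) v))) (at x)"
    using has_derivative_cong_open[OF opAB x, of "\<lambda>x. \<Phi> (\<psi> x)" "\<lambda>x. x"] \<Phi>(2) by simp
  then have "(\<lambda>v. frechet_derivative \<Phi> (at (\<psi> x)) (frechet_derivative \<psi> (at x) v)) = (\<lambda>v. v)"
    by (rule has_derivative_unique[OF _ has_derivative_ident])
  then have id: "frechet_derivative \<Phi> (at (\<psi> x)) (frechet_derivative \<psi> (at x) v) = v" for v by (rule fun_cong)
  show ?thesis by (rule inj_on_inverseI[of _ "frechet_derivative \<Phi> (at (\<psi> x))"]) (rule id)
qed

lemma partial_\<psi>_nonzero:
  assumes "x \<in> A \<times> B"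
  shows "partial_s \<psi> x \<noteq> 0" "partial_t \<psi> x \<noteq> 0"
proof -
  have lin: "linear (frechet_derivative \<psi> (at x))"
    by (rule linear_frechet_derivative[OF smooth_on_imp_differentiable[OF sm\<psi> assms]])
  have "v = 0" if "frechet_derivative \<psi> (at x) v = 0" for v
    using inj_\<psi>[OF assms] that unfolding linear_injective_0[OF lin] by blast
  from this[of "(1, 0)"] this[of "(0, 1)"] show "partial_s \<psi> x \<noteq> 0" "partial_t \<psi> x \<noteq> 0"
    unfolding partial_s_def partial_t_def by (auto simp: zero_prod_def)
qed

definition w :: "real \<times> real \<Rightarrow> 'a" where "w x = g (\<psi> x)"

lemma smw: "smooth_on (A \<times> B) w"
  unfolding w_def[abs_def] by (rule smooth_on_compose[OF opAB opU _ smg sm\<psi>]) (rule image_sub)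

lemma dw: "x \<in> A \<times> B \<Longrightarrow> w differentiable (at x)"
  by (rule smooth_on_imp_differentiable[OF smw])

lemma Dw:
  assumes x: "x \<in> A \<times> B"
  shows "frechet_derivative w (at x) v = frechet_derivative g (at (\<psi> x)) (frechet_derivative \<psi> (at x) v)"
proof -
  have "(w has_derivative (\<lambda>v. frechet_derivative g (at (\<psi> x)) (frechet_derivative \<psi> (at x) v))) (at x)"
    unfolding w_def[abs_def]
    by (rule has_derivative_compose[OF smooth_on_has_derivative[OF sm\<psi> x] smooth_on_has_derivative[OF smg \<psi>U[OF x]]])
  from fun_cong[OF frechet_derivative_at[OF this], of v] show ?thesis by simp
qed

lemma inj_Dw: 
  assumes x: "x \<in> A \<times> B"
  shows "inj (frechet_derivative w (at x))"
proof -
  have "frechet_derivative w (at x) = frechet_derivative g (at (\<psi> x)) \<circ> frechet_derivative \<psi> (at x)"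
    using Dw[OF x] by (simp add: fun_eq_iff)
  then show ?thesis using inj_compose[OF surface_at.inj_D[OF at[OF x]] inj_\<psi>[OF x]] by simp
qed

lemma partial_w:
  assumes "x \<in> A \<times> B"
  shows "partial_s w x = frechet_derivative g (at (\<psi> x)) (partial_s \<psi> x)"
    "partial_t w x = frechet_derivative g (at (\<psi> x)) (partial_t \<psi> x)"
  unfolding partial_s_def partial_t_def using Dw[OF assms] by auto

lemma partial_w_nonzero:
  assumes "x \<in> A \<times> B"
  shows "partial_s w x \<noteq> 0" "partial_t w x \<noteq> 0"
  unfolding partial_w[OF assms] surface_at.D_eq_0_iff[OF at[OF assms]] using partial_\<psi>_nonzero[OF assms] by auto

lemma w_orthogonal: "x \<in> A \<times> B \<Longrightarrow> partial_s w x \<bullet> partial_t w x = 0"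
  using cc partial_w by (auto simp: curvature_coordinates_def)

lemma partial_w_tangent:
  assumes "x \<in> A \<times> B"
  shows "partial_s w x \<in> tangent_plane g (\<psi> x)" "partial_t w x \<in> tangent_plane g (\<psi> x)"
  unfolding partial_w[OF assms] by (rule surface_at.D_in_tangent_plane[OF at[OF assms]])+

lemma tangent_plane_span:
  assumes x: "x \<in> A \<times> B"
  shows "tangent_plane g (\<psi> x) \<subseteq> span {partial_s w x, partial_t w x}"
proof
  interpret q: surface_at U g "\<psi> x" by (rule at[OF x])
  fix y assume "y \<in> tangent_plane g (\<psi> x)"
  then obtain v where v: "y = q.D v" by (auto simp: tangent_plane_def)
  have o: "q.D (partial_s \<psi> x) \<bullet> q.D (partial_t \<psi> x) = 0" using w_orthogonal[OF x] partial_w[OF x] by simp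
  obtain a b where "v = a *\<^sub>R partial_s \<psi> x + b *\<^sub>R partial_t \<psi> x"
    by (rule q.orthogonal_directions_basis[OF o partial_\<psi>_nonzero[OF x]])
  then have "y = a *\<^sub>R partial_s w x + b *\<^sub>R partial_t w x"
    by (simp add: v partial_w[OF x] linear_add[OF q.linear_D] linear_cmul[OF q.linear_D])
  then show "y \<in> span {partial_s w x, partial_t w x}" by (simp add: span_add span_scale span_base)
qed

lemma principal_t:
  assumes x: "x \<in> A \<times> B"
  shows "principal_direction g (\<psi> x) (partial_t \<psi> x)"
proof -
  obtain X where X: "principal_direction g (\<psi> x) X" "L (\<psi> x) = span {X}"
    using L \<psi>U[OF x] unfolding curvature_line_field_def by blast
  obtain r where r: "partial_t \<psi> x = r *\<^sub>R X" using \<psi>L[OF x] X(2) by (auto simp: span_singleton)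
  then have "r \<noteq> 0" using partial_\<psi>_nonzero[OF x] by auto
  then show ?thesis unfolding r using surface_at.principal_direction_scaleR[OF at[OF x] X(1)] by blast
qed

text \<open>By the chain rule this differs by a tangent vector from the second derivative of
  \<open>g\<close> in the directions of the two partials of \<psi>. The normal part of the latter is
  II of a principal direction with an orthogonal one, which is 0.\<close>

lemma mixed_tangent:
  assumes x: "x \<in> A \<times> B"
  shows "partial_t (partial_s w) x \<in> tangent_plane g (\<psi> x)"
proof -
  interpret q: surface_at U g "\<psi> x" by (rule at[OF x])
  have q: "\<psi> x \<in> U" by (rule \<psi>U[OF x])
  have smps: "smooth_on (A \<times> B) (partial_s \<psi>)" by (rule smooth_on_partial_s[OF sm\<psi>])
  have smgs: "smooth_on U (partial_s g)" "smooth_on U (partial_t g)"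
    by (intro smooth_on_partial_s smooth_on_partial_t smg)+
  let ?f = "\<lambda>y. fst (partial_s \<psi> y) *\<^sub>R partial_s g (\<psi> y) + snd (partial_s \<psi> y) *\<^sub>R partial_t g (\<psi> y)"
  have "partial_s w y = ?f y" if "y \<in> A \<times> B" for y
    unfolding partial_w[OF that] by (rule surface_at.D_eq[OF at[OF that]])
  then have "frechet_derivative (partial_s w) (at x) = frechet_derivative ?f (at x)"
    by (rule frechet_derivative_cong[OF opAB x])
  moreover note dps = smooth_on_has_derivative[OF smps x]
  note dgs = has_derivative_compose[OF smooth_on_has_derivative[OF sm\<psi> x] smooth_on_has_derivative[OF smgs(1) q]]
  note dgt = has_derivative_compose[OF smooth_on_has_derivative[OF sm\<psi> x] smooth_on_has_derivative[OF smgs(2) q]]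
  have "(?f has_derivative (\<lambda>v.
      (fst (partial_s \<psi> x) *\<^sub>R frechet_derivative (partial_s g) (at (\<psi> x)) (frechet_derivative \<psi> (at x) v)
        + fst (frechet_derivative (partial_s \<psi>) (at x) v) *\<^sub>R partial_s g (\<psi> x))
      + (snd (partial_s \<psi> x) *\<^sub>R frechet_derivative (partial_t g) (at (\<psi> x)) (frechet_derivative \<psi> (at x) v)
        + snd (frechet_derivative (partial_s \<psi>) (at x) v) *\<^sub>R partial_t g (\<psi> x)))) (at x)"
    by (intro has_derivative_add has_derivative_scaleR has_derivative_fst has_derivative_snd dps dgs dgt)
  from fun_cong[OF frechet_derivative_at[OF this], of "(0, 1)"]
  have "frechet_derivative ?f (at x) (0, 1) =
      (fst (partial_s \<psi> x) *\<^sub>R frechet_derivative (partial_s g) (at (\<psi> x)) (partial_t \<psi> x)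
        + fst (partial_t (partial_s \<psi>) x) *\<^sub>R partial_s g (\<psi> x))
      + (snd (partial_s \<psi> x) *\<^sub>R frechet_derivative (partial_t g) (at (\<psi> x)) (partial_t \<psi> x)
        + snd (partial_t (partial_s \<psi>) x) *\<^sub>R partial_t g (\<psi> x))"
    unfolding partial_t_def[of \<psi>] partial_t_def[of "partial_s \<psi>"] by (rule sym)
  then have "frechet_derivative ?f (at x) (0, 1) = 
      (fst (partial_s \<psi> x) *\<^sub>R frechet_derivative (partial_s g) (at (\<psi> x)) (partial_t \<psi> x)
        + snd (partial_s \<psi> x) *\<^sub>R frechet_derivative (partial_t g) (at (\<psi> x)) (partial_t \<psi> x))
      + q.D (partial_t (partial_s \<psi>) x)"
    unfolding q.D_eq by (simp only: add_ac)
  moreover have "fst (partial_s \<psi> x) *\<^sub>R frechet_derivative (partial_s g) (at (\<psi> x)) (partial_t \<psi> x)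
        + snd (partial_s \<psi> x) *\<^sub>R frechet_derivative (partial_t g) (at (\<psi> x)) (partial_t \<psi> x)
      = frechet_derivative (\<lambda>q. frechet_derivative g (at q) (partial_s \<psi> x)) (at (\<psi> x)) (partial_t \<psi> x)" (is "_ = ?H")
    unfolding q.second_derivative_eq
      frechet_derivative_eq_partials[OF smooth_on_imp_differentiable[OF smgs(1) q]]
      frechet_derivative_eq_partials[OF smooth_on_imp_differentiable[OF smgs(2) q]]
      partial_commute[OF opU smg q, symmetric]
    by (simp add: algebra_simps)
  ultimately have eq: "partial_t (partial_s w) x = ?H + q.D (partial_t (partial_s \<psi>) x)"
    by (simp add: partial_t_def[of "partial_s w"])
  have "q.D (partial_t \<psi> x) \<bullet> q.D (partial_s \<psi> x) = 0"
    using w_orthogonal[OF x] partial_w[OF x] by (simp add: inner_commute)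
  then have "q.II (partial_t \<psi> x) (partial_s \<psi> x) = 0"
    using principal_t[OF x] q.principal_direction_iff by blast
  then have "?H \<in> tangent_plane g (\<psi> x)"
    unfolding second_fundamental_form_def q.normal_part_eq_0_iff .
  then show ?thesis unfolding eq by (rule subspace_add[OF q.subspace_tangent_plane _ q.D_in_tangent_plane])
qed

lemma slice_t: "(s, t) \<in> A \<times> B \<Longrightarrow> ((\<lambda>t. \<psi> (s, t)) has_vector_derivative partial_t \<psi> (s, t)) (at t)"
  by (rule has_vector_derivative_partial_t[OF smooth_on_imp_differentiable[OF sm\<psi>]])

lemma t_curve_in_family:
  assumes s: "s \<in> A"
  shows "line_of_family U g L B (\<lambda>t. \<psi> (s, t))"
proof -
  have vel: "velocity (\<lambda>t. \<psi> (s, t)) t = partial_t \<psi> (s, t)" if "t \<in> B" for t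
    by (rule vector_derivative_at[OF slice_t]) (use s that in simp)
  have "smooth_on B (\<lambda>t. \<psi> (s, t))"
    by (rule smooth_on_compose[OF B(1) opAB _ sm\<psi>]) (use s in \<open>auto intro!: smooth_on_Pair smooth_on_const smooth_on_ident B\<close>)
  then show ?thesis
    unfolding line_of_family_def line_of_curvature_def
    using oi s vel principal_t \<psi>L image_sub by auto
qed

definition E :: "real \<times> real \<Rightarrow> real" where "E x = norm (partial_s w x)"
definition X :: "real \<times> real \<Rightarrow> 'a" where "X x = inverse (E x) *\<^sub>R partial_s w x"
text \<open>The signed geodesic curvature of the t-curve, with the sign for which X_t = -\<nu> w_t.
  Defining it by projection makes its smoothness evident before that equation is known.\<close>

definition \<nu> :: "real \<times> real \<Rightarrow> real" where "\<nu> x = - (partial_t X x \<bullet> partial_t w x) / (partial_t w x \<bullet> partial_t w x)"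

lemma E_pos: "x \<in> A \<times> B \<Longrightarrow> E x > 0" using partial_w_nonzero by (simp add: E_def)

lemma smE: "smooth_on (A \<times> B) E"
  unfolding E_def[abs_def] by (intro smooth_on_norm opAB smooth_on_partial_s smw partial_w_nonzero)

lemma smX: "smooth_on (A \<times> B) X"
  unfolding X_def[abs_def] by (intro smooth_on_scaleR smooth_on_inverse opAB smooth_on_partial_s smw smE) (use E_pos in force)

lemma sm\<nu>: "smooth_on (A \<times> B) \<nu>"
  unfolding \<nu>_def[abs_def]
  by (intro smooth_on_divide smooth_on_minus smooth_on_inner opAB smooth_on_partial_t smw smX)
    (use partial_w_nonzero(2) in simp)

lemma w_s_eq: "x \<in> A \<times> B \<Longrightarrow> partial_s w x = E x *\<^sub>R X x"
  using E_pos[of x] by (simp add: X_def)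

lemma X_unit: "x \<in> A \<times> B \<Longrightarrow> X x \<bullet> X x = 1"
  using partial_w_nonzero(1)[of x] by (simp add: X_def E_def dot_square_norm power2_eq_square)

lemma X_w_t: "x \<in> A \<times> B \<Longrightarrow> X x \<bullet> partial_t w x = 0"
  using w_orthogonal by (simp add: X_def)

lemma X_tangent: "x \<in> A \<times> B \<Longrightarrow> X x \<in> tangent_plane g (\<psi> x)"
  unfolding X_def using subspace_scale[OF surface_at.subspace_tangent_plane[OF at]] partial_w_tangent by blast

lemma X_slice: "(s, t) \<in> A \<times> B \<Longrightarrow> ((\<lambda>t. X (s, t)) has_vector_derivative partial_t X (s, t)) (at t)"
  by (rule has_vector_derivative_partial_t[OF smooth_on_imp_differentiable[OF smX]])

lemma w_slice: "(s, t) \<in> A \<times> B \<Longrightarrow> ((\<lambda>t. w (s, t)) has_vector_derivative partial_t w (s, t)) (at t)"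
  by (rule has_vector_derivative_partial_t[OF dw])

lemma w_slice_s: "(s, t) \<in> A \<times> B \<Longrightarrow> ((\<lambda>s. w (s, t)) has_vector_derivative partial_s w (s, t)) (at s)"
  by (rule has_vector_derivative_partial_s[OF dw])

text \<open>X is a multiple of w_s, so by \<open>mixed_tangent\<close> its t-derivative is tangent.
  Being a unit field, it has no derivative along itself, and only the direction of w_t
  remains.\<close>

lemma X_t:
  assumes x: "x \<in> A \<times> B"
  shows "partial_t X x = - \<nu> x *\<^sub>R partial_t w x"
proof -
  interpret q: surface_at U g "\<psi> x" by (rule at[OF x])
  obtain s t where st: "x = (s, t)" by (cases x)
  have xs: "(s, t) \<in> A \<times> B" and tB: "t \<in> B" using x st by auto
  have smE': "smooth_on (A \<times> B) (\<lambda>x. inverse (E x))"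
    by (intro smooth_on_inverse opAB smE) (use E_pos in force)
  obtain r where r: "((\<lambda>t. inverse (E (s, t))) has_real_derivative r) (at t)"
    using has_vector_derivative_partial_t[OF smooth_on_imp_differentiable[OF smE' xs]]
    unfolding has_real_derivative_iff_has_vector_derivative[symmetric] by blast
  have "((\<lambda>t. partial_s w (s, t)) has_vector_derivative partial_t (partial_s w) (s, t)) (at t)"
    by (rule has_vector_derivative_partial_t[OF smooth_on_imp_differentiable[OF smooth_on_partial_s[OF smw] xs]])
  from has_vector_derivative_scaleR[OF r this]
  have "partial_t X (s, t) = inverse (E (s, t)) *\<^sub>R partial_t (partial_s w) (s, t) + r *\<^sub>R partial_s w (s, t)"
    unfolding X_def[symmetric] by (rule partial_t_eqI[OF smooth_on_imp_differentiable[OF smX xs]])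
  then have "partial_t X x \<in> tangent_plane g (\<psi> x)"
    unfolding st using mixed_tangent[OF x] partial_w_tangent(1)[OF x] unfolding st
    by (simp only:) (intro subspace_add[OF q.subspace_tangent_plane, unfolded st] subspace_scale[OF q.subspace_tangent_plane, unfolded st])
  then have "partial_t X x \<in> span {partial_s w x, partial_t w x}" using tangent_plane_span[OF x] by blast
  then obtain a where "partial_t X x - a *\<^sub>R partial_s w x \<in> span {partial_t w x}"
    by (auto simp: span_breakdown_eq[of _ "partial_s w x"])
  then obtain b where b: "partial_t X x - a *\<^sub>R partial_s w x = b *\<^sub>R partial_t w x" by (auto simp: span_singleton)
  then have ab: "partial_t X x = a *\<^sub>R partial_s w x + b *\<^sub>R partial_t w x" by (simp add: algebra_simps)
  have "X x \<bullet> partial_t X x = 0"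
  proof -
    have "((\<lambda>t. X (s, t) \<bullet> X (s, t)) has_vector_derivative X (s, t) \<bullet> partial_t X (s, t) + partial_t X (s, t) \<bullet> X (s, t)) (at t)"
      by (rule bounded_bilinear.has_vector_derivative[OF bounded_bilinear_inner X_slice[OF xs] X_slice[OF xs]])
    moreover have "((\<lambda>t. X (s, t) \<bullet> X (s, t)) has_vector_derivative 0) (at t)"
      by (rule has_vector_derivative_transform_within_open[OF has_vector_derivative_const[of 1] B(1) tB])
        (use X_unit x st in auto)
    ultimately have "X (s, t) \<bullet> partial_t X (s, t) + partial_t X (s, t) \<bullet> X (s, t) = 0"
      by (rule vector_derivative_unique_at)
    then show ?thesis by (simp add: st inner_commute)
  qed
  moreover have "X x \<bullet> partial_t X x = a * E x"
    using X_w_t[OF x] X_unit[OF x] by (simp add: ab inner_add_right w_s_eq[OF x])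
  ultimately have "a = 0" using E_pos[OF x] by simp
  then have "partial_t X x = b *\<^sub>R partial_t w x" using ab by simp
  then show ?thesis using partial_w_nonzero(2)[OF x] by (simp add: \<nu>_def)
qed

lemma geodesic_curvature_t_curve:
  assumes st: "(s, t) \<in> A \<times> B"
  shows "geodesic_curvature g (\<lambda>t. \<psi> (s, t)) t = \<bar>\<nu> (s, t)\<bar>"
proof -
  have "geodesic_curvature g (\<lambda>t. \<psi> (s, t)) t = \<bar>- \<nu> (s, t)\<bar>"
  proof (rule geodesic_curvature_eq[where K = B and X = "\<lambda>t. X (s, t)" and W' = "\<lambda>t. partial_t w (s, t)" and U = U])
    show "surface_at U g (\<psi> (s, t))" by (rule at[OF st])
    show "open B" "t \<in> B" using B st by auto
    show "((\<lambda>\<tau>. g (\<psi> (s, \<tau>))) has_vector_derivative partial_t w (s, \<tau>)) (at \<tau>)" if "\<tau> \<in> B" for \<tau>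
      using w_slice[of s \<tau>] st that by (simp add: w_def)
    show "(\<lambda>t. partial_t w (s, t)) differentiable (at t)"
      using has_vector_derivative_partial_t[OF smooth_on_imp_differentiable[OF smooth_on_partial_t[OF smw] st]]
      by (rule differentiableI_vector)
    show "partial_t w (s, t) \<noteq> 0" by (rule partial_w_nonzero[OF st])
    show "partial_t w (s, t) \<in> tangent_plane g (\<psi> (s, t))" by (rule partial_w_tangent[OF st])
    show "X (s, \<tau>) \<bullet> partial_t w (s, \<tau>) = 0" if "\<tau> \<in> B" for \<tau> by (rule X_w_t) (use that st in auto)
    show "X (s, t) \<bullet> X (s, t) = 1" by (rule X_unit[OF st])
    show "X (s, t) \<in> tangent_plane g (\<psi> (s, t))" by (rule X_tangent[OF st])
    show "((\<lambda>t. X (s, t)) has_vector_derivative - \<nu> (s, t) *\<^sub>R partial_t w (s, t)) (at t)"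
      using X_slice[OF st] X_t[OF st] by simp
    have "partial_s w (s, t) \<in> span {X (s, t), partial_t w (s, t)}"
      unfolding w_s_eq[OF st] by (intro span_scale span_base) simp
    moreover have "partial_t w (s, t) \<in> span {X (s, t), partial_t w (s, t)}" by (intro span_base) simp
    ultimately have "span {partial_s w (s, t), partial_t w (s, t)} \<subseteq> span {X (s, t), partial_t w (s, t)}"
      by (intro span_minimal) auto
    then show "tangent_plane g (\<psi> (s, t)) \<subseteq> span {X (s, t), partial_t w (s, t)}"
      using tangent_plane_span[OF st] by blast
  qed
  then show ?thesis by simp
qed

end

text \<open>A change of sign would produce the value 0 on the interval, and then the function
  vanishes throughout. It passes from the unsigned \<open>geodesic_curvature\<close> to the signed
  \<nu>.\<close>

lemma constant_if_constant_abs: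
  fixes f :: "real \<Rightarrow> real"
  assumes "is_interval S" "continuous_on S f" "\<And>x. x \<in> S \<Longrightarrow> \<bar>f x\<bar> = r" "x \<in> S" "y \<in> S"
  shows "f x = f y"
proof (rule ccontr)
  assume ne: "f x \<noteq> f y"
  have r: "\<bar>f x\<bar> = r" "\<bar>f y\<bar> = r" using assms by auto
  have "is_interval (f ` S)"
    using connected_continuous_image[OF assms(2)] assms(1) by (simp add: is_interval_connected_1)
  moreover have "(f x \<le> 0 \<and> 0 \<le> f y) \<or> (f y \<le> 0 \<and> 0 \<le> f x)" using r ne by auto
  ultimately have "0 \<in> f ` S"
    using assms(4,5) unfolding is_interval_1 by (meson imageI)
  then have "r = 0" using assms(3) by force
  then show False using r ne by simp
qed

section \<open>Recovery of the construction data\<close>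

lemma smooth_on_slices:
  assumes "open A" "open B" "smooth_on (A \<times> B) h"
  shows "t \<in> B \<Longrightarrow> smooth_on A (\<lambda>s. h (s, t))" "s \<in> A \<Longrightarrow> smooth_on B (\<lambda>t. h (s, t))"
  by (rule smooth_on_compose[OF _ open_Times[OF assms(1,2)] _ assms(3)];
      auto intro!: smooth_on_Pair smooth_on_const smooth_on_ident assms)+

lemma smooth_on_vec_lambda:
  fixes f :: "'n::finite \<Rightarrow> real \<Rightarrow> real"
  assumes "open S" "\<And>i. smooth_on S (f i)"
  shows "smooth_on S (\<lambda>t. \<chi> i. f i t)"
proof -
  have "smooth_on S (\<lambda>t. \<Sum>i\<in>UNIV. f i t *\<^sub>R axis i (1::real))"
    by (intro smooth_on_sum smooth_on_scaleR smooth_on_const assms)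
  moreover have "(\<lambda>t. \<Sum>i\<in>UNIV. f i t *\<^sub>R axis i (1::real)) = (\<lambda>t. \<chi> i. f i t)"
  proof (intro ext)
    fix t
    have "(\<Sum>i\<in>UNIV. f i t *\<^sub>R axis i (1::real)) $ j = f j t" for j
    proof -
      have "(\<Sum>i\<in>UNIV. f i t *\<^sub>R axis i (1::real)) $ j = (\<Sum>i\<in>UNIV. f i t * axis i (1::real) $ j)"
        by simp
      also have "\<dots> = (\<Sum>i\<in>UNIV. if i = j then f j t else 0)"
        by (rule sum.cong) (auto simp: axis_def)
      finally show ?thesis by simp
    qed
    then show "(\<Sum>i\<in>UNIV. f i t *\<^sub>R axis i (1::real)) = (\<chi> i. f i t)" by (simp add: vec_eq_iff)
  qed
  ultimately show ?thesis by simp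
qed

text \<open>The inversion is an immersion: if its derivative kills c', then c' is twice its own
  projection onto c, so that projection is zero and c' with it. This will show that \<alpha> can be
  parametrized by arc length.\<close>

lemma zero_derivative_of_inversion:
  fixes c :: "real \<Rightarrow> 'a::real_inner"
  assumes c: "(c has_vector_derivative c') (at x)" and nz: "c x \<noteq> 0"
    and 0: "((\<lambda>x. inverse (c x \<bullet> c x) *\<^sub>R c x) has_vector_derivative 0) (at x)"
  shows "c' = 0"
proof -
  have q: "c x \<bullet> c x \<noteq> 0" using nz by simp
  have "inverse (c x \<bullet> c x) *\<^sub>R (c' - (2 * (c' \<bullet> c x) / (c x \<bullet> c x)) *\<^sub>R c x) = 0"
    by (rule vector_derivative_unique_at[OF has_vector_derivative_inversion[OF c q] 0])
  then have eq: "c' = (2 * (c' \<bullet> c x) / (c x \<bullet> c x)) *\<^sub>R c x" using q by simp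
  then have "c' \<bullet> c x = (2 * (c' \<bullet> c x) / (c x \<bullet> c x)) * (c x \<bullet> c x)" by (metis inner_scaleR_left)
  then have "c' \<bullet> c x = 0" using q by simp
  then show ?thesis using eq by simp
qed

text \<open>The s-curve at t1 is going to be \<gamma>, so it has unit speed. The last assumption is
  what constant geodesic curvature of the t-curves gives.\<close>

locale adapted_patch = curvature_patch U g L A B \<psi>
  for U and g :: "real \<times> real \<Rightarrow> real^'m::finite" and L A B \<psi> +
  fixes t1
  assumes t1: "t1 \<in> B" and unit_base: "\<And>s. s \<in> A \<Longrightarrow> E (s, t1) = 1"
    and \<nu>_const: "\<And>s t. s \<in> A \<Longrightarrow> t \<in> B \<Longrightarrow> \<nu> (s, t) = \<nu> (s, t1)"
begin

definition \<gamma> :: "real \<Rightarrow> real^'m" where "\<gamma> s = w (s, t1)"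
definition \<ll> :: "real \<Rightarrow> real" where "\<ll> s = \<nu> (s, t1)"
definition chord :: "real \<Rightarrow> real \<Rightarrow> real^'m" where "chord s t = w (s, t) - \<gamma> s"

lemma sm_\<gamma>: "smooth_on A \<gamma>"
  unfolding \<gamma>_def[abs_def] by (rule smooth_on_slices(1)[OF A(1) B(1) smw t1])

lemma sm_\<ll>: "smooth_on A \<ll>"
  unfolding \<ll>_def[abs_def] by (rule smooth_on_slices(1)[OF A(1) B(1) sm\<nu> t1])

lemma d\<gamma>: "s \<in> A \<Longrightarrow> (\<gamma> has_vector_derivative X (s, t1)) (at s)"
  using w_slice_s[of s t1] w_s_eq[of "(s, t1)"] unit_base[of s] t1 by (simp add: \<gamma>_def[abs_def])

lemma velocity_\<gamma>: "s \<in> A \<Longrightarrow> velocity \<gamma> s = X (s, t1)"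
  by (rule vector_derivative_at[OF d\<gamma>])

lemma velocity_\<gamma>_unit: "s \<in> A \<Longrightarrow> velocity \<gamma> s \<bullet> velocity \<gamma> s = 1"
  using velocity_\<gamma> X_unit t1 by simp

lemma unit_speed: "unit_speed_curve A \<gamma>"
  unfolding unit_speed_curve_def using oi sm_\<gamma> velocity_\<gamma>_unit by (simp add: norm_eq_1)

lemma chord_slice_t: "s \<in> A \<Longrightarrow> t \<in> B \<Longrightarrow> ((\<lambda>t. chord s t) has_vector_derivative partial_t w (s, t)) (at t)"
  unfolding chord_def using has_vector_derivative_diff[OF w_slice has_vector_derivative_const, of s t "\<gamma> s"] by simp

text \<open>Along a line of curvature of the family, \<open>X + \<nu> w\<close> is constant: for \<open>\<nu> \<noteq> 0\<close> the line lies in a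
  sphere with centre \<open>(X + \<nu> w) / \<nu>\<close>, to which \<open>X\<close> is normal. This sphere passes through \<open>\<gamma> s\<close>.\<close>

lemma X_eq:
  assumes s: "s \<in> A" and t: "t \<in> B"
  shows "X (s, t) = velocity \<gamma> s - \<ll> s *\<^sub>R chord s t"
proof -
  have "X (s, t) + \<ll> s *\<^sub>R w (s, t) = X (s, t1) + \<ll> s *\<^sub>R w (s, t1)"
  proof (rule constant_on_interval[OF B(2) _ t t1])
    fix t assume t: "t \<in> B"
    have x: "(s, t) \<in> A \<times> B" using s t by simp
    have "((\<lambda>t. X (s, t) + \<ll> s *\<^sub>R w (s, t)) has_vector_derivative partial_t X (s, t) + \<ll> s *\<^sub>R partial_t w (s, t)) (at t)"
      by (intro has_vector_derivative_add X_slice[OF x] bounded_linear.has_vector_derivative[OF bounded_linear_scaleR_right] w_slice[OF x])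
    then show "((\<lambda>t. X (s, t) + \<ll> s *\<^sub>R w (s, t)) has_vector_derivative 0) (at t)"
      using \<nu>_const[OF s t] by (simp add: X_t[OF x] \<ll>_def)
  qed
  then show ?thesis by (simp add: velocity_\<gamma>[OF s] chord_def \<gamma>_def algebra_simps)
qed

text \<open>By the formula for X, the t-derivative of the difference of both sides is -2 X . w_t =
  0, and at t1 the chord is zero. It is the equation of the sphere, or hyperplane if \<ll> s = 0,
  that passes through \<gamma> s with normal \<gamma>' there.\<close>

lemma chord_eq:
  assumes s: "s \<in> A" and t: "t \<in> B"
  shows "\<ll> s * (chord s t \<bullet> chord s t) = 2 * (velocity \<gamma> s \<bullet> chord s t)"
proof -
  have "\<ll> s * (chord s t \<bullet> chord s t) - 2 * (velocity \<gamma> s \<bullet> chord s t)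
      = \<ll> s * (chord s t1 \<bullet> chord s t1) - 2 * (velocity \<gamma> s \<bullet> chord s t1)"
  proof (rule constant_on_interval[OF B(2) _ t t1])
    fix t assume t: "t \<in> B"
    note d = chord_slice_t[OF s t]
    let ?w = "partial_t w (s, t)"
    have "((\<lambda>t. \<ll> s * (chord s t \<bullet> chord s t) - 2 * (velocity \<gamma> s \<bullet> chord s t)) has_vector_derivative
        \<ll> s * (chord s t \<bullet> ?w + ?w \<bullet> chord s t) - 2 * (velocity \<gamma> s \<bullet> ?w)) (at t)"
      by (intro has_vector_derivative_diff bounded_linear.has_vector_derivative[OF bounded_linear_mult_right]
          bounded_bilinear.has_vector_derivative[OF bounded_bilinear_inner d d]
          bounded_linear.has_vector_derivative[OF bounded_linear_inner_right d])
    moreover have "\<ll> s * (chord s t \<bullet> ?w + ?w \<bullet> chord s t) - 2 * (velocity \<gamma> s \<bullet> ?w) = - 2 * (X (s, t) \<bullet> ?w)"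
      by (simp add: X_eq[OF s t] inner_diff_left inner_commute[of ?w] algebra_simps)
    ultimately show "((\<lambda>t. \<ll> s * (chord s t \<bullet> chord s t) - 2 * (velocity \<gamma> s \<bullet> chord s t)) has_vector_derivative 0) (at t)"
      using X_w_t[of "(s, t)"] s t by simp
  qed
  then show ?thesis by (simp add: chord_def \<gamma>_def)
qed

lemma chord_slice_s:
  assumes s: "s \<in> A" and t: "t \<in> B"
  shows "((\<lambda>s. chord s t) has_vector_derivative (E (s, t) - 1) *\<^sub>R velocity \<gamma> s - (E (s, t) * \<ll> s) *\<^sub>R chord s t) (at s)"
proof -
  have x: "(s, t) \<in> A \<times> B" using s t by simp
  have "((\<lambda>s. chord s t) has_vector_derivative partial_s w (s, t) - X (s, t1)) (at s)"
    unfolding chord_def by (intro has_vector_derivative_diff w_slice_s[OF x] d\<gamma>[OF s])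
  then show ?thesis
    by (rule has_vector_derivative_eq_rhs)
      (simp add: w_s_eq[OF x] X_eq[OF s t] velocity_\<gamma>[OF s, symmetric] algebra_simps)
qed

text \<open>The factor E cancels: the multiples of \<phi> P / q have coefficients -\<ll> from
  \<phi>, -e \<ll> from P and (e + 1) \<ll> from 1 / q. What remains comes from \<xi>' and the
  sphere equation and does not contain t; this is what allows a component to split into a function
  of s and one of t.\<close>

lemma inverted_chord_derivative:
  assumes s: "s \<in> A" and t: "t \<in> B" and nz: "chord s t \<noteq> 0"
    and \<xi>: "(\<xi> has_vector_derivative - \<kappa> *\<^sub>R velocity \<gamma> s) (at s)" "\<xi> s \<bullet> velocity \<gamma> s = 0"
    and \<phi>: "(\<phi> has_real_derivative - \<ll> s * \<phi> s) (at s)"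
  shows "((\<lambda>s. - 2 * \<phi> s * (chord s t \<bullet> \<xi> s) / (chord s t \<bullet> chord s t)) has_real_derivative \<phi> s * \<ll> s * \<kappa>) (at s)"
proof -
  define P where "P = (\<lambda>s. chord s t \<bullet> \<xi> s)"
  define q where "q = (\<lambda>s. chord s t \<bullet> chord s t)"
  define e where "e = E (s, t)"
  note d = chord_slice_s[OF s t, folded e_def]
  have q0: "q s \<noteq> 0" using nz by (simp add: q_def)
  have c: "2 * (chord s t \<bullet> velocity \<gamma> s) = \<ll> s * q s"
    using chord_eq[OF s t] by (simp add: q_def inner_commute)
  have "(P has_vector_derivative chord s t \<bullet> (- \<kappa> *\<^sub>R velocity \<gamma> s)
      + ((e - 1) *\<^sub>R velocity \<gamma> s - (e * \<ll> s) *\<^sub>R chord s t) \<bullet> \<xi> s) (at s)"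
    unfolding P_def by (rule bounded_bilinear.has_vector_derivative[OF bounded_bilinear_inner d \<xi>(1)])
  moreover have "chord s t \<bullet> (- \<kappa> *\<^sub>R velocity \<gamma> s) + ((e - 1) *\<^sub>R velocity \<gamma> s - (e * \<ll> s) *\<^sub>R chord s t) \<bullet> \<xi> s
      = - \<kappa> * \<ll> s * q s / 2 - e * \<ll> s * P s"
    using \<xi>(2) c by (simp add: P_def inner_diff_left inner_commute[of "velocity \<gamma> s" "\<xi> s"] algebra_simps)
  ultimately have dP: "(P has_real_derivative - \<kappa> * \<ll> s * q s / 2 - e * \<ll> s * P s) (at s)"
    by (simp add: has_real_derivative_iff_has_vector_derivative)
  have "(q has_vector_derivative chord s t \<bullet> ((e - 1) *\<^sub>R velocity \<gamma> s - (e * \<ll> s) *\<^sub>R chord s t)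
      + ((e - 1) *\<^sub>R velocity \<gamma> s - (e * \<ll> s) *\<^sub>R chord s t) \<bullet> chord s t) (at s)"
    unfolding q_def by (rule bounded_bilinear.has_vector_derivative[OF bounded_bilinear_inner d d])
  moreover have "chord s t \<bullet> ((e - 1) *\<^sub>R velocity \<gamma> s - (e * \<ll> s) *\<^sub>R chord s t)
      + ((e - 1) *\<^sub>R velocity \<gamma> s - (e * \<ll> s) *\<^sub>R chord s t) \<bullet> chord s t
      = (e - 1) * (2 * (chord s t \<bullet> velocity \<gamma> s)) - 2 * e * \<ll> s * q s"
    by (simp add: q_def inner_diff_left inner_diff_right inner_commute[of "velocity \<gamma> s" "chord s t"] algebra_simps)
  ultimately have "(q has_vector_derivative (e - 1) * (\<ll> s * q s) - 2 * e * \<ll> s * q s) (at s)"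
    unfolding c by (simp only:)
  moreover have "(e - 1) * (\<ll> s * q s) - 2 * e * \<ll> s * q s = - (e + 1) * \<ll> s * q s" by (simp add: algebra_simps)
  ultimately have dq: "(q has_real_derivative - (e + 1) * \<ll> s * q s) (at s)"
    unfolding has_real_derivative_iff_has_vector_derivative by (simp only:)
  let ?d = "(- 2 * \<phi> s) * (- \<kappa> * \<ll> s * q s / 2 - e * \<ll> s * P s) + (- 2 * (- \<ll> s * \<phi> s)) * P s"
  have "((\<lambda>s. - 2 * \<phi> s * P s) has_real_derivative ?d) (at s)"
    by (rule DERIV_cong[OF DERIV_mult[OF DERIV_cmult[OF \<phi>, of "- 2"] dP]]) simp
  from DERIV_divide[OF this dq q0]
  have "((\<lambda>s. - 2 * \<phi> s * P s / q s) has_real_derivative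
      (?d * q s - (- 2 * \<phi> s * P s) * (- (e + 1) * \<ll> s * q s)) / (q s * q s)) (at s)" .
  moreover have "?d * q s - (- 2 * \<phi> s * P s) * (- (e + 1) * \<ll> s * q s) = (\<phi> s * \<ll> s * \<kappa>) * (q s * q s)"
    by (simp add: algebra_simps)
  ultimately have "((\<lambda>s. - 2 * \<phi> s * P s / q s) has_real_derivative \<phi> s * \<ll> s * \<kappa>) (at s)"
    using q0 by simp
  then show ?thesis by (simp add: P_def q_def)
qed

lemma open_chord_nonzero: "open {x \<in> A \<times> B. chord (fst x) (snd x) \<noteq> 0}"
proof -
  have "smooth_on (A \<times> B) (\<lambda>x. w x - \<gamma> (fst x))"
    by (intro smooth_on_diff smw opAB smooth_on_compose[OF opAB A(1) _ sm_\<gamma> smooth_on_fst[OF opAB smooth_on_ident[OF opAB]]]) auto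
  from continuous_open_preimage[OF smooth_on_imp_continuous_on[OF this] opAB, of "- {0}"]
  have "open (A \<times> B \<inter> (\<lambda>x. w x - \<gamma> (fst x)) -` (- {0}))" by (simp add: open_Compl)
  moreover have "A \<times> B \<inter> (\<lambda>x. w x - \<gamma> (fst x)) -` (- {0}) = {x \<in> A \<times> B. chord (fst x) (snd x) \<noteq> 0}"
    by (auto simp: chord_def)
  ultimately show ?thesis by simp
qed

text \<open>The chord can be inverted only where it is nonzero. This holds on a rectangle around the
  point, which is shrunk further so that the parallel frame exists over it.\<close>

lemma construction_exists:
  fixes s0 t0
  assumes dim: "CARD('m) = CARD('n::finite) + 1"
    and s0: "s0 \<in> A" and t0: "t0 \<in> B" and nz0: "chord s0 t0 \<noteq> 0"
  shows "\<exists>I J (\<gamma> :: real \<Rightarrow> real^'m) (\<xi> :: 'n::finite \<Rightarrow> real \<Rightarrow> real^'m) k \<phi> \<beta> \<alpha> V \<psi>'.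
             construction_data I J \<gamma> \<xi> k \<phi> \<beta> \<alpha> \<and>
             I \<times> J = regular_points I J \<gamma> \<xi> \<phi> \<beta> \<alpha> \<and>
             \<psi> (s0, t0) \<in> V \<and> V \<subseteq> U \<and>
             diffeomorphism_between (I \<times> J) V \<psi>' \<and>
             (\<forall>x\<in>I \<times> J. g (\<psi>' x) = construction_map \<gamma> \<xi> \<phi> \<beta> \<alpha> x) \<and>
             (\<forall>s\<in>I. line_of_family U g L J (\<lambda>t. \<psi>' (s, t)))"
proof -
  obtain \<delta> and \<xi> :: "'n::finite \<Rightarrow> real \<Rightarrow> real^'m" where \<delta>: "\<delta> > 0" "{s0-\<delta><..<s0+\<delta>} \<subseteq> A"
    and frame: "parallel_orthonormal_frame {s0-\<delta><..<s0+\<delta>} \<gamma> \<xi>"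
    and d\<xi>': "\<And>s i. s \<in> {s0-\<delta><..<s0+\<delta>} \<Longrightarrow>
      (\<xi> i has_vector_derivative - (velocity (velocity \<gamma>) s \<bullet> \<xi> i s) *\<^sub>R velocity \<gamma> s) (at s)"
    by (rule parallel_frame_exists[OF dim unit_speed s0], rule that)
  have mem: "(s0, t0) \<in> {x \<in> A \<times> B. chord (fst x) (snd x) \<noteq> 0}" using s0 t0 nz0 by simp
  obtain A1 B1 where A1: "open A1" "open B1" "(s0, t0) \<in> A1 \<times> B1" "A1 \<times> B1 \<subseteq> {x \<in> A \<times> B. chord (fst x) (snd x) \<noteq> 0}"
    by (rule open_prod_elim[OF open_chord_nonzero mem], rule that)
  have "s0 \<in> A1" "t0 \<in> B1" using A1(3) by auto
  then obtain r1 r2 where r1: "r1 > 0" "ball s0 r1 \<subseteq> A1" and r2: "r2 > 0" "ball t0 r2 \<subseteq> B1"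
    using A1(1,2) unfolding open_contains_ball by blast
  define d where "d = min \<delta> r1"
  define I where "I = {s0-d<..<s0+d}"
  define J1 where "J1 = {t0-r2<..<t0+r2}"
  have d: "d > 0" "d \<le> \<delta>" "d \<le> r1" using \<delta> r1 by (auto simp: d_def)
  have I\<delta>: "I \<subseteq> {s0-\<delta><..<s0+\<delta>}" using d by (auto simp: I_def)
  have IA: "I \<subseteq> A" using I\<delta> \<delta>(2) by blast
  have IJ: "(s, t) \<in> A1 \<times> B1" if "s \<in> I" "t \<in> J1" for s t
  proof -
    have "s \<in> ball s0 r1" "t \<in> ball t0 r2" using that d by (auto simp: I_def J1_def ball_eq_greaterThanLessThan)
    then show ?thesis using r1 r2 by auto
  qed
  have s0I: "s0 \<in> I" and t0J: "t0 \<in> J1" using d r2 by (auto simp: I_def J1_def)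
  have J1B: "J1 \<subseteq> B" using IJ[OF s0I] A1(4) by auto
  have nz: "chord s t \<noteq> 0" if "s \<in> I" "t \<in> J1" for s t using IJ[OF that] A1(4) by force
  have I: "open I" "is_interval I" "open_interval I" and J1: "open J1" "is_interval J1" "open_interval J1"
    using s0I t0J by (auto simp: I_def J1_def is_interval_oo open_interval_def)
  have fr: "\<xi> i s \<bullet> velocity \<gamma> s = 0" "\<xi> i s \<bullet> \<xi> j s = (if i = j then 1 else 0)" if "s \<in> I" for s i j
    using frame I\<delta> that unfolding parallel_orthonormal_frame_def by blast+
  have sm\<xi>: "smooth_on I (\<xi> i)" for i
    by (rule smooth_on_subset[OF _ I\<delta>]) (use frame in \<open>simp add: parallel_orthonormal_frame_def\<close>)
  have frameI: "parallel_orthonormal_frame I \<gamma> \<xi>"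
    using frame I\<delta> sm\<xi> unfolding parallel_orthonormal_frame_def by blast
  obtain P where P: "smooth_on I P" "\<And>s. s \<in> I \<Longrightarrow> (P has_real_derivative \<ll> s) (at s)"
    by (rule smooth_antiderivative[OF smooth_on_subset[OF sm_\<ll> IA[unfolded I_def]], folded I_def], rule that)
  \<comment> \<open>The choice of the primitive P is immaterial: it scales \<phi> and N by the same
    factor and leaves the map unchanged. The exponential form ensures that \<phi> has no
    zeros.\<close>
  define \<phi> where "\<phi> = (\<lambda>s. exp (- P s))"
  have \<phi>0: "\<phi> s \<noteq> 0" for s by (simp add: \<phi>_def)
  have sm\<phi>: "smooth_on I \<phi>" unfolding \<phi>_def by (intro smooth_on_exp smooth_on_minus I P)
  have d\<phi>: "(\<phi> has_real_derivative - \<ll> s * \<phi> s) (at s)" if "s \<in> I" for s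
    unfolding \<phi>_def using P(2)[OF that] by (auto intro!: derivative_eq_intros)
  have deriv\<phi>: "deriv \<phi> s = - \<ll> s * \<phi> s" if "s \<in> I" for s by (rule DERIV_imp_deriv[OF d\<phi>[OF that]])
  define k where "k = (\<lambda>i s. velocity (velocity \<gamma>) s \<bullet> \<xi> i s)"
  \<comment> \<open>The normal components of -2 \<phi> c / |c|^2, which is what c = -2 \<phi> N /
    |N|^2 gives when solved for N.\<close>
  define b where "b = (\<lambda>i s t. - 2 * \<phi> s * (chord s t \<bullet> \<xi> i s) / (chord s t \<bullet> chord s t))"
  have db: "((\<lambda>s. b i s t) has_real_derivative \<phi> s * \<ll> s * k i s) (at s)" if s: "s \<in> I" and t: "t \<in> J1" for i s t
    unfolding b_def k_def
    by (rule inverted_chord_derivative[OF subsetD[OF IA s] subsetD[OF J1B t] nz[OF s t] d\<xi>'[OF subsetD[OF I\<delta> s]] fr(1)[OF s] d\<phi>[OF s]])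
  have split: "b i s t - b i s t0 = b i s0 t - b i s0 t0" if s: "s \<in> I" and t: "t \<in> J1" for i s t
  proof (rule constant_on_interval[OF I(2) _ s s0I])
    fix s assume s: "s \<in> I"
    have "((\<lambda>s. b i s t - b i s t0) has_real_derivative \<phi> s * \<ll> s * k i s - \<phi> s * \<ll> s * k i s) (at s)"
      by (intro DERIV_diff db s t t0J)
    then show "((\<lambda>s. b i s t - b i s t0) has_vector_derivative 0) (at s)"
      by (simp add: has_real_derivative_iff_has_vector_derivative)
  qed
  \<comment> \<open>A splitting of b is determined up to opposite constants. Here \<beta> is
    normalized to vanish at s0, so that \<alpha>0 carries the values there.\<close>
  define \<beta> where "\<beta> = (\<lambda>i s. b i s t0 - b i s0 t0)"
  define \<alpha>0 :: "real \<Rightarrow> real^'n" where "\<alpha>0 = (\<lambda>t. \<chi> i. b i s0 t)"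
  have b_eq: "\<beta> i s + \<alpha>0 t $ i = b i s t" if "s \<in> I" "t \<in> J1" for i s t
    using split[OF that, of i] by (simp add: \<beta>_def \<alpha>0_def)
  have sm\<beta>: "smooth_on I (\<beta> i)" for i
  proof -
    have "smooth_on I (\<lambda>s. chord s t0)"
      unfolding chord_def by (intro smooth_on_diff I smooth_on_subset[OF _ IA] smooth_on_slices(1)[OF A(1) B(1) smw t0] sm_\<gamma>)
    then show ?thesis
      unfolding \<beta>_def b_def
      by (intro smooth_on_diff smooth_on_divide smooth_on_mult smooth_on_inner smooth_on_const sm\<phi> sm\<xi> I) (use nz t0J s0I in auto)
  qed
  have smcs0: "smooth_on J1 (\<lambda>t. chord s0 t)"
    unfolding chord_def by (intro smooth_on_diff smooth_on_const J1 smooth_on_subset[OF _ J1B] smooth_on_slices(2)[OF A(1) B(1) smw s0])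
  have sm\<alpha>0: "smooth_on J1 \<alpha>0"
    unfolding \<alpha>0_def b_def
    by (intro smooth_on_vec_lambda smooth_on_divide smooth_on_mult smooth_on_inner smooth_on_const J1 smcs0) (use nz s0I in simp)
  have d\<alpha>0: "(\<alpha>0 has_vector_derivative velocity \<alpha>0 t) (at t)" if "t \<in> J1" for t
    by (rule smooth_on_has_vector_derivative[OF sm\<alpha>0 that])
  define y where "y = (\<lambda>s t. (- 2 * \<phi> s / (chord s t \<bullet> chord s t)) *\<^sub>R chord s t)"
  \<comment> \<open>Compared in the orthonormal frame: the component along \<gamma>' is -\<ll>
    \<phi> = \<phi>' by the sphere equation, and the normal ones are b.\<close>
  have y_eq: "y s t = deriv \<phi> s *\<^sub>R velocity \<gamma> s + (\<Sum>i\<in>UNIV. (\<beta> i s + \<alpha>0 t $ i) *\<^sub>R \<xi> i s)" if s: "s \<in> I" and t: "t \<in> J1" for s t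
  proof -
    have q0: "chord s t \<bullet> chord s t \<noteq> 0" using nz[OF s t] by simp
    have e: "chord s t \<bullet> velocity \<gamma> s = \<ll> s * (chord s t \<bullet> chord s t) / 2"
      using chord_eq[OF subsetD[OF IA s] subsetD[OF J1B t]] by (simp add: inner_commute)
    have "y s t \<bullet> velocity \<gamma> s = - 2 * \<phi> s / (chord s t \<bullet> chord s t) * (chord s t \<bullet> velocity \<gamma> s)"
      unfolding y_def by (rule inner_scaleR_left)
    then have 1: "y s t \<bullet> velocity \<gamma> s = deriv \<phi> s"
      unfolding e deriv\<phi>[OF s] using q0 by simp
    have 2: "y s t \<bullet> \<xi> i s = \<beta> i s + \<alpha>0 t $ i" for i
      unfolding b_eq[OF s t] by (simp add: y_def b_def)
    show ?thesis
      using orthonormal_expansion[OF dim velocity_\<gamma>_unit[OF subsetD[OF IA s]], of "\<lambda>i. \<xi> i s" "y s t"] fr[OF s] by (simp add: 1 2)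
  qed
  \<comment> \<open>Zero speed would make the inverted chord at s0 stationary in t, hence also the
    chord, contrary to w_t being nonzero.\<close>
  have v0: "velocity \<alpha>0 t \<noteq> 0" if t: "t \<in> J1" for t
  proof
    assume 0: "velocity \<alpha>0 t = 0"
    have "((\<lambda>t. \<alpha>0 t $ i) has_vector_derivative 0) (at t)" for i
      using bounded_linear.has_vector_derivative[OF bounded_linear_vec_nth d\<alpha>0[OF t], of i] 0 by simp
    then have a: "((\<lambda>t. \<alpha>0 t $ i) has_real_derivative 0) (at t)" for i
      by (simp add: has_real_derivative_iff_has_vector_derivative)
    have "((\<lambda>t. (\<beta> i s0 + \<alpha>0 t $ i) *\<^sub>R \<xi> i s0) has_vector_derivative (\<beta> i s0 + \<alpha>0 t $ i) *\<^sub>R 0 + 0 *\<^sub>R \<xi> i s0) (at t)" for i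
      by (rule has_vector_derivative_scaleR[OF _ has_vector_derivative_const]) (use a[of i] in \<open>auto intro!: derivative_eq_intros\<close>)
    then have "((\<lambda>t. (\<beta> i s0 + \<alpha>0 t $ i) *\<^sub>R \<xi> i s0) has_vector_derivative 0) (at t)" for i by simp
    then have "((\<lambda>t. deriv \<phi> s0 *\<^sub>R velocity \<gamma> s0 + (\<Sum>i\<in>UNIV. (\<beta> i s0 + \<alpha>0 t $ i) *\<^sub>R \<xi> i s0)) has_vector_derivative
        0 + (\<Sum>i\<in>(UNIV::'n set). 0)) (at t)"
      by (intro has_vector_derivative_add has_vector_derivative_const has_vector_derivative_sum)
    then have "((\<lambda>t. deriv \<phi> s0 *\<^sub>R velocity \<gamma> s0 + (\<Sum>i\<in>UNIV. (\<beta> i s0 + \<alpha>0 t $ i) *\<^sub>R \<xi> i s0)) has_vector_derivative 0) (at t)"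
      by simp
    then have "((\<lambda>t. y s0 t) has_vector_derivative 0) (at t)"
      by (rule has_vector_derivative_transform_within_open[OF _ J1(1) t]) (simp add: y_eq[OF s0I])
    note dy = bounded_linear.has_vector_derivative[OF bounded_linear_scaleR_right this, of "inverse (- 2 * \<phi> s0)"]
    have "inverse (- 2 * \<phi> s0) *\<^sub>R y s0 t = inverse (chord s0 t \<bullet> chord s0 t) *\<^sub>R chord s0 t" for t
    proof -
      have cancel: "inverse m * (m / q) = inverse q" if "m \<noteq> 0" for m q :: real
        using that by (simp add: divide_inverse)
      have nz2: "- 2 * \<phi> s0 \<noteq> 0" using \<phi>0 by simp
      show ?thesis unfolding y_def scaleR_scaleR cancel[OF nz2] by (rule refl)
    qed
    then have "((\<lambda>t. inverse (chord s0 t \<bullet> chord s0 t) *\<^sub>R chord s0 t) has_vector_derivative 0) (at t)"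
      using dy by (simp only: scaleR_zero_right)
    from zero_derivative_of_inversion[OF chord_slice_t[OF s0 subsetD[OF J1B t]] nz[OF s0I t] this]
    show False using partial_w_nonzero(2)[of "(s0, t)"] s0 J1B t by auto
  qed
  have smv: "smooth_on J1 (\<lambda>t. norm (velocity \<alpha>0 t))"
    by (intro smooth_on_norm J1 smooth_on_velocity sm\<alpha>0 v0)
  \<comment> \<open>The speed of \<alpha>0 is nonzero but not yet 1. Passing to arc length changes t
    alone, so the coordinates remain curvature line coordinates.\<close>
  obtain J \<tau> \<tau>' where J: "open_interval J" and im: "\<tau>' ` J1 = J" "\<tau> ` J = J1"
    and inv: "\<And>x. x \<in> J1 \<Longrightarrow> \<tau> (\<tau>' x) = x" "\<And>y. y \<in> J \<Longrightarrow> \<tau>' (\<tau> y) = y"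
    and sm\<tau>: "smooth_on J1 \<tau>'" "smooth_on J \<tau>"
    and d\<tau>: "\<And>y. y \<in> J \<Longrightarrow> (\<tau> has_real_derivative inverse (norm (velocity \<alpha>0 (\<tau> y)))) (at y)"
    by (rule positive_speed_reparametrization[OF J1_def _ smv]) (use r2 v0 in auto)
  have \<tau>J: "\<tau> t \<in> J1" if "t \<in> J" for t using im(2) that by blast
  have opJ: "open J" using J by (simp add: open_interval_def)
  define \<alpha> where "\<alpha> = (\<lambda>t. \<alpha>0 (\<tau> t))"
  have sm\<alpha>: "smooth_on J \<alpha>"
    unfolding \<alpha>_def by (rule smooth_on_compose[OF opJ J1(1) _ sm\<alpha>0 sm\<tau>(2)]) (simp add: im)
  have vel\<alpha>: "norm (velocity \<alpha> t) = 1" if t: "t \<in> J" for t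
  proof -
    have "(\<alpha> has_vector_derivative inverse (norm (velocity \<alpha>0 (\<tau> t))) *\<^sub>R velocity \<alpha>0 (\<tau> t)) (at t)"
      using vector_diff_chain_at[OF d\<tau>[OF t, unfolded has_real_derivative_iff_has_vector_derivative] d\<alpha>0[OF \<tau>J[OF t]]]
      by (simp add: o_def \<alpha>_def)
    then show ?thesis using v0[OF \<tau>J[OF t]] by (simp add: vector_derivative_at)
  qed
  have us\<alpha>: "unit_speed_curve J \<alpha>" unfolding unit_speed_curve_def using J sm\<alpha> vel\<alpha> by blast
  have us\<gamma>: "unit_speed_curve I \<gamma>"
    unfolding unit_speed_curve_def using I(3) smooth_on_subset[OF sm_\<gamma> IA] unit_speed IA
    by (auto simp: unit_speed_curve_def)
  have acc: "velocity (velocity \<gamma>) s = (\<Sum>i\<in>UNIV. k i s *\<^sub>R \<xi> i s)" if s: "s \<in> I" for s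
  proof -
    have sA: "s \<in> A" using s IA by blast
    have v: "(velocity \<gamma> has_vector_derivative velocity (velocity \<gamma>) s) (at s)"
      by (rule smooth_on_has_vector_derivative[OF smooth_on_velocity[OF A(1) sm_\<gamma>] sA])
    have "((\<lambda>s. velocity \<gamma> s \<bullet> velocity \<gamma> s) has_vector_derivative
        velocity \<gamma> s \<bullet> velocity (velocity \<gamma>) s + velocity (velocity \<gamma>) s \<bullet> velocity \<gamma> s) (at s)"
      by (rule bounded_bilinear.has_vector_derivative[OF bounded_bilinear_inner v v])
    moreover have "((\<lambda>s. velocity \<gamma> s \<bullet> velocity \<gamma> s) has_vector_derivative 0) (at s)"
      by (rule has_vector_derivative_transform_within_open[OF has_vector_derivative_const[of 1] A(1) sA])
        (simp add: velocity_\<gamma>_unit)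
    ultimately have "velocity \<gamma> s \<bullet> velocity (velocity \<gamma>) s + velocity (velocity \<gamma>) s \<bullet> velocity \<gamma> s = 0"
      by (rule vector_derivative_unique_at)
    then have "velocity (velocity \<gamma>) s \<bullet> velocity \<gamma> s = 0" by (simp add: inner_commute)
    then show ?thesis
      using orthonormal_expansion[OF dim velocity_\<gamma>_unit[OF sA], of "\<lambda>i. \<xi> i s" "velocity (velocity \<gamma>) s"] fr[OF s]
      by (simp add: k_def)
  qed
  have \<beta>k: "deriv (\<beta> i) s + deriv \<phi> s * k i s = 0" if s: "s \<in> I" for i s
  proof -
    have "(\<beta> i has_real_derivative \<phi> s * \<ll> s * k i s - 0) (at s)"
      unfolding \<beta>_def by (intro DERIV_diff db[OF s t0J] DERIV_const)
    then have "deriv (\<beta> i) s = \<phi> s * \<ll> s * k i s" by (simp add: DERIV_imp_deriv)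
    then show ?thesis by (simp add: deriv\<phi>[OF s])
  qed
  have data: "construction_data I J \<gamma> \<xi> k \<phi> \<beta> \<alpha>"
    unfolding construction_data_def using us\<gamma> frameI acc sm\<phi> sm\<beta> \<beta>k us\<alpha> by blast
  interpret c: construction I J \<gamma> \<xi> k \<phi> \<beta> \<alpha> by unfold_locales (rule data)
  define \<psi>2 where "\<psi>2 = (\<lambda>(s, t). \<psi> (s, \<tau> t))"
  have "curvature_coordinates U g L I J1 \<psi>"
    by (rule curvature_coordinates_restrict[OF cc I(3) IA J1(3) J1B])
  then have cc2: "curvature_coordinates U g L I J \<psi>2"
    unfolding \<psi>2_def
    by (rule curvature_coordinates_reparametrize[OF g L, where \<sigma> = "\<lambda>s. s" and \<sigma>' = "\<lambda>s. s"])
      (use I J im inv sm\<tau> in \<open>auto intro: smooth_on_ident\<close>)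
  interpret q: curvature_patch U g L I J \<psi>2 by unfold_locales (rule g L cc2)+
  have N: "c.N s t = y s (\<tau> t)" if "s \<in> I" "t \<in> J" for s t
    unfolding c.N_def y_eq[OF that(1) \<tau>J[OF that(2)]] by (simp add: \<alpha>_def)
  have NN: "c.N s t \<bullet> c.N s t \<noteq> 0" if "s \<in> I" "t \<in> J" for s t
    using nz[OF that(1) \<tau>J[OF that(2)]] \<phi>0[of s] by (simp add: N[OF that] y_def)
  have f_eq: "construction_map \<gamma> \<xi> \<phi> \<beta> \<alpha> x = q.w x" if x: "x \<in> I \<times> J" for x
  proof -
    obtain s t where st: "x = (s, t)" "s \<in> I" "t \<in> J" using x by auto
    let ?d = "chord s (\<tau> t)"
    have q0: "?d \<bullet> ?d \<noteq> 0" using nz[OF st(2) \<tau>J[OF st(3)]] by simp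
    \<comment> \<open>Inversion is an involution up to scale: N = m c / |c|^2 has |N|^2 = m^2 /
      |c|^2, so m N / |N|^2 is again c.\<close>
    have scaled_N: "(- 2 * \<phi> s) *\<^sub>R (inverse (c.N s t \<bullet> c.N s t) *\<^sub>R c.N s t) = ?d"
    proof -
      define m where "m = - 2 * \<phi> s"
      have m0: "m \<noteq> 0" using \<phi>0 by (simp add: m_def)
      have Nm: "c.N s t = (m / (?d \<bullet> ?d)) *\<^sub>R ?d" unfolding N[OF st(2,3)] y_def m_def ..
      have NNm: "c.N s t \<bullet> c.N s t = m * m / (?d \<bullet> ?d)" unfolding Nm using q0 by simp
      have "m *\<^sub>R (inverse (c.N s t \<bullet> c.N s t) *\<^sub>R c.N s t) = (m * inverse (m * m / (?d \<bullet> ?d)) * (m / (?d \<bullet> ?d))) *\<^sub>R ?d"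
        unfolding NNm unfolding Nm by simp
      also have "m * inverse (m * m / (?d \<bullet> ?d)) * (m / (?d \<bullet> ?d)) = 1"
        using m0 q0 by (simp add: field_simps)
      finally show ?thesis by (simp add: m_def)
    qed
    have "construction_map \<gamma> \<xi> \<phi> \<beta> \<alpha> x
        = \<gamma> s + (- 2 * \<phi> s) *\<^sub>R (inverse (c.N s t \<bullet> c.N s t) *\<^sub>R c.N s t)"
      unfolding st c.f_eq'[OF st(2)] by simp
    then have "construction_map \<gamma> \<xi> \<phi> \<beta> \<alpha> x = \<gamma> s + ?d" unfolding scaled_N .
    then show ?thesis unfolding q.w_def chord_def w_def by (simp add: \<psi>2_def st)
  qed
  \<comment> \<open>The denominator is |N|^2, which is nonzero, and injectivity is inherited from
    the immersed surface, with which the map agrees on the open rectangle.\<close>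
  have reg: "I \<times> J = regular_points I J \<gamma> \<xi> \<phi> \<beta> \<alpha>"
  proof (intro equalityI subsetI)
    fix x assume x: "x \<in> I \<times> J"
    then obtain s t where st: "x = (s, t)" "s \<in> I" "t \<in> J" by auto
    have "construction_denom \<phi> \<beta> \<alpha> x \<noteq> 0" using NN[OF st(2,3)] c.N_N[OF st(2)] by (simp add: st)
    moreover have "frechet_derivative (construction_map \<gamma> \<xi> \<phi> \<beta> \<alpha>) (at x) = frechet_derivative q.w (at x)"
      by (rule frechet_derivative_cong[OF q.opAB x f_eq])
    ultimately show "x \<in> regular_points I J \<gamma> \<xi> \<phi> \<beta> \<alpha>"
      using q.inj_Dw[OF x] x by (simp add: regular_points_def)
  qed (simp add: regular_points_def)
  have "\<tau>' t0 \<in> J" "\<tau> (\<tau>' t0) = t0" using im(1) inv(1) t0J by blast+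
  then have "\<psi>2 (s0, \<tau>' t0) = \<psi> (s0, t0)" "(s0, \<tau>' t0) \<in> I \<times> J" using s0I by (auto simp: \<psi>2_def)
  then have p: "\<psi> (s0, t0) \<in> \<psi>2 ` (I \<times> J)" by (metis imageI)
  obtain \<Phi> where \<Phi>: "smooth_on (\<psi>2 ` (I \<times> J)) \<Phi>" "\<And>x. x \<in> I \<times> J \<Longrightarrow> \<Phi> (\<psi>2 x) = x"
    by (rule curvature_coordinates_inverse[OF cc2], rule that)
  have injon: "inj_on \<psi>2 (I \<times> J)" by (rule inj_on_inverseI[of _ \<Phi>]) (rule \<Phi>(2))
  have "smooth_on (\<psi>2 ` (I \<times> J)) (inv_into (I \<times> J) \<psi>2)"
  proof (rule smooth_on_cong[OF q.op_image, THEN iffD2, OF _ \<Phi>(1)])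
    fix z assume "z \<in> \<psi>2 ` (I \<times> J)"
    then obtain x where x: "x \<in> I \<times> J" "z = \<psi>2 x" by (rule imageE)
    then show "inv_into (I \<times> J) \<psi>2 z = \<Phi> z" using \<Phi>(2) injon by simp
  qed
  then have diffeo: "diffeomorphism_between (I \<times> J) (\<psi>2 ` (I \<times> J)) \<psi>2"
    unfolding diffeomorphism_between_def using q.opAB q.op_image q.sm\<psi> injon by (simp add: bij_betw_def)
  have map_eq: "\<forall>x\<in>I \<times> J. g (\<psi>2 x) = construction_map \<gamma> \<xi> \<phi> \<beta> \<alpha> x" using f_eq by (simp add: q.w_def)
  have lines: "\<forall>s\<in>I. line_of_family U g L J (\<lambda>t. \<psi>2 (s, t))" using q.t_curve_in_family by blast
  show ?thesis
    by (rule exI[of _ I], rule exI[of _ J], rule exI[of _ \<gamma>], rule exI[of _ \<xi>], rule exI[of _ k],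
        rule exI[of _ \<phi>], rule exI[of _ \<beta>], rule exI[of _ \<alpha>], rule exI[of _ "\<psi>2 ` (I \<times> J)"],
        rule exI[of _ \<psi>2]) (intro conjI data reg p q.image_sub diffeo map_eq lines)
qed

end

text \<open>Since w_t is nonzero, the t-curve through p is not constant, so it contains a point
  different from p. The s-curve through that point fixes t1, and s is replaced by its arc length;
  the chord at p is then nonzero.\<close>

lemma adapted_patch_exists:
  fixes g :: "real \<times> real \<Rightarrow> real^'m::finite"
  assumes g: "immersed_surface U g" and nu: "\<And>q. q \<in> U \<Longrightarrow> \<not> umbilic g q"
    and L: "curvature_line_field U g L"
    and const: "\<And>K c. line_of_family U g L K c \<Longrightarrow> constant_geodesic_curvature g K c"
    and p: "p \<in> U"
  obtains A B \<psi> t1 s0 t0 where "adapted_patch U g L A B \<psi> t1" "s0 \<in> A" "t0 \<in> B" "\<psi> (s0, t0) = p" "g (\<psi> (s0, t0)) \<noteq> g (\<psi> (s0, t1))"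
proof -
  obtain l m l' m' \<psi>0 x0 where cc0: "curvature_coordinates U g L {l<..<m} {l'<..<m'} \<psi>0"
    and x0: "x0 \<in> {l<..<m} \<times> {l'<..<m'}" "\<psi>0 x0 = p"
    by (rule curvature_coordinates_exist[OF g nu L p], assumption, rule that)
  define A0 B where "A0 = {l<..<m}" and "B = {l'<..<m'}"
  obtain r0 t0 where rt: "x0 = (r0, t0)" by (cases x0)
  have r0: "r0 \<in> A0" and t0: "t0 \<in> B" using x0 rt by (auto simp: A0_def B_def)
  interpret c0: curvature_patch U g L A0 B \<psi>0
    by unfold_locales (use g L cc0 in \<open>auto simp: A0_def B_def\<close>)
  have x0': "(r0, t0) \<in> A0 \<times> B" using r0 t0 by simp
  have "\<exists>t1\<in>B. c0.w (r0, t0) \<noteq> c0.w (r0, t1)"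
  proof (rule ccontr)
    assume "\<not> (\<exists>t1\<in>B. c0.w (r0, t0) \<noteq> c0.w (r0, t1))"
    then have "((\<lambda>t. c0.w (r0, t)) has_vector_derivative 0) (at t0)"
      by (intro has_vector_derivative_transform_within_open[OF has_vector_derivative_const[of "c0.w (r0, t0)"] c0.B(1) t0]) auto
    then show False
      using vector_derivative_unique_at[OF c0.w_slice[OF x0']] c0.partial_w_nonzero(2)[OF x0'] by blast
  qed
  then obtain t1 where t1: "t1 \<in> B" "c0.w (r0, t0) \<noteq> c0.w (r0, t1)" by blast
  have smv: "smooth_on A0 (\<lambda>s. c0.E (s, t1))" by (rule smooth_on_slices(1)[OF c0.A(1) c0.B(1) c0.smE t1(1)])
  have lm: "l < m" using r0 by (auto simp: A0_def)
  obtain A \<sigma> \<sigma>' where A: "open_interval A" and im: "\<sigma>' ` A0 = A" "\<sigma> ` A = A0"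
    and inv: "\<And>x. x \<in> A0 \<Longrightarrow> \<sigma> (\<sigma>' x) = x" "\<And>y. y \<in> A \<Longrightarrow> \<sigma>' (\<sigma> y) = y"
    and sm: "smooth_on A0 \<sigma>'" "smooth_on A \<sigma>"
    and d: "\<And>y. y \<in> A \<Longrightarrow> (\<sigma> has_real_derivative inverse (c0.E (\<sigma> y, t1))) (at y)"
    by (rule positive_speed_reparametrization[OF A0_def lm smv]) (use c0.E_pos t1 in auto)
  define \<psi> where "\<psi> = (\<lambda>(s, t). \<psi>0 (\<sigma> s, t))"
  have cc: "curvature_coordinates U g L A B \<psi>"
    unfolding \<psi>_def
    by (rule curvature_coordinates_reparametrize[OF g L c0.cc, where \<tau> = "\<lambda>t. t" and \<tau>' = "\<lambda>t. t"])
      (use A c0.oi(2) c0.B im inv sm in \<open>auto intro: smooth_on_ident\<close>)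
  interpret c: curvature_patch U g L A B \<psi> by unfold_locales (rule g L cc)+
  have \<sigma>A: "\<sigma> s \<in> A0" if "s \<in> A" for s using im(2) that by blast
  have w_eq: "c.w (s, t) = c0.w (\<sigma> s, t)" for s t 
    unfolding c.w_def c0.w_def by (simp add: \<psi>_def)
  have "adapted_patch U g L A B \<psi> t1"
  proof unfold_locales
    show "t1 \<in> B" by (rule t1)
    fix s assume s: "s \<in> A"
    have x: "(\<sigma> s, t1) \<in> A0 \<times> B" using \<sigma>A[OF s] t1 by simp
    have "((\<lambda>s. c0.w (\<sigma> s, t1)) has_vector_derivative inverse (c0.E (\<sigma> s, t1)) *\<^sub>R partial_s c0.w (\<sigma> s, t1)) (at s)"
      using vector_diff_chain_at[OF d[OF s, unfolded has_real_derivative_iff_has_vector_derivative] c0.w_slice_s[OF x]]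
      by (simp add: o_def)
    then have "partial_s c.w (s, t1) = inverse (c0.E (\<sigma> s, t1)) *\<^sub>R partial_s c0.w (\<sigma> s, t1)"
      using s t1 by (intro partial_s_eqI[OF c.dw]) (auto simp: w_eq)
    then show "c.E (s, t1) = 1" using c0.E_pos[OF x] by (simp add: c.E_def) (simp add: c0.E_def)
    fix t assume t: "t \<in> B"
    \<comment> \<open>The t-curve belongs to the family, so |\<nu>| is constant along it. Continuity
      on the interval then makes \<nu> itself constant.\<close>
    obtain \<kappa> where \<kappa>: "\<And>t. t \<in> B \<Longrightarrow> geodesic_curvature g (\<lambda>t. \<psi> (s, t)) t = \<kappa>"
      using const[OF c.t_curve_in_family[OF s]] unfolding constant_geodesic_curvature_def by blast
    have "\<bar>c.\<nu> (s, t)\<bar> = \<kappa>" if "t \<in> B" for t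
      using \<kappa>[OF that] c.geodesic_curvature_t_curve[of s t] s that by simp
    then show "c.\<nu> (s, t) = c.\<nu> (s, t1)"
      by (intro constant_if_constant_abs[OF c.B(2) smooth_on_imp_continuous_on[OF smooth_on_slices(2)[OF c.A(1) c.B(1) c.sm\<nu> s]] _ t t1(1)])
  qed
  moreover have "\<sigma>' r0 \<in> A" "\<sigma> (\<sigma>' r0) = r0" using im(1) inv(1) r0 by blast+
  ultimately show thesis
    using that[of A B \<psi> t1 "\<sigma>' r0" t0] t0 t1(2) x0(2) rt by (auto simp: \<psi>_def c0.w_def)
qed

theorem corollary11:
  assumes dim: "CARD('m::finite) = CARD('n::finite) + 1"
  shows
    "(\<forall>I J (\<gamma> :: real \<Rightarrow> real^'m) (\<xi> :: 'n \<Rightarrow> real \<Rightarrow> real^'m) k \<phi> \<beta> \<alpha> f R.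
        construction_data I J \<gamma> \<xi> k \<phi> \<beta> \<alpha> \<and>
        f = construction_map \<gamma> \<xi> \<phi> \<beta> \<alpha> \<and> R = regular_points I J \<gamma> \<xi> \<phi> \<beta> \<alpha> \<longrightarrow>
          immersed_surface R f \<and>
          flat_normal_bundle R f \<and>
          (\<forall>t K. open_interval K \<and> (\<forall>s\<in>K. (s, t) \<in> R) \<longrightarrow> line_of_curvature R f K (\<lambda>s. (s, t))) \<and>
          (\<forall>s K. open_interval K \<and> (\<forall>t\<in>K. (s, t) \<in> R) \<longrightarrow> line_of_curvature R f K (\<lambda>t. (s, t))) \<and>
          (\<forall>s. constant_geodesic_curvature f {t. (s, t) \<in> R} (\<lambda>t. (s, t))))
     \<and>
     (\<forall>U (g :: real \<times> real \<Rightarrow> real^'m) L.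
        immersed_surface U g \<and> (\<forall>p\<in>U. \<not> umbilic g p) \<and> flat_normal_bundle U g \<and>
        curvature_line_field U g L \<and>
        (\<forall>K c. line_of_family U g L K c \<longrightarrow> constant_geodesic_curvature g K c) \<longrightarrow>
          (\<forall>p\<in>U. \<exists>I J (\<gamma> :: real \<Rightarrow> real^'m) (\<xi> :: 'n \<Rightarrow> real \<Rightarrow> real^'m) k \<phi> \<beta> \<alpha> V \<psi>.
             construction_data I J \<gamma> \<xi> k \<phi> \<beta> \<alpha> \<and>
             I \<times> J = regular_points I J \<gamma> \<xi> \<phi> \<beta> \<alpha> \<and>
             p \<in> V \<and> V \<subseteq> U \<and>
             diffeomorphism_between (I \<times> J) V \<psi> \<and>
             (\<forall>x\<in>I \<times> J. g (\<psi> x) = construction_map \<gamma> \<xi> \<phi> \<beta> \<alpha> x) \<and>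
             (\<forall>s\<in>I. line_of_family U g L J (\<lambda>t. \<psi> (s, t)))))"
proof (rule conjI; intro allI impI ballI)
  fix I J and \<gamma> :: "real \<Rightarrow> real^'m" and \<xi> :: "'n \<Rightarrow> real \<Rightarrow> real^'m" and k \<phi> \<beta> \<alpha> f R
  assume *: "construction_data I J \<gamma> \<xi> k \<phi> \<beta> \<alpha> \<and>
        f = construction_map \<gamma> \<xi> \<phi> \<beta> \<alpha> \<and> R = regular_points I J \<gamma> \<xi> \<phi> \<beta> \<alpha>"
  interpret c: construction I J \<gamma> \<xi> k \<phi> \<beta> \<alpha> by unfold_locales (use * in blast)
  have f: "f = construction_map \<gamma> \<xi> \<phi> \<beta> \<alpha>" and R: "R = regular_points I J \<gamma> \<xi> \<phi> \<beta> \<alpha>" using * by auto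
  show "immersed_surface R f \<and>
          flat_normal_bundle R f \<and>
          (\<forall>t K. open_interval K \<and> (\<forall>s\<in>K. (s, t) \<in> R) \<longrightarrow> line_of_curvature R f K (\<lambda>s. (s, t))) \<and>
          (\<forall>s K. open_interval K \<and> (\<forall>t\<in>K. (s, t) \<in> R) \<longrightarrow> line_of_curvature R f K (\<lambda>t. (s, t))) \<and>
          (\<forall>s. constant_geodesic_curvature f {t. (s, t) \<in> R} (\<lambda>t. (s, t)))"
    unfolding f R using c.immersed c.flat c.s_curves c.t_curves c.t_curves_constant_geodesic_curvature by blast
next
  fix U and g :: "real \<times> real \<Rightarrow> real^'m" and L p
  assume *: "immersed_surface U g \<and> (\<forall>p\<in>U. \<not> umbilic g p) \<and> flat_normal_bundle U g \<and>
        curvature_line_field U g L \<and>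
        (\<forall>K c. line_of_family U g L K c \<longrightarrow> constant_geodesic_curvature g K c)" and p: "p \<in> U"
  then have g: "immersed_surface U g" and nu: "\<And>q. q \<in> U \<Longrightarrow> \<not> umbilic g q" and L: "curvature_line_field U g L"
    and const: "\<And>K c. line_of_family U g L K c \<Longrightarrow> constant_geodesic_curvature g K c" by blast+
  obtain A B \<psi> t1 s0 t0 where patch: "adapted_patch U g L A B \<psi> t1" and st: "s0 \<in> A" "t0 \<in> B" "\<psi> (s0, t0) = p"
    and ne: "g (\<psi> (s0, t0)) \<noteq> g (\<psi> (s0, t1))"
    by (rule adapted_patch_exists[OF g nu L const p], assumption, assumption, rule that)
  interpret adapted_patch U g L A B \<psi> t1 by (rule patch)
  have "chord s0 t0 \<noteq> 0" using ne by (simp add: chord_def \<gamma>_def w_def)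
  from construction_exists[OF dim st(1,2) this]
  show "\<exists>I J (\<gamma> :: real \<Rightarrow> real^'m) (\<xi> :: 'n \<Rightarrow> real \<Rightarrow> real^'m) k \<phi> \<beta> \<alpha> V \<psi>.
             construction_data I J \<gamma> \<xi> k \<phi> \<beta> \<alpha> \<and>
             I \<times> J = regular_points I J \<gamma> \<xi> \<phi> \<beta> \<alpha> \<and>
             p \<in> V \<and> V \<subseteq> U \<and>
             diffeomorphism_between (I \<times> J) V \<psi> \<and>
             (\<forall>x\<in>I \<times> J. g (\<psi> x) = construction_map \<gamma> \<xi> \<phi> \<beta> \<alpha> x) \<and>
             (\<forall>s\<in>I. line_of_family U g L J (\<lambda>t. \<psi> (s, t)))"
    unfolding st(3) .
qed

end
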